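(* Let $\mathcal{X}=\mathbb{P}_{fr}^{d-1}(\mathcal{O}_r)$ with $|\mathcal{O}/\mathfrak{p}|=q$, and let $2\le n\le d-1$. The adjacency spectrum of the graph $\mathcal{X}_{1,n}$ is as follows (for each entry with $\pm$, the stated multiplicity is that of each of the two signs): - $\pm\sqrt{\binom{d-1}{n-1}_q[n]_q\,q^{(r-1)\left((d-1)^2-(d-1)n+2n-2\right)}}$, with multiplicity $1$; - $\pm\sqrt{\binom{d-2}{n-1}_q\,q^{(d-2)(r-1)(d-n)+r(n-1)}}$, with multiplicity $[d]_q-1$; - for each $0\le k\le r-2$: $\pm\sqrt{\binom{d-2}{n-1}_q\,q^{(d-2)(r-1)(d-n)}\cdot q^{(k+1)(n-1)}}$, with multiplicity $q^{(r-2-k)(d-1)}(q^{d-1}-1)[d]_q$; - $0$, with multiplicity $\binom{d}{n}_q q^{(r-1)n(d-n)}-[d]_q q^{(d-1)(r-1)}$. In particular, the spectral expansion (maximal normalized non-trivial eigenvalue) of $\mathcal{X}_{1,n}$ is approximately $1/\sqrt{q^{n-1}}$.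
   Context: Let $\mathcal{O}$ be a Dedekind domain, $\mathfrak{p}\trianglelefteq\mathcal{O}$ a prime ideal of finite residue order $q=|\mathcal{O}/\mathfrak{p}|$, $r\ge1$, and $\mathcal{O}_r=\mathcal{O}/\mathfrak{p}^r$, a finite local ring of size $q^r$. The free projective $d$-space $\mathbb{P}_{fr}^{d-1}(\mathcal{O}_r)$ is the simplicial complex whose vertices are the free submodules $0\lneq V\lneq\mathcal{O}_r^d$, and whose cells are the flags of such free submodules. $\mathcal{X}_{1,n}$ is the induced bipartite graph on the free submodules of rank $1$ and of rank $n$, with adjacency given by inclusion. Here $[n]_q=\frac{q^n-1}{q-1}$, $[n]_{!q}=[n]_q[n-1]_q\cdots[1]_q$, and $\binom{d}{n}_q=\frac{[d]_{!q}}{[n]_{!q}[d-n]_{!q}}$. The trivial eigenvalues are $\pm$ the Perron-Frobenius eigenvalue, and a normalized eigenvalue is an eigenvalue divided by the Perron-Frobenius eigenvalue.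
   Formalization: The exponent (d-2)(r-1)(d-n) in items 2 and 3 is corrected to (n-1)(r-1)(d-n), and that of item 1 to (r-1)(n-1)(d-n+1); the printed values fail unless r=1 or n=d-1. The prime is taken nonzero, and "approximately" means relative error at most 1/q. *)

theory Defs
  imports
    "HOL-Algebra.Algebra"
    "Jordan_Normal_Form.Missing_VectorSpace"
    "Jordan_Normal_Form.Char_Poly"
begin

section \<open>Dedekind domains and the rings \<open>\<O>\<^sub>r\<close>\<close>

text \<open>
  Integral closedness is stated without constructing the fraction field: the assumption on
  \<open>a\<close> and \<open>b\<close> is the monic equation
  \<open>(a/b)^m + (\<Sum>i<m. c i * (a/b)^i) = 0\<close> multiplied by \<open>b^m\<close>, and the conclusion says that
  \<open>a/b\<close> lies in \<open>R\<close>. With these axioms a field is a (degenerate) Dedekind domain.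
\<close>

locale dedekind_domain = noetherian_domain +
  assumes integrally_closed:
    "\<And>a b c (m::nat).
      \<lbrakk>a \<in> carrier R; b \<in> carrier R - {\<zero>}; c \<in> {..<m} \<rightarrow> carrier R;
       a [^] m \<oplus> (\<Oplus>i\<in>{..<m}. c i \<otimes> a [^] i \<otimes> b [^] (m - i)) = \<zero>\<rbrakk>
      \<Longrightarrow> b divides a"
    and prime_is_maximal:
    "\<And>P. \<lbrakk>primeideal P R; P \<noteq> {\<zero>}\<rbrakk> \<Longrightarrow> maximalideal P R"

definition quot_ring_pow :: "('a, 'b) ring_scheme \<Rightarrow> 'a set \<Rightarrow> nat \<Rightarrow> 'a set ring" where
  "quot_ring_pow R P r = R Quot (P [^]\<^bsub>ideals_set R\<^esub> r)"

section \<open>The free projective space and the graphs \<open>\<X>\<^sub>1\<^sub>,\<^sub>n\<close>\<close>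

text \<open>\<open>S\<^sup>d\<close>, realised as the functions \<open>{0, \<dots>, d-1} \<rightarrow> S\<close> with pointwise operations.\<close>

definition free_mod :: "('a, 'b) ring_scheme \<Rightarrow> nat \<Rightarrow> ('a, nat \<Rightarrow> 'a) module" where
  "free_mod S d = LinearCombinations.ring.func_space S {..<d}"

definition free_submodule_of_rank ::
  "('a, 'b) ring_scheme \<Rightarrow> ('a, 'c, 'e) module_scheme \<Rightarrow> nat \<Rightarrow> 'c set \<Rightarrow> bool" where
  "free_submodule_of_rank S M m V \<longleftrightarrow>
     (\<exists>B. finite B \<and> card B = m \<and> B \<subseteq> carrier M \<and>
          \<not> LinearCombinations.module.lin_dep S M B \<and>
          LinearCombinations.module.span S M B = V)"

definition fr_proj_vertices :: "('a, 'b) ring_scheme \<Rightarrow> nat \<Rightarrow> (nat \<Rightarrow> 'a) set set" where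
  "fr_proj_vertices S d =
     {V. (\<exists>m. free_submodule_of_rank S (free_mod S d) m V) \<and>
         V \<noteq> {\<zero>\<^bsub>free_mod S d\<^esub>} \<and> V \<noteq> carrier (free_mod S d)}"

definition fr_proj_cells :: "('a, 'b) ring_scheme \<Rightarrow> nat \<Rightarrow> (nat \<Rightarrow> 'a) set set set" where
  "fr_proj_cells S d =
     {F. finite F \<and> F \<noteq> {} \<and> F \<subseteq> fr_proj_vertices S d \<and> (\<forall>V\<in>F. \<forall>W\<in>F. V \<subseteq> W \<or> W \<subseteq> V)}"

definition X1n_vertices :: "('a, 'b) ring_scheme \<Rightarrow> nat \<Rightarrow> nat \<Rightarrow> (nat \<Rightarrow> 'a) set set" where
  "X1n_vertices S d n =
     {V \<in> fr_proj_vertices S d.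
        free_submodule_of_rank S (free_mod S d) 1 V \<or> free_submodule_of_rank S (free_mod S d) n V}"

text \<open>
  The graph is induced from the one-skeleton: two distinct vertices are adjacent iff they form a
  flag, i.e. iff one contains the other.
\<close>

definition fr_proj_adj ::
  "('a, 'b) ring_scheme \<Rightarrow> nat \<Rightarrow> (nat \<Rightarrow> 'a) set \<Rightarrow> (nat \<Rightarrow> 'a) set \<Rightarrow> bool" where
  "fr_proj_adj S d V W \<longleftrightarrow> V \<noteq> W \<and> {V, W} \<in> fr_proj_cells S d"

section \<open>Adjacency spectra\<close>

definition adjacency_mat :: "'v list \<Rightarrow> ('v \<Rightarrow> 'v \<Rightarrow> bool) \<Rightarrow> real mat" where
  "adjacency_mat vs adj =
     mat (length vs) (length vs) (\<lambda>(i, j). if adj (vs ! i) (vs ! j) then 1 else 0)"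

text \<open>
  The multiset of eigenvalues of a finite undirected graph. It does not depend on the chosen
  enumeration of the vertices, since reordering conjugates the matrix by a permutation matrix, and
  no eigenvalue is lost by working over the reals because the matrix is symmetric.
\<close>

definition adjacency_spectrum :: "'v set \<Rightarrow> ('v \<Rightarrow> 'v \<Rightarrow> bool) \<Rightarrow> real multiset" where
  "adjacency_spectrum V adj =
     proots (char_poly (adjacency_mat (SOME vs. distinct vs \<and> set vs = V) adj))"

definition perron_eigenvalue :: "real multiset \<Rightarrow> real" where
  "perron_eigenvalue Sp = Max (set_mset Sp)"

definition spectral_expansion :: "real multiset \<Rightarrow> real" where
  "spectral_expansion Sp =
     Max {x / perron_eigenvalue Sp | x.
            x \<in># Sp \<and> x \<noteq> perron_eigenvalue Sp \<and> x \<noteq> - perron_eigenvalue Sp}"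

definition pm_mset :: "nat \<Rightarrow> real \<Rightarrow> real multiset" where
  "pm_mset m x = replicate_mset m x + replicate_mset m (- x)"

section \<open>Gaussian numbers\<close>

definition q_int :: "nat \<Rightarrow> nat \<Rightarrow> nat" where
  "q_int q n = (q ^ n - 1) div (q - 1)"

definition q_fact :: "nat \<Rightarrow> nat \<Rightarrow> nat" where
  "q_fact q n = (\<Prod>i = 1..n. q_int q i)"

definition q_binomial :: "nat \<Rightarrow> nat \<Rightarrow> nat \<Rightarrow> nat" where
  "q_binomial q d n = q_fact q d div (q_fact q n * q_fact q (d - n))"

text \<open>The natural-number divisions in these definitions are exact for \<open>q \<ge> 2\<close>.\<close>

lemma q_int_eq_sum:
  assumes "q \<ge> 2"
  shows "q_int q n = (\<Sum>i<n. q ^ i)"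
proof -
  have "q ^ n - 1 = (q - 1) * (\<Sum>i<n. q ^ i)"
  proof (induction n)
    case (Suc n)
    have "(q - 1) * (\<Sum>i<Suc n. q ^ i) = (q ^ n - 1) + (q - 1) * q ^ n"
      using Suc by (simp add: distrib_left)
    also have "\<dots> = q ^ Suc n - 1"
      using assms by (simp add: diff_mult_distrib)
    finally show ?case by simp
  qed simp
  then show ?thesis
    using assms by (simp add: q_int_def)
qed

lemma q_int_exact:
  assumes "q \<ge> 2"
  shows "real (q_int q n) = (real q ^ n - 1) / (real q - 1)"
  using assms geometric_sum[of "real q" n] by (simp add: q_int_eq_sum)

lemma q_int_add:
  assumes "q \<ge> 2"
  shows "q_int q (m + n) = q_int q m + q ^ m * q_int q n"
  unfolding q_int_eq_sum[OF assms] by (induction n) (simp_all add: power_add algebra_simps)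

lemma q_fact_dvd:
  assumes "q \<ge> 2"
  shows "q_fact q m * q_fact q n dvd q_fact q (m + n)"
proof (induction "m + n" arbitrary: m n)
  case 0
  then show ?case by (simp add: q_fact_def)
next
  case (Suc k)
  have Suc_fact: "q_fact q (Suc j) = q_fact q j * q_int q (Suc j)" for j
    by (simp add: q_fact_def)
  show ?case
  proof (cases "m = 0 \<or> n = 0")
    case True
    then show ?thesis by (auto simp: q_fact_def)
  next
    case False
    then obtain m' n' where mn: "m = Suc m'" "n = Suc n'"
      by (metis not0_implies_Suc)
    have k: "k = m' + n" "k = m + n'"
      using Suc(2) mn by auto
    have "q_fact q m' * q_fact q n dvd q_fact q k" "q_fact q m * q_fact q n' dvd q_fact q k"
      using Suc(1)[OF k(1)] Suc(1)[OF k(2)] k by auto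
    then have "q_fact q m * q_fact q n dvd q_fact q k * q_int q m"
      "q_fact q m * q_fact q n dvd q_fact q k * q_int q n"
      unfolding mn Suc_fact by (metis mult.assoc mult.commute mult_dvd_mono dvd_refl)+
    then have "q_fact q m * q_fact q n dvd q_fact q k * q_int q m + q ^ m * (q_fact q k * q_int q n)"
      by (rule dvd_add[OF _ dvd_mult])
    then have "q_fact q m * q_fact q n dvd q_fact q k * (q_int q m + q ^ m * q_int q n)"
      by (simp only: distrib_left mult.left_commute)
    then show ?thesis
      using Suc(2) q_int_add[OF assms, of m n] Suc_fact[of k] by simp
  qed
qed

lemma q_binomial_exact:
  assumes "q \<ge> 2" "n \<le> d"
  shows "real (q_binomial q d n) = real (q_fact q d) / (real (q_fact q n) * real (q_fact q (d - n)))"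
  using q_fact_dvd[OF assms(1), of n "d - n"] assms(2)
  by (simp add: q_binomial_def real_of_nat_div)

text \<open>
  A free line of \<open>\<O>\<^sub>r\<^sup>d\<close> lies in
  \<open>q_binomial q (d - 1) (n - 1) * q ^ ((r - 1) * (n - 1) * (d - n))\<close> free submodules of rank \<open>n\<close>,
  namely the free submodules of rank \<open>n - 1\<close> of \<open>\<O>\<^sub>r\<^sup>d\<^sup>-\<^sup>1\<close>. This is the source of
  the exponent \<open>(n - 1) * (r - 1) * (d - n)\<close> occurring in every nonzero eigenvalue of
  \<open>\<X>\<^sub>1\<^sub>,\<^sub>n\<close>. It is printed as \<open>(d - 2) * (r - 1) * (d - n)\<close> in the literature
  (correspondingly \<open>(r - 1) * ((d - 1)^2 - (d - 1) * n + 2 * n - 2)\<close> instead of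
  \<open>(r - 1) * (n - 1) * (d - n + 1)\<close> for the largest eigenvalue), which agrees with the correct value
  exactly when \<open>n = d - 1\<close> or \<open>r = 1\<close>.
\<close>

end

theory Submission
  imports Defs
begin

text \<open>
  A Dedekind domain is locally a discrete valuation ring: a nonzero prime \<open>P\<close> is a colon ideal
  \<open>(a : b)\<close>, and integral closedness rules out \<open>(b/a) P \<subseteq> P\<close>, so some \<open>c \<in> P\<close> generates \<open>P\<close> up
  to elements outside \<open>P\<close>. Hence \<open>R/P^r\<close> is a finite chain ring with uniformizer \<open>c\<close>.

  Let \<open>B\<close> be the incidence matrix between lines and free submodules of rank \<open>n\<close>. Automorphisms act
  transitively on pairs of lines that agree modulo \<open>p^k\<close> but not modulo \<open>p^(k+1)\<close>, so the entries
  of \<open>B B\<^sup>T\<close> depend on this level \<open>k\<close> only. Thus \<open>B B\<^sup>T\<close> is a combination of the averaging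
  projections onto the congruence classes of lines, which are nested and hence simultaneously
  diagonal; its eigenvalues follow from double counting of the sums over a class. The spectrum of
  the bipartite graph consists of the square roots, completed by zeros.
\<close>

section \<open>Local structure of Dedekind domains\<close>

text \<open>Fractions are never formed: multiplication by b/a is the relation b x = a y, and powers
  of b/a are followed along an orbit. Quotient modules are not formed either: congruence modulo p^k
  is equality of the sets V + p^k M, and counting inside a free submodule V rests on its purity,
  that V meets p^k M exactly in p^k V. The eigenvalue at level j comes from a function g that is
  constant on the classes of level j and has sum zero over each class of level j-1. Let s_j be the
  class size, W_j the sum of a row of the matrix over the class of level j, and N_(j-1) the entry
  for pairs that agree at level j-1 but not at level j. The class of level j contributes W_j g(u),
  the rest of the class of level j-1 contributes -s_j N_(j-1) g(u), and all coarser shells cancel.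
  So the eigenvalue is W_j - s_j N_(j-1). The sums W_j are counted inside the submodules of rank n,
  and the entries N_j follow from differences. Instead of constructing eigenspaces, the proof
  computes determinants of combinations of the nested projections by a recursion that divides by the
  parameters; it is therefore applied only off the eigenvalues, which suffices for an identity of
  polynomials.\<close>

lemma (in noetherian_ring) sequence_dependent:
  assumes cr: "cring R" and x: "\<And>i::nat. x i \<in> carrier R"
  obtains m c where "c \<in> {..<m} \<rightarrow> carrier R" "x m = (\<Oplus>i\<in>{..<m}. c i \<otimes> x i)"
proof -
  interpret cring R by (rule cr)
  \<comment> \<open>\<open>J k\<close> is the ideal generated by \<open>x 0, ..., x (k-1)\<close>.
    The ascending chain becomes stationary at some \<open>m\<close>, and then \<open>x m\<close>, an
    element of \<open>J (Suc m)\<close>, already lies in \<open>J m\<close>.\<close>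
  define J where "J = rec_nat {\<zero>} (\<lambda>k I. I <+> PIdl (x k))"
  have J0: "J 0 = {\<zero>}" and JSuc: "J (Suc k) = J k <+> PIdl (x k)" for k by (simp_all add: J_def)
  have idJ: "ideal (J k) R" for k
    by (induction k) (simp_all add: J0 JSuc zeroideal add_ideals cgenideal_ideal x)
  note zero = additive_subgroup.zero_closed[OF ideal.axioms(1)]
  have xJ: "x k \<in> J (Suc k)" and Jsub: "J k \<subseteq> J (Suc k)" for k
  proof -
    have "x k = \<zero> \<oplus> x k" using x by simp
    then show "x k \<in> J (Suc k)"
      unfolding JSuc set_add_def' using zero[OF idJ[of k]] cgenideal_self[OF x[of k]] by blast
    have "y = y \<oplus> \<zero>" if "y \<in> J k" for y using ideal.Icarr[OF idJ that] by simp
    then show "J k \<subseteq> J (Suc k)"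
      unfolding JSuc set_add_def' using zero[OF cgenideal_ideal[OF x[of k]]] by blast
  qed
  have sums: "\<exists>c. c \<in> {..<k} \<rightarrow> carrier R \<and> y = (\<Oplus>i\<in>{..<k}. c i \<otimes> x i)" if "y \<in> J k" for k y
    using that
  proof (induction k arbitrary: y)
    case 0
    then show ?case by (simp add: J0)
  next
    case (Suc k)
    then obtain z b where z: "z \<in> J k" and b: "b \<in> carrier R" "y = z \<oplus> b \<otimes> x k"
      unfolding JSuc set_add_def' cgenideal_def by blast
    obtain c where c: "c \<in> {..<k} \<rightarrow> carrier R" "z = (\<Oplus>i\<in>{..<k}. c i \<otimes> x i)" using Suc.IH[OF z] by blast
    let ?c = "c(k := b)"
    have cc: "?c \<in> {..<Suc k} \<rightarrow> carrier R" using c(1) b(1) by (auto simp: Pi_iff less_Suc_eq)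
    have "(\<Oplus>i\<in>{..<Suc k}. ?c i \<otimes> x i) = b \<otimes> x k \<oplus> (\<Oplus>i\<in>{..<k}. ?c i \<otimes> x i)"
      using c(1) b(1) x by (subst lessThan_Suc, subst finsum_insert) (auto simp: Pi_def)
    also have "(\<Oplus>i\<in>{..<k}. ?c i \<otimes> x i) = z"
      unfolding c(2) using c(1) x by (intro finsum_cong') (auto simp: Pi_def)
    finally have "y = (\<Oplus>i\<in>{..<Suc k}. ?c i \<otimes> x i)"
      using b x ideal.Icarr[OF idJ z] by (simp add: a_comm)
    then show ?case using cc by blast
  qed
  have mono: "i \<le> j \<Longrightarrow> J i \<subseteq> J j" for i j using Jsub by (rule lift_Suc_mono_le)
  have "subset.chain {I. ideal I R} (range J)"
    unfolding Zorn.subset_chain_def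
  proof (intro conjI ballI)
    show "range J \<subseteq> {I. ideal I R}" using idJ by blast
    fix A B assume "A \<in> range J" "B \<in> range J"
    then obtain i j where "A = J i" "B = J j" by blast
    then show "A \<subseteq> B \<or> B \<subseteq> A" using mono[of i j] mono[of j i] nat_le_linear[of i j] by blast
  qed
  then have "\<Union>(range J) \<in> range J" by (intro ideal_chain_is_trivial) auto
  then obtain m where "\<Union>(range J) = J m" by auto
  then have "x m \<in> J m" using xJ by blast
  then show ?thesis using sums that by blast
qed

context dedekind_domain begin

text \<open>The orbit of \<open>p\<close> under multiplication by b/a stays in \<open>I\<close>, so
  by the Noetherian property one of its terms is a combination of earlier ones. Cancelling
  \<open>p\<close> leaves a monic equation for b/a, and integral closedness puts b/a into the
  ring.\<close>

lemma frac_mult_stable_imp_divides: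
  assumes a: "a \<in> carrier R" "a \<noteq> \<zero>" and b: "b \<in> carrier R"
    and I: "I \<subseteq> carrier R" "p \<in> I" "p \<noteq> \<zero>"
    and stable: "\<And>x. x \<in> I \<Longrightarrow> \<exists>y\<in>I. b \<otimes> x = a \<otimes> y"
  shows "a divides b"
proof -
  obtain h where h: "\<And>x. x \<in> I \<Longrightarrow> h x \<in> I \<and> b \<otimes> x = a \<otimes> h x" using stable by metis
  define x where "x k = (h ^^ k) p" for k
  have xI: "x k \<in> I" for k by (induction k) (auto simp: x_def I h)
  have xc: "x k \<in> carrier R" for k using xI I by auto
  have pc: "p \<in> carrier R" using I by auto
  \<comment> \<open>This is \<open>x k = (b/a)^k p\<close> without denominators.\<close>
  have xpow: "x k \<otimes> a [^] k = p \<otimes> b [^] k" for k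
  proof (induction k)
    case 0 then show ?case using pc by (simp add: x_def)
  next
    case (Suc k)
    have hx: "b \<otimes> x k = a \<otimes> x (Suc k)" using h[OF xI[of k]] by (simp add: x_def)
    have "x (Suc k) \<otimes> a [^] Suc k = (a \<otimes> x (Suc k)) \<otimes> a [^] k"
      using xc[of "Suc k"] a by (simp add: m_ac)
    also have "\<dots> = b \<otimes> (x k \<otimes> a [^] k)" using hx[symmetric] xc[of k] a b by (simp add: m_ac)
    also have "\<dots> = p \<otimes> b [^] Suc k" unfolding Suc using pc b by (simp add: m_ac)
    finally show ?case .
  qed
  obtain m c where c: "c \<in> {..<m} \<rightarrow> carrier R" "x m = (\<Oplus>i\<in>{..<m}. c i \<otimes> x i)"
    by (rule sequence_dependent[OF is_cring xc])
  have cc: "c i \<in> carrier R" if "i < m" for i using c that by auto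
  let ?s = "\<Oplus>i\<in>{..<m}. c i \<otimes> b [^] i \<otimes> a [^] (m - i)"
  have sc: "?s \<in> carrier R" using cc a b by (auto intro!: finsum_closed)
  have "p \<otimes> b [^] m = a [^] m \<otimes> (\<Oplus>i\<in>{..<m}. c i \<otimes> x i)"
    using xpow[of m] xc a c by (metis m_comm nat_pow_closed)
  also have "\<dots> = (\<Oplus>i\<in>{..<m}. a [^] m \<otimes> (c i \<otimes> x i))"
    using cc xc a by (intro finsum_rdistr) auto
  also have "\<dots> = (\<Oplus>i\<in>{..<m}. p \<otimes> (c i \<otimes> b [^] i \<otimes> a [^] (m - i)))"
  proof (rule finsum_cong')
    fix i assume i: "i \<in> {..<m}"
    then have "a [^] m = a [^] i \<otimes> a [^] (m - i)" using a by (simp add: nat_pow_mult)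
    then have "a [^] m \<otimes> (c i \<otimes> x i) = (x i \<otimes> a [^] i) \<otimes> c i \<otimes> a [^] (m - i)"
      using cc i xc[of i] a by (simp add: m_ac)
    also have "\<dots> = p \<otimes> (c i \<otimes> b [^] i \<otimes> a [^] (m - i))"
      unfolding xpow using cc i pc a b by (simp add: m_ac)
    finally show "a [^] m \<otimes> (c i \<otimes> x i) = p \<otimes> (c i \<otimes> b [^] i \<otimes> a [^] (m - i))" .
  qed (use cc a b pc in auto)
  also have "\<dots> = p \<otimes> ?s"
    using cc pc a b by (intro finsum_rdistr[symmetric]) auto
  finally have bm: "b [^] m = ?s" using I(3) pc b sc by (simp add: m_lcancel)
  \<comment> \<open>The coefficients change sign because \<open>integrally_closed\<close> expects
    the monic equation with right-hand side zero.\<close>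
  have "(\<Oplus>i\<in>{..<m}. (\<ominus> c i) \<otimes> b [^] i \<otimes> a [^] (m - i))
      = (\<Oplus>i\<in>{..<m}. (\<ominus> \<one>) \<otimes> (c i \<otimes> b [^] i \<otimes> a [^] (m - i)))"
    using cc a b by (intro finsum_cong') (auto simp: l_minus)
  also have "\<dots> = (\<ominus> \<one>) \<otimes> ?s"
    using cc a b by (intro finsum_rdistr[symmetric]) auto
  also have "\<dots> = \<ominus> (b [^] m)" unfolding bm[symmetric] using b by (simp add: l_minus)
  finally have "b [^] m \<oplus> (\<Oplus>i\<in>{..<m}. (\<ominus> c i) \<otimes> b [^] i \<otimes> a [^] (m - i)) = \<zero>"
    using b by (simp add: r_neg)
  then show ?thesis using integrally_closed[of b a "\<lambda>i. \<ominus> c i" m] a b cc by auto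
qed

lemma colon_ideal:
  assumes "a \<in> carrier R" "b \<in> carrier R"
  shows "ideal {x \<in> carrier R. a divides b \<otimes> x} R" (is "ideal ?J R")
proof (rule idealI)
  show "ring R" by (rule ring_axioms)
  show "subgroup ?J (add_monoid R)"
  proof (rule add.subgroupI)
    show "?J \<noteq> {}" using assms by (auto intro!: exI[of _ \<zero>] simp: factor_def intro!: bexI[of _ \<zero>])
    show "\<ominus> x \<in> ?J" if x: "x \<in> ?J" for x
    proof -
      obtain c where "c \<in> carrier R" "b \<otimes> x = a \<otimes> c" using x by (auto simp: factor_def)
      then have "b \<otimes> (\<ominus> x) = a \<otimes> (\<ominus> c)" using x assms by (simp add: r_minus)
      then show ?thesis using x \<open>c \<in> carrier R\<close> unfolding factor_def by blast
    qed
    show "x \<oplus> y \<in> ?J" if xy: "x \<in> ?J" "y \<in> ?J" for x y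
    proof -
      obtain c e where c: "c \<in> carrier R" "b \<otimes> x = a \<otimes> c" and e: "e \<in> carrier R" "b \<otimes> y = a \<otimes> e"
        using xy by (auto simp: factor_def)
      have "b \<otimes> (x \<oplus> y) = a \<otimes> (c \<oplus> e)" using c e xy assms by (simp add: r_distr)
      then show ?thesis using xy c(1) e(1) unfolding factor_def by blast
    qed
  qed auto
  show "y \<otimes> x \<in> ?J" if x: "x \<in> ?J" and y: "y \<in> carrier R" for x y
  proof -
    obtain c where c: "c \<in> carrier R" "b \<otimes> x = a \<otimes> c" using x by (auto simp: factor_def)
    have "b \<otimes> (y \<otimes> x) = y \<otimes> (b \<otimes> x)" using x y assms by (simp add: m_ac)
    also have "\<dots> = a \<otimes> (y \<otimes> c)" using c y assms by (simp add: m_ac)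
    finally show ?thesis using c x y by (auto simp: factor_def intro!: bexI[of _ "y \<otimes> c"])
  qed
  then show "x \<otimes> y \<in> ?J" if x: "x \<in> ?J" and y: "y \<in> carrier R" for x y
    using that by (simp add: m_comm[of x y])
qed

lemma ex_maximal_ideal_in:
  assumes "\<C> \<noteq> {}" "\<And>I. I \<in> \<C> \<Longrightarrow> ideal I R"
  obtains M where "M \<in> \<C>" "\<And>I. I \<in> \<C> \<Longrightarrow> M \<subseteq> I \<Longrightarrow> I = M"
proof -
  have "\<exists>M\<in>\<C>. \<forall>J\<in>\<C>. M \<subseteq> J \<longrightarrow> J = M"
  proof (rule subset_Zorn_nonempty[OF assms(1)])
    fix C assume C: "C \<noteq> {}" "subset.chain \<C> C"
    then have "subset.chain {I. ideal I R} C" using assms(2) by (auto simp: Zorn.subset_chain_def)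
    then have "\<Union>C \<in> C" using C(1) by (rule ideal_chain_is_trivial[rotated])
    then show "\<Union>C \<in> \<C>" using C(2) by (auto simp: Zorn.subset_chain_def)
  qed
  then show ?thesis using that by blast
qed

text \<open>
  A nonzero prime \<open>P\<close> is the colon ideal \<open>(a : b)\<close>: a maximal element among the
  colon ideals \<open>(a : b) \<subseteq> P\<close> is itself prime, hence maximal, hence \<open>P\<close>.
\<close>

lemma prime_eq_colon:
  assumes P: "primeideal P R" and a: "a \<in> P" "a \<noteq> \<zero>"
  obtains b where "b \<in> carrier R" "P = {x \<in> carrier R. a divides b \<otimes> x}"
proof -
  interpret P: primeideal P R by (rule P)
  have ac: "a \<in> carrier R" using a by auto
  define col where "col b = {x \<in> carrier R. a divides b \<otimes> x}" for b
  have idc: "ideal (col b) R" if "b \<in> carrier R" for b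
    unfolding col_def by (rule colon_ideal[OF ac that])
  have colD: "x \<in> col b \<longleftrightarrow> x \<in> carrier R \<and> a divides b \<otimes> x" for x b by (simp add: col_def)
  define \<C> where "\<C> = {col b | b. b \<in> carrier R \<and> col b \<subseteq> P}"
  \<comment> \<open>The family is nonempty: (a : 1) is the principal ideal of \<open>a\<close>,
    which lies in \<open>P\<close>.\<close>
  have "col \<one> \<subseteq> P" using a ac by (auto simp: col_def factor_def P.I_r_closed)
  then have "\<C> \<noteq> {}" unfolding \<C>_def by blast
  moreover have "ideal I R" if "I \<in> \<C>" for I using that idc by (auto simp: \<C>_def)
  ultimately obtain M where M: "M \<in> \<C>" "\<And>I. I \<in> \<C> \<Longrightarrow> M \<subseteq> I \<Longrightarrow> I = M"
    using ex_maximal_ideal_in[of \<C>] by blast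
  obtain b where b: "b \<in> carrier R" "M = col b" "col b \<subseteq> P" using M(1) by (auto simp: \<C>_def)
  \<comment> \<open>Passing from \<open>b\<close> to \<open>b x\<close> can only enlarge the colon
    ideal, so by maximality a strictly larger one has left \<open>P\<close>.\<close>
  have grow: "\<not> col (b \<otimes> x) \<subseteq> P" if x: "x \<in> carrier R" and y: "y \<in> col (b \<otimes> x)" "y \<notin> col b" for x y
  proof
    assume "col (b \<otimes> x) \<subseteq> P"
    then have "col (b \<otimes> x) \<in> \<C>" using b x by (auto simp: \<C>_def)
    moreover have "col b \<subseteq> col (b \<otimes> x)"
    proof
      fix z assume z: "z \<in> col b"
      then have "x \<otimes> z \<in> col b" using ideal.I_l_closed[OF idc[OF b(1)]] x by auto
      then show "z \<in> col (b \<otimes> x)" using z x b by (simp add: colD m_assoc)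
    qed
    ultimately have "col (b \<otimes> x) = col b" using M(2) b by auto
    then show False using y by auto
  qed
  have "primeideal (col b) R"
  proof (intro primeidealI idc b is_cring)
    show "carrier R \<noteq> col b" using b(3) P.I_notcarr P.Icarr by blast
    fix x y assume xy: "x \<in> carrier R" "y \<in> carrier R" "x \<otimes> y \<in> col b"
    show "x \<in> col b \<or> y \<in> col b"
    proof (rule ccontr)
      \<comment> \<open>Maximality is used twice: it yields \<open>s\<close> outside
        \<open>P\<close> with \<open>x s\<close> in \<open>col b\<close>, and then \<open>t\<close>
        outside \<open>P\<close> with \<open>s t\<close> in \<open>col b\<close>. As
        \<open>col b\<close> lies in \<open>P\<close>, this contradicts the primality of
        \<open>P\<close>.\<close>
      assume neg: "\<not> (x \<in> col b \<or> y \<in> col b)"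
      have "y \<in> col (b \<otimes> x)" using xy b by (simp add: colD m_assoc)
      then have "\<not> col (b \<otimes> x) \<subseteq> P" using grow[of x y] xy neg by blast
      then obtain s where s: "s \<in> carrier R" "a divides b \<otimes> x \<otimes> s" "s \<notin> P"
        unfolding col_def by blast
      have "x \<in> col (b \<otimes> s)" using s xy b by (simp add: colD m_ac)
      then have "\<not> col (b \<otimes> s) \<subseteq> P" using grow[of s x] xy neg s by blast
      then obtain t where t: "t \<in> carrier R" "a divides b \<otimes> s \<otimes> t" "t \<notin> P"
        unfolding col_def by blast
      have "s \<otimes> t \<in> col b" using s t b by (simp add: colD m_assoc)
      then show False using b(3) s t P.I_prime by blast
    qed
  qed
  \<comment> \<open>\<open>col b\<close> contains \<open>a\<close>, hence is nonzero and, being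
    prime, maximal.\<close>
  moreover have "b \<otimes> a = a \<otimes> b" using ac b(1) by (rule m_comm[rotated])
  then have "a \<in> col b" using ac b(1) unfolding colD factor_def by blast
  ultimately have "maximalideal (col b) R" using a(2) prime_is_maximal[of "col b"] by blast
  then have "P = col b \<or> P = carrier R"
    using maximalideal.I_maximal[of "col b" R P] P.is_ideal b(3) P.a_subset by blast
  then have "P = col b" using P.I_notcarr by auto
  then show ?thesis unfolding col_def by (rule that[OF b(1)])
qed

text \<open>Localised at \<open>P\<close>, the element \<open>c\<close> generates \<open>P\<close>.
  Since \<open>P = (a : b)\<close>, the fraction b/a maps \<open>P\<close> into the ring; if it
  mapped \<open>P\<close> into \<open>P\<close>, then \<open>a\<close> would divide \<open>b\<close>
  and \<open>P\<close> would contain 1. So some \<open>c\<close> in \<open>P\<close> has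
  \<open>e = b c / a\<close> outside \<open>P\<close>, and then \<open>e x = c (b x / a)\<close> for
  every \<open>x\<close> in \<open>P\<close>.\<close>

lemma local_uniformizer:
  assumes P: "primeideal P R" and P0: "P \<noteq> {\<zero>}"
  obtains c e where "c \<in> P" "c \<noteq> \<zero>" "e \<in> carrier R" "e \<notin> P"
    "\<And>x. x \<in> P \<Longrightarrow> \<exists>y\<in>carrier R. e \<otimes> x = c \<otimes> y"
proof -
  interpret P: primeideal P R by (rule P)
  obtain a where a: "a \<in> P" "a \<noteq> \<zero>" using P0 P.zero_closed by blast
  have ac: "a \<in> carrier R" using a by auto
  obtain b where b: "b \<in> carrier R" "P = {x \<in> carrier R. a divides b \<otimes> x}"
    using prime_eq_colon[OF P a] .
  have "\<not> a divides b"
  proof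
    assume "a divides b"
    then have "a divides b \<otimes> \<one>" using b(1) by simp
    then have "\<one> \<in> P" unfolding b(2) by simp
    then show False using P.I_notcarr P.one_imp_carrier by blast
  qed
  have "\<not> (\<forall>x\<in>P. \<exists>y\<in>P. b \<otimes> x = a \<otimes> y)"
  proof
    assume "\<forall>x\<in>P. \<exists>y\<in>P. b \<otimes> x = a \<otimes> y"
    then have "a divides b"
      using frac_mult_stable_imp_divides[OF ac a(2) b(1) P.a_subset a] by metis
    then show False using \<open>\<not> a divides b\<close> by simp
  qed
  then obtain c where c: "c \<in> P" "\<And>y. y \<in> P \<Longrightarrow> b \<otimes> c \<noteq> a \<otimes> y" by blast
  have "a divides b \<otimes> x" if "x \<in> P" for x using that unfolding b(2) by simp
  then obtain h where h: "\<And>x. x \<in> P \<Longrightarrow> h x \<in> carrier R \<and> b \<otimes> x = a \<otimes> h x"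
    unfolding factor_def by metis
  have cc: "c \<in> carrier R" using c by auto
  show ?thesis
  proof (rule that[of c "h c"])
    show "c \<in> P" "h c \<in> carrier R" "h c \<notin> P" using c h by blast+
    show "c \<noteq> \<zero>" using c(2)[of \<zero>] b(1) ac P.zero_closed by auto
    fix x assume x: "x \<in> P"
    have xc: "x \<in> carrier R" using x by auto
    have "a \<otimes> (h c \<otimes> x) = (b \<otimes> c) \<otimes> x" using h[OF c(1)] ac xc by (simp add: m_assoc)
    also have "\<dots> = c \<otimes> (b \<otimes> x)" using b(1) cc xc by (simp add: m_ac)
    also have "\<dots> = a \<otimes> (c \<otimes> h x)" using h[OF x] ac cc by (simp add: m_ac)
    finally have "h c \<otimes> x = c \<otimes> h x" using a ac h[OF c(1)] h[OF x] xc cc by (simp add: m_lcancel)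
    then show "\<exists>y\<in>carrier R. h c \<otimes> x = c \<otimes> y" using h[OF x] by blast
  qed
qed

end

section \<open>Powers of a prime and the quotient ring as a finite chain ring\<close>

definition (in ring) multiples :: "'a \<Rightarrow> 'a set" where
  "multiples a = (\<lambda>x. a \<otimes> x) ` carrier R"

text \<open>A local ring whose maximal ideal is generated by a nilpotent \<open>p\<close> of exact
  index \<open>r\<close>. Finiteness is demanded of the socle, the part that is readily compared
  with the residue field; finiteness of the whole ring follows in
  \<open>card_multiples_pow\<close>.\<close>

locale finite_chain_ring = cring R for R (structure) +
  fixes p :: 'a and r :: nat
  assumes uniformizer_closed [simp, intro]: "p \<in> carrier R"
    and nonunit: "\<And>x. x \<in> carrier R \<Longrightarrow> x \<notin> Units R \<Longrightarrow> x \<in> multiples p"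
    and uniformizer_pow_r: "p [^] r = \<zero>"
    and uniformizer_pow_less: "\<And>k. k < r \<Longrightarrow> p [^] k \<noteq> \<zero>"
    and length_pos: "1 \<le> r"
    and finite_socle: "finite (multiples (p [^] (r - 1)))"

text \<open>Compares two images of one set without a given map between them; it identifies the socle
  of the quotient by \<open>P^r\<close> with \<open>R Quot P\<close>.\<close>

lemma card_image_eq_if_same_kernel:
  assumes "\<And>x y. x \<in> A \<Longrightarrow> y \<in> A \<Longrightarrow> f x = f y \<longleftrightarrow> g x = g y"
  shows "card (f ` A) = card (g ` A)" "finite (f ` A) \<longleftrightarrow> finite (g ` A)"
proof -
  have "bij_betw (\<lambda>z. g (inv_into A f z)) (f ` A) (g ` A)"
  proof (rule bij_betw_imageI)
    show "inj_on (\<lambda>z. g (inv_into A f z)) (f ` A)"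
      using assms by (intro inj_onI) (metis f_inv_into_f inv_into_into)
    show "(\<lambda>z. g (inv_into A f z)) ` f ` A = g ` A"
    proof -
      have "g (inv_into A f (f x)) = g x" if "x \<in> A" for x
        using assms that by (metis f_inv_into_f image_eqI inv_into_into)
      then show ?thesis by (auto simp: image_image)
    qed
  qed
  then show "card (f ` A) = card (g ` A)" "finite (f ` A) \<longleftrightarrow> finite (g ` A)"
    by (auto dest: bij_betw_same_card bij_betw_finite)
qed

context dedekind_domain begin

abbreviation ideal_power :: "'a set \<Rightarrow> nat \<Rightarrow> 'a set" where
  "ideal_power P k \<equiv> P [^]\<^bsub>ideals_set R\<^esub> k"

lemma ideals_set_simps [simp]:
  "\<one>\<^bsub>ideals_set R\<^esub> = carrier R" "I \<otimes>\<^bsub>ideals_set R\<^esub> J = ideal_prod R I J"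
  by (simp_all add: ideals_set_def)

lemma ideal_power_0: "ideal_power P 0 = carrier R"
  by simp

lemma ideal_power_Suc: "ideal_power P (Suc k) = ideal_prod R (ideal_power P k) P"
  by simp

lemma ideal_power_ideal: "ideal P R \<Longrightarrow> ideal (ideal_power P k) R"
  by (induction k) (simp_all add: ideal_power_0 ideal_power_Suc oneideal ideal_prod_is_ideal)

lemma ideal_power_antimono:
  assumes "ideal P R" "j \<le> k"
  shows "ideal_power P k \<subseteq> ideal_power P j"
  using assms(2)
proof (rule lift_Suc_antimono_le[rotated])
  show "ideal_power P (Suc n) \<subseteq> ideal_power P n" for n
    unfolding ideal_power_Suc using ideal_prod_inter[OF ideal_power_ideal[OF assms(1)] assms(1)] by blast
qed

lemma ideal_power_le: "ideal P R \<Longrightarrow> 1 \<le> k \<Longrightarrow> ideal_power P k \<subseteq> P"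
proof -
  assume P: "ideal P R" and k: "1 \<le> k"
  have "ideal_power P 1 = P"
    using P by (simp add: ideal_prod_commute oneideal ideal_prod_one)
  then show ?thesis using ideal_power_antimono[OF P k] by simp
qed

lemma pow_mem_ideal_power:
  assumes P: "ideal P R" and c: "c \<in> P"
  shows "c [^] k \<in> ideal_power P k"
proof (induction k)
  case 0 then show ?case by (simp add: ideal_power_0)
next
  case (Suc k)
  then show ?case using c by (simp add: ideal_power_Suc ideal_prod.prod)
qed

text \<open>The uniformizer is the image of the \<open>c\<close> of
  \<open>local_uniformizer\<close>. Elements outside \<open>P\<close> become units modulo
  \<open>P^r\<close>, in particular \<open>e\<close> does, so the relation \<open>e x = c y\<close>
  turns the image of every element of \<open>P\<close> into a multiple of the image of
  \<open>c\<close>.\<close>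

lemma quot_ring_pow_chain_ring:
  assumes P: "primeideal P R" and P0: "P \<noteq> {\<zero>}"
    and fin: "finite (carrier (R Quot P))" and r: "1 \<le> r"
  obtains p where "finite_chain_ring (quot_ring_pow R P r) p r"
    "card (ring.multiples (quot_ring_pow R P r) (p [^]\<^bsub>quot_ring_pow R P r\<^esub> (r - 1)))
       = card (carrier (R Quot P))"
proof -
  interpret P: primeideal P R by (rule P)
  obtain c e where c: "c \<in> P" "c \<noteq> \<zero>" and e: "e \<in> carrier R" "e \<notin> P"
    and ec: "\<And>x. x \<in> P \<Longrightarrow> \<exists>y\<in>carrier R. e \<otimes> x = c \<otimes> y"
    using local_uniformizer[OF P P0] by blast
  have cc: "c \<in> carrier R" using c by auto
  have mx: "maximalideal P R" using prime_is_maximal P P0 by blast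
  define I where "I = ideal_power P r"
  define S where "S = quot_ring_pow R P r"
  define h where "h = (+>) I"
  have idI: "ideal I R" unfolding I_def by (rule ideal_power_ideal[OF P.is_ideal])
  have S: "S = R Quot I" by (simp add: S_def I_def quot_ring_pow_def)
  interpret I: ideal I R by (rule idI)
  interpret S: cring S unfolding S by (rule I.quotient_is_cring[OF is_cring])
  interpret h: ring_hom_ring R S h unfolding S h_def by (rule I.rcos_ring_hom_ring)
  have carS: "carrier S = h ` carrier R"
    unfolding S h_def FactRing_def A_RCOSETS_def' by auto
  have heq: "h x = h y \<longleftrightarrow> x \<ominus> y \<in> I" if "x \<in> carrier R" "y \<in> carrier R" for x y
    unfolding h_def using quotient_eq_iff_same_a_r_cos[OF idI that] by simp
  have h0: "h x = \<zero>\<^bsub>S\<^esub> \<longleftrightarrow> x \<in> I" if "x \<in> carrier R" for x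
    using heq[OF that zero_closed] that by (simp add: minus_eq)
  have IP: "I \<subseteq> P" unfolding I_def using ideal_power_le[OF P.is_ideal r] .
  \<comment> \<open>An inverse modulo \<open>P\<close> lifts successively to all powers of \<open>P\<close>.\<close>
  have inv: "\<exists>y\<in>carrier R. x \<otimes> y \<ominus> \<one> \<in> ideal_power P k" if x: "x \<in> carrier R" "x \<notin> P" for x k
  proof -
    have id: "ideal (P <+> PIdl x) R" using add_ideals[OF P.is_ideal cgenideal_ideal[OF x(1)]] .
    have sub: "P \<subseteq> P <+> PIdl x"
    proof
      fix y assume "y \<in> P"
      moreover have "\<zero> \<in> PIdl x"
        using additive_subgroup.zero_closed[OF ideal.axioms(1)[OF cgenideal_ideal[OF x(1)]]] .
      moreover have "y = y \<oplus> \<zero>" using \<open>y \<in> P\<close> by simp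
      ultimately show "y \<in> P <+> PIdl x" unfolding set_add_def' by blast
    qed
    have "x = \<zero> \<oplus> x" using x(1) by simp
    then have "x \<in> P <+> PIdl x"
      using cgenideal_self[OF x(1)] P.zero_closed unfolding set_add_def' by blast
    then have "P <+> PIdl x = carrier R"
      using maximalideal.I_maximal[OF mx id sub] ideal.Icarr[OF id] x(2) by blast
    then obtain u v where uv: "u \<in> P" "v \<in> PIdl x" "\<one> = u \<oplus> v"
      using one_closed unfolding set_add_def' by blast
    then obtain y where y: "y \<in> carrier R" "v = y \<otimes> x" by (auto simp: cgenideal_def)
    have uc: "u \<in> carrier R" using uv by auto
    have "x \<otimes> y \<ominus> \<one> = \<ominus> u" unfolding uv(3) y(2) using x y uc by algebra
    then have y1: "x \<otimes> y \<ominus> \<one> \<in> P" using uv by simp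
    show ?thesis
    proof (induction k)
      case 0 then show ?case using x y by (auto simp: ideal_power_0)
    next
      case (Suc k)
      then obtain z where z: "z \<in> carrier R" "x \<otimes> z \<ominus> \<one> \<in> ideal_power P k" by blast
      \<comment> \<open>Chosen so that \<open>1 - x w = (1 - x z)(1 - x y)\<close>: the first factor
        lies in \<open>P^k\<close>, the second in \<open>P\<close>.\<close>
      define w where "w = y \<oplus> z \<ominus> x \<otimes> y \<otimes> z"
      have w: "w \<in> carrier R" unfolding w_def using x y z by auto
      have "x \<otimes> w \<ominus> \<one> = \<ominus> ((x \<otimes> z \<ominus> \<one>) \<otimes> (x \<otimes> y \<ominus> \<one>))"
        unfolding w_def using x y z by algebra
      moreover have "(x \<otimes> z \<ominus> \<one>) \<otimes> (x \<otimes> y \<ominus> \<one>) \<in> ideal_power P (Suc k)"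
        unfolding ideal_power_Suc using z(2) y1 by (rule ideal_prod.prod)
      ultimately have "x \<otimes> w \<ominus> \<one> \<in> ideal_power P (Suc k)"
        using additive_subgroup.a_inv_closed[OF ideal.axioms(1)[OF ideal_power_ideal[OF P.is_ideal]]] by metis
      then show ?case using w by blast
    qed
  qed
  have unit: "h x \<in> Units S" if x: "x \<in> carrier R" "x \<notin> P" for x
  proof -
    obtain y where y: "y \<in> carrier R" "x \<otimes> y \<ominus> \<one> \<in> I" using inv[OF x, of r] by (auto simp: I_def)
    then have "h (x \<otimes> y) = h \<one>" using heq[of "x \<otimes> y" \<one>] x by blast
    then have "h x \<otimes>\<^bsub>S\<^esub> h y = \<one>\<^bsub>S\<^esub>" using x y by (metis h.hom_mult h.hom_one)
    moreover have "h x \<in> carrier S" "h y \<in> carrier S" using x y by auto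
    ultimately show ?thesis using S.m_comm[of "h x" "h y"] unfolding Units_def
      by (auto intro!: bexI[of _ "h y"])
  qed
  have hc: "h c \<in> carrier S" using cc by simp
  have hP: "h x \<in> S.multiples (h c)" if x: "x \<in> P" for x
  proof -
    obtain y where y: "y \<in> carrier R" "e \<otimes> x = c \<otimes> y" using ec[OF x] by blast
    have xc: "x \<in> carrier R" using x by auto
    have u: "h e \<in> Units S" using unit e by blast
    have "h e \<otimes>\<^bsub>S\<^esub> h x = h c \<otimes>\<^bsub>S\<^esub> h y" using y xc e cc by (metis h.hom_mult)
    then have "h x = inv\<^bsub>S\<^esub> (h e) \<otimes>\<^bsub>S\<^esub> (h c \<otimes>\<^bsub>S\<^esub> h y)"
      using u xc y cc
      by (metis S.Units_closed S.Units_inv_closed S.Units_l_inv S.l_one S.m_assoc h.hom_closed)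
    also have "\<dots> = h c \<otimes>\<^bsub>S\<^esub> (inv\<^bsub>S\<^esub> (h e) \<otimes>\<^bsub>S\<^esub> h y)"
      using u y hc by (simp add: S.m_lcomm)
    finally show ?thesis unfolding S.multiples_def using u y by auto
  qed
  \<comment> \<open>The k-th power of the uniformizer relation: \<open>e^k\<close> carries
    \<open>P^k\<close> into the multiples of \<open>c^k\<close>.\<close>
  have pow_e: "\<exists>y\<in>carrier R. e [^] k \<otimes> x = c [^] k \<otimes> y" if "x \<in> ideal_power P k" for x k
    using that
  proof (induction k arbitrary: x)
    case 0 then show ?case by (auto simp: ideal_power_0)
  next
    case (Suc k)
    have "x \<in> ideal_prod R (ideal_power P k) P" using Suc(2) unfolding ideal_power_Suc .
    then show ?case
    proof (induction x rule: ideal_prod.induct)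
      case (prod i j)
      obtain y where y: "y \<in> carrier R" "e [^] k \<otimes> i = c [^] k \<otimes> y" using Suc(1) prod by blast
      obtain z where z: "z \<in> carrier R" "e \<otimes> j = c \<otimes> z" using ec prod by blast
      have ic: "i \<in> carrier R" using prod ideal.Icarr[OF ideal_power_ideal[OF P.is_ideal]] by blast
      have jc: "j \<in> carrier R" using prod by auto
      have "e [^] Suc k \<otimes> (i \<otimes> j) = (e [^] k \<otimes> i) \<otimes> (e \<otimes> j)" using e ic jc by (simp add: m_ac)
      also have "\<dots> = c [^] Suc k \<otimes> (y \<otimes> z)" unfolding y z using y z cc by (simp add: m_ac)
      finally show ?case using y z by blast
    next
      case (sum a b)
      obtain y z where yz: "y \<in> carrier R" "e [^] Suc k \<otimes> a = c [^] Suc k \<otimes> y"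
         "z \<in> carrier R" "e [^] Suc k \<otimes> b = c [^] Suc k \<otimes> z" using sum by blast
      have ab: "a \<in> carrier R" "b \<in> carrier R"
        using sum(1,2) ideal_prod_in_carrier[OF ideal_power_ideal[OF P.is_ideal] P.is_ideal] by blast+
      have "e [^] Suc k \<otimes> (a \<oplus> b) = e [^] Suc k \<otimes> a \<oplus> e [^] Suc k \<otimes> b"
        using ab e by (simp add: r_distr del: nat_pow_Suc)
      also have "\<dots> = c [^] Suc k \<otimes> (y \<oplus> z)"
        unfolding yz using yz(1,3) cc by (simp add: r_distr del: nat_pow_Suc)
      finally show ?case using yz by blast
    qed
  qed
  have ePk: "e [^] k \<notin> P" for k :: nat
  proof (induction k)
    case 0 then show ?case using P.I_notcarr P.one_imp_carrier by auto
  next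
    case (Suc k) then show ?case using P.I_prime[of "e [^] k" e] e by auto
  qed
  \<comment> \<open>The nilpotency index is exactly \<open>r\<close>: if \<open>c^k\<close> were in
    \<open>P^(k+1)\<close>, cancelling \<open>c^k\<close> in the domain \<open>R\<close> would make
    a power of \<open>e\<close> a multiple of \<open>c\<close>, hence an element of
    \<open>P\<close>.\<close>
  have cpow: "c [^] k \<notin> I" if k: "k < r" for k
  proof
    assume "c [^] k \<in> I"
    then have "c [^] k \<in> ideal_power P (Suc k)"
      unfolding I_def using ideal_power_antimono[OF P.is_ideal, of "Suc k" r] k by auto
    then obtain y where y: "y \<in> carrier R" "e [^] Suc k \<otimes> c [^] k = c [^] Suc k \<otimes> y"
      using pow_e by blast
    have "c [^] k \<otimes> e [^] Suc k = c [^] k \<otimes> (c \<otimes> y)"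
      using y e cc by (simp add: m_ac)
    moreover have "c [^] k \<noteq> \<zero>" using c(2) cc by (induction k) (auto simp: integral_iff)
    ultimately have "e [^] Suc k = c \<otimes> y" using y e cc by (simp add: m_lcancel)
    then have "e [^] Suc k \<in> P" using c y P.I_r_closed by simp
    then show False using ePk by blast
  qed
  have hpow: "h x [^]\<^bsub>S\<^esub> (k::nat) = h (x [^] k)" if "x \<in> carrier R" for x k
    using h.hom_nat_pow[OF that] by simp
  \<comment> \<open>Multiplication by \<open>c^(r-1)\<close> followed by reduction modulo
    \<open>I\<close> has kernel \<open>P\<close>, which makes the socle a copy of
    \<open>R Quot P\<close>.\<close>
  have same: "h (c [^] (r - 1)) \<otimes>\<^bsub>S\<^esub> h x = h (c [^] (r - 1)) \<otimes>\<^bsub>S\<^esub> h y \<longleftrightarrow> P +> x = P +> y"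
    if xy: "x \<in> carrier R" "y \<in> carrier R" for x y
  proof -
    have "h (c [^] (r - 1)) \<otimes>\<^bsub>S\<^esub> h x = h (c [^] (r - 1)) \<otimes>\<^bsub>S\<^esub> h y
       \<longleftrightarrow> c [^] (r - 1) \<otimes> x \<ominus> c [^] (r - 1) \<otimes> y \<in> I"
      using heq xy cc by (metis h.hom_mult m_closed nat_pow_closed)
    also have "c [^] (r - 1) \<otimes> x \<ominus> c [^] (r - 1) \<otimes> y = c [^] (r - 1) \<otimes> (x \<ominus> y)"
      using xy cc nat_pow_closed[OF cc, of "r - 1"] by algebra
    also have "c [^] (r - 1) \<otimes> (x \<ominus> y) \<in> I \<longleftrightarrow> x \<ominus> y \<in> P"
    proof
      assume xyP: "x \<ominus> y \<in> P"
      have "I = ideal_prod R (ideal_power P (r - 1)) P"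
        unfolding I_def ideal_power_Suc[symmetric] using r by simp
      then show "c [^] (r - 1) \<otimes> (x \<ominus> y) \<in> I"
        using ideal_prod.prod[OF pow_mem_ideal_power[OF P.is_ideal c(1)] xyP] by metis
    next
      assume *: "c [^] (r - 1) \<otimes> (x \<ominus> y) \<in> I"
      show "x \<ominus> y \<in> P"
      proof (rule ccontr)
        assume "x \<ominus> y \<notin> P"
        then have u: "h (x \<ominus> y) \<in> Units S" using unit xy by simp
        have "h (c [^] (r - 1)) \<otimes>\<^bsub>S\<^esub> h (x \<ominus> y) = \<zero>\<^bsub>S\<^esub>"
          using * h0 xy cc by (metis h.hom_mult m_closed minus_closed nat_pow_closed)
        then have "h (c [^] (r - 1)) = \<zero>\<^bsub>S\<^esub>"
          using u cc by (metis S.Units_closed S.Units_inv_closed S.Units_r_inv S.l_null S.m_assoc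
             S.r_one h.hom_closed nat_pow_closed)
        then show False using h0 cpow[of "r - 1"] r cc by simp
      qed
    qed
    also have "\<dots> \<longleftrightarrow> P +> x = P +> y" using quotient_eq_iff_same_a_r_cos[OF P.is_ideal xy] .
    finally show ?thesis .
  qed
  have carP: "carrier (R Quot P) = (+>) P ` carrier R"
    unfolding FactRing_def A_RCOSETS_def' by auto
  have soc: "S.multiples (h c [^]\<^bsub>S\<^esub> (r - 1)) = (\<lambda>x. h (c [^] (r - 1)) \<otimes>\<^bsub>S\<^esub> h x) ` carrier R"
    unfolding S.multiples_def carS hpow[OF cc] by (simp add: image_image)
  have socle: "card (S.multiples (h c [^]\<^bsub>S\<^esub> (r - 1))) = card (carrier (R Quot P))"
    "finite (S.multiples (h c [^]\<^bsub>S\<^esub> (r - 1)))"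
    unfolding soc carP
    using card_image_eq_if_same_kernel[of "carrier R"
      "\<lambda>x. h (c [^] (r - 1)) \<otimes>\<^bsub>S\<^esub> h x" "(+>) P", OF same] fin[unfolded carP]
    by (blast, blast)
  have "finite_chain_ring S (h c) r"
  proof (intro finite_chain_ring.intro finite_chain_ring_axioms.intro S.is_cring hc r)
    show "h c [^]\<^bsub>S\<^esub> r = \<zero>\<^bsub>S\<^esub>"
      using hpow[OF cc] h0 pow_mem_ideal_power[OF P.is_ideal c(1), of r] cc by (simp add: I_def)
    show "h c [^]\<^bsub>S\<^esub> k \<noteq> \<zero>\<^bsub>S\<^esub>" if "k < r" for k
      using hpow[OF cc] h0 cpow[OF that] cc by simp
    show "x \<in> S.multiples (h c)" if "x \<in> carrier S" "x \<notin> Units S" for x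
      using that unit hP unfolding carS by blast
    show "finite (S.multiples (h c [^]\<^bsub>S\<^esub> (r - 1)))" by (rule socle)
  qed
  then show ?thesis using that socle(1) unfolding S_def by blast
qed

end

section \<open>Finite chain rings\<close>

lemma card_eq_fibers:
  assumes "finite B" "f ` A = B" and c: "\<And>b. b \<in> B \<Longrightarrow> finite {a \<in> A. f a = b}"
    "\<And>b. b \<in> B \<Longrightarrow> card {a \<in> A. f a = b} = c"
  shows "finite A" "card A = c * card B"
proof -
  have A: "A = (\<Union>b\<in>B. {a \<in> A. f a = b})" using assms(2) by auto
  show "finite A" by (subst A) (use assms in auto)
  have "card A = (\<Sum>b\<in>B. card {a \<in> A. f a = b})"
    by (subst A, rule card_UN_disjoint) (use assms in auto)
  then show "card A = c * card B" using c by simp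
qed

context finite_chain_ring begin

text \<open>The socle is a one-dimensional space over the residue field, so its order is q; the
  definition stays inside the ring and does not mention the residue field.\<close>

definition residue_order :: nat where
  "residue_order = card (multiples (p [^] (r - 1)))"

lemma multiples_subset: "a \<in> carrier R \<Longrightarrow> multiples a \<subseteq> carrier R"
  by (auto simp: multiples_def)

lemma multiplesI: "x \<in> carrier R \<Longrightarrow> a \<otimes> x \<in> multiples a"
  by (simp add: multiples_def)

lemma multiplesE: "y \<in> multiples a \<Longrightarrow> (\<And>x. x \<in> carrier R \<Longrightarrow> y = a \<otimes> x \<Longrightarrow> thesis) \<Longrightarrow> thesis"
  by (auto simp: multiples_def)

lemma multiples_pow_mono: "(j::nat) \<le> k \<Longrightarrow> multiples (p [^] k) \<subseteq> multiples (p [^] j)"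
proof
  fix y assume jk: "j \<le> k" and "y \<in> multiples (p [^] k)"
  then obtain x where x: "x \<in> carrier R" "y = p [^] k \<otimes> x" by (blast elim: multiplesE)
  have "p [^] k = p [^] j \<otimes> p [^] (k - j)" using jk by (simp add: nat_pow_mult)
  then have "y = p [^] j \<otimes> (p [^] (k - j) \<otimes> x)" using x by (simp add: m_assoc)
  then show "y \<in> multiples (p [^] j)" using x by (simp add: multiplesI)
qed

lemma zero_mem_multiples: "a \<in> carrier R \<Longrightarrow> \<zero> \<in> multiples a"
  using multiplesI[of \<zero> a] by simp

text \<open>Existence of a valuation: \<open>p\<close> is split off until the cofactor is a unit,
  which happens before step \<open>r\<close> because \<open>p^r\<close> is zero and \<open>x\<close>
  is not.\<close>

lemma unit_times_pow:
  assumes "x \<in> carrier R" "x \<noteq> \<zero>"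
  obtains u k where "u \<in> Units R" "k < r" "x = p [^] k \<otimes> u"
proof -
  have "x \<in> multiples (p [^] j) \<or> (\<exists>u\<in>Units R. \<exists>k<j. x = p [^] k \<otimes> u)" for j :: nat
  proof (induction j)
    case 0 then show ?case using multiplesI[of x \<one>] assms by simp
  next
    case (Suc j)
    show ?case
    proof (cases "x \<in> multiples (p [^] j)")
      case True
      then obtain y where y: "y \<in> carrier R" "x = p [^] j \<otimes> y" by (blast elim: multiplesE)
      show ?thesis
      proof (cases "y \<in> Units R")
        case True then show ?thesis using y by blast
      next
        case False
        then obtain z where z: "z \<in> carrier R" "y = p \<otimes> z" using nonunit y by (blast elim: multiplesE)
        then have "x = p [^] Suc j \<otimes> z" using y by (simp add: m_assoc)
        then show ?thesis using multiplesI z by blast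
      qed
    qed (use Suc in \<open>auto intro: less_SucI\<close>)
  qed
  from this[of r] have "\<exists>u\<in>Units R. \<exists>k<r. x = p [^] k \<otimes> u"
    using assms uniformizer_pow_r by (auto simp: multiples_def)
  then show ?thesis using that by blast
qed

text \<open>If a nonzero \<open>x\<close> has valuation \<open>j\<close>, then
  \<open>p^(k+j)\<close> times a unit vanishes, so \<open>k + j\<close> is at least
  \<open>r\<close>.\<close>

lemma annihilator_pow:
  assumes "x \<in> carrier R" "k \<le> r" "p [^] k \<otimes> x = \<zero>"
  shows "x \<in> multiples (p [^] (r - k))"
proof (cases "x = \<zero>")
  case True then show ?thesis by (simp add: zero_mem_multiples)
next
  case False
  then obtain u j where u: "u \<in> Units R" "j < r" "x = p [^] j \<otimes> u"
    using unit_times_pow assms(1) by blast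
  have "p [^] (k + j) \<otimes> u = \<zero>"
    using assms u by (simp add: nat_pow_mult[symmetric] m_assoc Units_closed)
  then have "p [^] (k + j) = \<zero>"
    using u(1) by (metis Units_closed Units_inv_closed Units_r_inv l_null m_assoc nat_pow_closed
        r_one uniformizer_closed)
  then have "r - k \<le> j" using uniformizer_pow_less[of "k + j"] by (cases "k + j < r") auto
  then show ?thesis using multiples_pow_mono multiplesI[of u "p [^] j"] u by (auto simp: Units_closed)
qed

lemma pow_annihilates: "x \<in> multiples (p [^] (r - k)) \<Longrightarrow> k \<le> r \<Longrightarrow> p [^] k \<otimes> x = \<zero>"
  by (auto elim!: multiplesE simp: m_assoc[symmetric] nat_pow_mult uniformizer_pow_r)

lemma one_neq_zero: "\<one> \<noteq> \<zero>"
  using uniformizer_pow_less[of 0] length_pos by simp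

text \<open>Multiplication by \<open>p\<close> maps \<open>p^k R\<close> onto
  \<open>p^(k+1) R\<close>, and its fibres are cosets of the socle, of size q each. The induction
  descends from \<open>k = r\<close>.\<close>

lemma card_multiples_pow:
  assumes "k \<le> r"
  shows "finite (multiples (p [^] k)) \<and> card (multiples (p [^] k)) = residue_order ^ (r - k)"
  using assms
proof (induction "r - k" arbitrary: k)
  case 0
  then have "multiples (p [^] k) = {\<zero>}" using uniformizer_pow_r zero_closed by (auto simp: multiples_def)
  then show ?case using 0 by simp
next
  case (Suc n)
  have k: "k \<le> r - 1" "Suc k \<le> r" using Suc by auto
  have IH: "finite (multiples (p [^] Suc k))" "card (multiples (p [^] Suc k)) = residue_order ^ (r - Suc k)"
    using Suc(1)[of "Suc k"] Suc(2) k by auto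
  have fiber: "{y \<in> multiples (p [^] k). p \<otimes> y = b} = (\<lambda>z. y0 \<oplus> z) ` multiples (p [^] (r - 1))"
    if y0: "y0 \<in> multiples (p [^] k)" "p \<otimes> y0 = b" for y0 b
  proof (intro equalityI subsetI)
    have y0c: "y0 \<in> carrier R" using y0 multiples_subset by blast
    fix y assume "y \<in> {y \<in> multiples (p [^] k). p \<otimes> y = b}"
    then have y: "y \<in> carrier R" "p \<otimes> y = p \<otimes> y0" using y0 multiples_subset[OF nat_pow_closed[OF uniformizer_closed]] by auto
    have "p [^] (1::nat) \<otimes> (y \<ominus> y0) = p \<otimes> y \<ominus> p \<otimes> y0"
      using y y0c by (simp add: minus_eq r_distr r_minus)
    also have "\<dots> = \<zero>" using y y0c by (simp add: minus_eq r_neg)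
    finally have "y \<ominus> y0 \<in> multiples (p [^] (r - 1))" using annihilator_pow[of "y \<ominus> y0" 1] y y0c length_pos by auto
    moreover have "y = y0 \<oplus> (y \<ominus> y0)" using y y0c by algebra
    ultimately show "y \<in> (\<lambda>z. y0 \<oplus> z) ` multiples (p [^] (r - 1))" by blast
  next
    have y0c: "y0 \<in> carrier R" using y0 multiples_subset by blast
    fix y assume "y \<in> (\<lambda>z. y0 \<oplus> z) ` multiples (p [^] (r - 1))"
    then obtain z where z: "z \<in> multiples (p [^] (r - 1))" "y = y0 \<oplus> z" by blast
    have zc: "z \<in> carrier R" using z multiples_subset by blast
    have "z \<in> multiples (p [^] k)" using z multiples_pow_mono[OF k(1)] by blast
    then obtain a where a: "a \<in> carrier R" "z = p [^] k \<otimes> a" by (blast elim: multiplesE)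
    obtain c where c: "c \<in> carrier R" "y0 = p [^] k \<otimes> c" using y0 by (blast elim: multiplesE)
    have "y = p [^] k \<otimes> (c \<oplus> a)" using z a c by (simp add: r_distr)
    then have "y \<in> multiples (p [^] k)" using a c by (simp add: multiplesI)
    moreover have "p \<otimes> z = \<zero>" using pow_annihilates[of z 1] z length_pos by simp
    then have "p \<otimes> y = b" using z(2) y0 y0c zc by (simp add: r_distr, metis m_closed r_zero uniformizer_closed)
    ultimately show "y \<in> {y \<in> multiples (p [^] k). p \<otimes> y = b}" by blast
  qed
  have inj: "inj_on (\<lambda>z. y0 \<oplus> z) (multiples (p [^] (r - 1)))" if "y0 \<in> carrier R" for y0
  proof (rule inj_onI)
    fix a b assume ab: "a \<in> multiples (p [^] (r - 1))" "b \<in> multiples (p [^] (r - 1))" "y0 \<oplus> a = y0 \<oplus> b"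
    then have "a \<in> carrier R" "b \<in> carrier R"
      using multiples_subset[OF nat_pow_closed[OF uniformizer_closed]] by blast+
    then show "a = b" using ab(3) that by simp
  qed
  have im: "(\<lambda>y. p \<otimes> y) ` multiples (p [^] k) = multiples (p [^] Suc k)"
  proof -
    have "p \<otimes> (p [^] k \<otimes> x) = p [^] Suc k \<otimes> x" if "x \<in> carrier R" for x
      using that by (simp add: m_ac)
    then show ?thesis unfolding multiples_def image_image by (intro image_cong) auto
  qed
  have fb: "finite {y \<in> multiples (p [^] k). p \<otimes> y = b}"
       "card {y \<in> multiples (p [^] k). p \<otimes> y = b} = residue_order"
    if b: "b \<in> multiples (p [^] Suc k)" for b
  proof -
    obtain y0 where y0: "y0 \<in> multiples (p [^] k)" "p \<otimes> y0 = b" using b unfolding im[symmetric] by blast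
    have y0c: "y0 \<in> carrier R" using y0 multiples_subset by blast
    show "finite {y \<in> multiples (p [^] k). p \<otimes> y = b}"
      unfolding fiber[OF y0] using finite_socle by simp
    show "card {y \<in> multiples (p [^] k). p \<otimes> y = b} = residue_order"
      unfolding fiber[OF y0] residue_order_def using inj[OF y0c] by (rule card_image)
  qed
  have "residue_order * residue_order ^ (r - Suc k) = residue_order ^ (r - k)"
    using k by (simp add: Suc_diff_Suc flip: power_Suc)
  then show ?case using card_eq_fibers[OF IH(1) im fb] IH(2) by simp
qed

lemma finite_carrier: "finite (carrier R)" and card_carrier: "card (carrier R) = residue_order ^ r"
proof -
  have "multiples \<one> = carrier R" by (auto simp: multiples_def image_iff)
  then show "finite (carrier R)" "card (carrier R) = residue_order ^ r"
    using card_multiples_pow[of 0] by simp_all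
qed

lemma residue_order_ge_2: "residue_order \<ge> 2"
proof -
  have "{\<zero>, p [^] (r - 1)} \<subseteq> multiples (p [^] (r - 1))"
    using zero_mem_multiples multiplesI[of \<one> "p [^] (r - 1)"] by simp
  then have "card {\<zero>, p [^] (r - 1)} \<le> residue_order"
    unfolding residue_order_def by (rule card_mono[OF finite_socle])
  then show ?thesis using uniformizer_pow_less[of "r - 1"] length_pos by simp
qed

end

section \<open>Gaussian numbers\<close>

lemma q_int_pos: "q \<ge> 2 \<Longrightarrow> n \<ge> 1 \<Longrightarrow> q_int q n > 0"
  by (cases n) (auto simp: q_int_eq_sum)

lemma q_int_times: "q \<ge> 2 \<Longrightarrow> (q - 1) * q_int q n = q ^ n - 1"
proof -
  assume q: "q \<ge> 2"
  have "real ((q - 1) * q_int q n) = real q ^ n - 1"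
    using q by (simp add: q_int_exact of_nat_diff)
  also have "\<dots> = real (q ^ n - 1)" using q by (simp add: of_nat_diff)
  finally show ?thesis by linarith
qed

lemma q_fact_pos: "q \<ge> 2 \<Longrightarrow> q_fact q n > 0"
  unfolding q_fact_def by (intro prod_pos) (simp add: q_int_pos)

lemma q_fact_Suc: "q_fact q (Suc n) = q_int q (Suc n) * q_fact q n"
  by (simp add: q_fact_def)

lemma q_binomial_fact:
  assumes "q \<ge> 2" "n \<le> d"
  shows "q_binomial q d n * (q_fact q n * q_fact q (d - n)) = q_fact q d"
  using q_fact_dvd[OF assms(1), of n "d - n"] assms(2) by (simp add: q_binomial_def)

lemma prod_q_int_falling:
  "n \<le> d \<Longrightarrow> (\<Prod>i<n. q_int q (d - i)) * q_fact q (d - n) = q_fact q d"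
proof (induction n)
  case (Suc n)
  have "q_fact q (d - n) = q_int q (d - n) * q_fact q (d - Suc n)"
    using q_fact_Suc[of q "d - Suc n"] Suc(2) by (simp add: Suc_diff_Suc)
  then show ?case using Suc by (simp add: mult.assoc)
qed simp

lemma prod_power_diff:
  fixes q :: nat
  assumes "q \<ge> 2" "n \<le> d"
  shows "(\<Prod>i<n. q ^ d - q ^ i) = (\<Prod>i<n. q ^ i * (q - 1)) * (\<Prod>i<n. q_int q (d - i))"
proof -
  have "q ^ d - q ^ i = (q ^ i * (q - 1)) * q_int q (d - i)" if "i < n" for i
  proof -
    have "q ^ d - q ^ i = q ^ i * q ^ (d - i) - q ^ i * 1"
      using that assms(2) by (simp only: power_add[symmetric]) simp
    also have "\<dots> = q ^ i * ((q - 1) * q_int q (d - i))"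
      by (simp only: diff_mult_distrib2[symmetric] q_int_times[OF assms(1)])
    finally show ?thesis by (simp only: mult.assoc)
  qed
  then have "(\<Prod>i<n. q ^ d - q ^ i) = (\<Prod>i<n. (q ^ i * (q - 1)) * q_int q (d - i))"
    by (intro prod.cong) auto
  then show ?thesis by (simp only: prod.distrib)
qed

text \<open>Both products are numbers of ordered independent n-tuples: on the right in an F_q-space
  of dimension d, on the left in one of its n-dimensional subspaces. The multiplicative form fits
  the double counting in \<open>card_free_subs\<close>.\<close>

lemma q_binomial_prod:
  fixes q :: nat
  assumes "q \<ge> 2" "n \<le> d"
  shows "q_binomial q d n * (\<Prod>i<n. q ^ n - q ^ i) = (\<Prod>i<n. q ^ d - q ^ i)"
proof -
  have n: "(\<Prod>i<n. q_int q (n - i)) = q_fact q n"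
    using prod_q_int_falling[of n n q] by (simp add: q_fact_def)
  have "q_binomial q d n * q_fact q n * q_fact q (d - n) = (\<Prod>i<n. q_int q (d - i)) * q_fact q (d - n)"
    using q_binomial_fact[OF assms] prod_q_int_falling[OF assms(2), of q] by (simp add: mult.assoc)
  then have "q_binomial q d n * q_fact q n = (\<Prod>i<n. q_int q (d - i))"
    using q_fact_pos[OF assms(1), of "d - n"] by simp
  then show ?thesis
    unfolding prod_power_diff[OF assms] prod_power_diff[OF assms(1) order_refl] n
    by (simp add: mult_ac)
qed

lemma q_binomial_1: "q \<ge> 2 \<Longrightarrow> d \<ge> 1 \<Longrightarrow> q_binomial q d 1 = q_int q d"
proof -
  assume q: "q \<ge> 2" and d: "d \<ge> 1"
  have "q_binomial q d 1 * q_fact q (d - 1) = q_int q d * q_fact q (d - 1)"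
    using q_binomial_fact[OF q d] q_fact_Suc[of q "d - 1"] d q by (simp add: q_fact_def q_int_def)
  then show ?thesis using q_fact_pos[OF q, of "d - 1"] by simp
qed

section \<open>Free modules over finite chain rings\<close>

locale chain_module = finite_chain_ring R p r + module R M
  for R (structure) and p and r and M (structure)
begin

definition indep :: "'c set \<Rightarrow> bool" where
  "indep B \<longleftrightarrow> finite B \<and> B \<subseteq> carrier M \<and> lin_indpt B"

definition scaled :: "nat \<Rightarrow> 'c set \<Rightarrow> 'c set" where
  "scaled k V = (\<lambda>v. (p [^] k) \<odot>\<^bsub>M\<^esub> v) ` V"

lemma indepD: "indep B \<Longrightarrow> finite B" "indep B \<Longrightarrow> B \<subseteq> carrier M" "indep B \<Longrightarrow> lin_indpt B"
  by (simp_all add: indep_def)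

lemma indep_subset: "indep B \<Longrightarrow> A \<subseteq> B \<Longrightarrow> indep A"
  unfolding indep_def using subset_li_is_li finite_subset by blast

lemma indep_coeff_zero:
  assumes "indep B" "a \<in> B \<rightarrow> carrier R" "lincomb a B = \<zero>\<^bsub>M\<^esub>" "v \<in> B"
  shows "a v = \<zero>"
  using assms lin_dep_crit[of B B a v] by (auto simp: indep_def)

lemma indepI:
  assumes "finite B" "B \<subseteq> carrier M"
    "\<And>a v. a \<in> B \<rightarrow> carrier R \<Longrightarrow> lincomb a B = \<zero>\<^bsub>M\<^esub> \<Longrightarrow> v \<in> B \<Longrightarrow> a v = \<zero>"
  shows "indep B"
  using assms finite_lin_indpt2[of B] by (auto simp: indep_def)

lemma lincomb_inj:
  assumes B: "indep B" and a: "a \<in> B \<rightarrow> carrier R" and b: "b \<in> B \<rightarrow> carrier R"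
    and eq: "lincomb a B = lincomb b B" and v: "v \<in> B"
  shows "a v = b v"
proof -
  have "lincomb (\<lambda>v. a v \<ominus> b v) B = lincomb a B \<ominus>\<^bsub>M\<^esub> lincomb b B"
    using lincomb_diff indepD(1,2)[OF B] a b by blast
  also have "\<dots> = \<zero>\<^bsub>M\<^esub>" unfolding eq using b indepD(2)[OF B] lincomb_closed by simp
  finally have "a v \<ominus> b v = \<zero>"
    using indep_coeff_zero[OF B _ _ v, of "\<lambda>v. a v \<ominus> b v"] a b by blast
  moreover have "a v \<in> carrier R" "b v \<in> carrier R" using a b v by auto
  ultimately show ?thesis by simp
qed

lemma span_closed: "B \<subseteq> carrier M \<Longrightarrow> span B \<subseteq> carrier M"
  by (rule span_is_subset2)

lemma in_spanE:
  assumes "finite B" "B \<subseteq> carrier M" "v \<in> span B"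
  obtains a where "a \<in> B \<rightarrow> carrier R" "v = lincomb a B"
  using finite_in_span[OF assms] by blast

lemma lincomb_in_span:
  assumes "finite B" "B \<subseteq> carrier M" "a \<in> B \<rightarrow> carrier R"
  shows "lincomb a B \<in> span B"
  using finite_span[OF assms(1,2)] assms(3) by blast

lemma span_submodule:
  assumes "B \<subseteq> carrier M"
  shows span_zero: "\<zero>\<^bsub>M\<^esub> \<in> span B"
    and span_add: "x \<in> span B \<Longrightarrow> y \<in> span B \<Longrightarrow> x \<oplus>\<^bsub>M\<^esub> y \<in> span B"
    and span_smult: "c \<in> carrier R \<Longrightarrow> x \<in> span B \<Longrightarrow> c \<odot>\<^bsub>M\<^esub> x \<in> span B"
  using span_is_submodule[OF assms] unfolding submodule_def by auto

lemma span_neg: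
  assumes "B \<subseteq> carrier M" "x \<in> span B"
  shows "\<ominus>\<^bsub>M\<^esub> x \<in> span B"
proof -
  have "x \<in> carrier M" using assms span_closed by blast
  then have "\<ominus>\<^bsub>M\<^esub> x = (\<ominus> \<one>) \<odot>\<^bsub>M\<^esub> x" using smult_l_minus[of \<one> x] by simp
  then show ?thesis using span_smult[OF assms(1), of "\<ominus> \<one>" x] assms by simp
qed

lemma span_subset_spanI: "B \<subseteq> carrier M \<Longrightarrow> A \<subseteq> span B \<Longrightarrow> span A \<subseteq> span B"
  by (rule span_is_subset[OF _ span_is_submodule])

text \<open>Values outside \<open>B\<close> do not affect a combination, so extensional coefficient
  functions suffice; over an independent \<open>B\<close> these are unique, which is what
  \<open>card_lincomb\<close> counts.\<close>

lemma lincomb_image_eq: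
  assumes "B \<subseteq> carrier M" "A \<subseteq> carrier R"
  shows "{lincomb a B | a. a \<in> B \<rightarrow> A} = (\<lambda>a. lincomb a B) ` (B \<rightarrow>\<^sub>E A)"
proof (intro equalityI subsetI)
  fix x assume "x \<in> {lincomb a B | a. a \<in> B \<rightarrow> A}"
  then obtain a where a: "a \<in> B \<rightarrow> A" "x = lincomb a B" by blast
  have "lincomb a B = lincomb (restrict a B) B"
    using assms a by (intro lincomb_cong) auto
  then show "x \<in> (\<lambda>a. lincomb a B) ` (B \<rightarrow>\<^sub>E A)" using a by (intro image_eqI[of _ _ "restrict a B"]) auto
qed auto

lemma card_lincomb:
  assumes B: "indep B" and A: "A \<subseteq> carrier R"
  shows "card {lincomb a B | a. a \<in> B \<rightarrow> A} = card A ^ card B"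
proof -
  have "inj_on (\<lambda>a. lincomb a B) (B \<rightarrow>\<^sub>E A)"
  proof (rule inj_onI)
    fix a b assume ab: "a \<in> B \<rightarrow>\<^sub>E A" "b \<in> B \<rightarrow>\<^sub>E A" "lincomb a B = lincomb b B"
    then have "a v = b v" if "v \<in> B" for v
      using lincomb_inj[OF B _ _ ab(3) that] A by fastforce
    then show "a = b" using ab(1,2) by (intro PiE_ext) auto
  qed
  then show ?thesis
    unfolding lincomb_image_eq[OF indepD(2)[OF B] A]
    by (simp add: card_image card_PiE indepD(1)[OF B])
qed

lemma span_finite: "finite B \<Longrightarrow> B \<subseteq> carrier M \<Longrightarrow> finite (span B)"
  using finite_span[of B] lincomb_image_eq[of B "carrier R"] finite_carrier
  by (simp add: finite_PiE)

lemma card_span: "indep B \<Longrightarrow> card (span B) = residue_order ^ (r * card B)"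
  using card_lincomb[of B "carrier R"] finite_span[of B] card_carrier
  by (simp add: indep_def power_mult)

lemma scaled_span:
  assumes "finite B" "B \<subseteq> carrier M"
  shows "scaled k (span B) = {lincomb a B | a. a \<in> B \<rightarrow> multiples (p [^] k)}"
proof (intro equalityI subsetI)
  fix x assume "x \<in> scaled k (span B)"
  then obtain a where a: "a \<in> B \<rightarrow> carrier R" "x = p [^] k \<odot>\<^bsub>M\<^esub> lincomb a B"
    unfolding scaled_def using in_spanE[OF assms] by blast
  then have "x = lincomb (\<lambda>v. p [^] k \<otimes> a v) B" using assms lincomb_smult[of B a "p [^] k"] by simp
  moreover have "(\<lambda>v. p [^] k \<otimes> a v) \<in> B \<rightarrow> multiples (p [^] k)" using a multiplesI by auto
  ultimately show "x \<in> {lincomb a B | a. a \<in> B \<rightarrow> multiples (p [^] k)}" by blast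
next
  fix x assume "x \<in> {lincomb a B | a. a \<in> B \<rightarrow> multiples (p [^] k)}"
  then obtain a where a: "a \<in> B \<rightarrow> multiples (p [^] k)" "x = lincomb a B" by blast
  have "\<forall>v\<in>B. \<exists>c\<in>carrier R. a v = p [^] k \<otimes> c" using a(1) by (auto simp: multiples_def)
  then obtain c where c: "\<And>v. v \<in> B \<Longrightarrow> c v \<in> carrier R \<and> a v = p [^] k \<otimes> c v" by metis
  have "x = lincomb (\<lambda>v. p [^] k \<otimes> c v) B"
    unfolding a(2) using c assms by (intro lincomb_cong) auto
  also have "\<dots> = p [^] k \<odot>\<^bsub>M\<^esub> lincomb c B" using c assms by (intro lincomb_smult) auto
  finally show "x \<in> scaled k (span B)"
    unfolding scaled_def using lincomb_in_span[OF assms, of c] c by blast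
qed

lemma scaled_closed: "V \<subseteq> carrier M \<Longrightarrow> scaled k V \<subseteq> carrier M"
  by (auto simp: scaled_def)

lemma scaled_span_subset: "B \<subseteq> carrier M \<Longrightarrow> scaled k (span B) \<subseteq> span B"
  by (auto simp: scaled_def intro: span_smult)

lemma scaled_mono: "V \<subseteq> W \<Longrightarrow> scaled k V \<subseteq> scaled k W"
  by (auto simp: scaled_def)

lemma card_scaled_span:
  assumes "indep B" "k \<le> r"
  shows "card (scaled k (span B)) = residue_order ^ ((r - k) * card B)"
  using card_lincomb[OF assms(1), of "multiples (p [^] k)"] scaled_span[of B k] indepD[OF assms(1)]
    card_multiples_pow[OF assms(2)] multiples_subset[of "p [^] k"]
  by (simp add: power_mult)

lemma annihilator_span:
  assumes B: "indep B" and x: "x \<in> span B" and k: "k \<le> r" and 0: "p [^] k \<odot>\<^bsub>M\<^esub> x = \<zero>\<^bsub>M\<^esub>"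
  shows "x \<in> scaled (r - k) (span B)"
proof -
  note B' = indepD(1,2)[OF B]
  obtain a where a: "a \<in> B \<rightarrow> carrier R" "x = lincomb a B" using in_spanE[OF B' x] .
  have l0: "lincomb (\<lambda>v. p [^] k \<otimes> a v) B = \<zero>\<^bsub>M\<^esub>"
    using lincomb_smult[of B a "p [^] k"] a B' 0 by simp
  have "p [^] k \<otimes> a v = \<zero>" if "v \<in> B" for v
    by (rule indep_coeff_zero[OF B _ l0 that]) (use a in auto)
  then have "a \<in> B \<rightarrow> multiples (p [^] (r - k))" using annihilator_pow[OF _ k] a by auto
  then show ?thesis unfolding scaled_span[OF B'] using a by blast
qed

text \<open>Purity of free submodules. An element of \<open>p^k M\<close> is killed by
  \<open>p^(r-k)\<close>, and inside a free module the elements killed by \<open>p^(r-k)\<close> are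
  those of \<open>p^k\<close> times the module.\<close>

lemma span_Int_scaled:
  assumes B: "indep B" and k: "k \<le> r"
  shows "span B \<inter> scaled k (carrier M) = scaled k (span B)"
proof (intro equalityI subsetI)
  fix x assume x: "x \<in> span B \<inter> scaled k (carrier M)"
  then obtain m where m: "m \<in> carrier M" "x = p [^] k \<odot>\<^bsub>M\<^esub> m" by (auto simp: scaled_def)
  have "p [^] (r - k) \<odot>\<^bsub>M\<^esub> x = (p [^] (r - k) \<otimes> p [^] k) \<odot>\<^bsub>M\<^esub> m"
    using m by (simp add: smult_assoc1)
  also have "\<dots> = \<zero>\<^bsub>M\<^esub>" using m k by (simp add: nat_pow_mult uniformizer_pow_r)
  finally show "x \<in> scaled k (span B)" using annihilator_span[OF B, of x "r - k"] x k by simp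
next
  fix x assume "x \<in> scaled k (span B)"
  then show "x \<in> span B \<inter> scaled k (carrier M)"
    using scaled_span_subset[OF indepD(2)[OF B], of k] scaled_mono[OF span_closed[OF indepD(2)[OF B]], of k]
    by blast
qed

lemma lincomb_insert_eq:
  assumes "finite B" "B \<subseteq> carrier M" "v \<in> carrier M" "v \<notin> B" "a \<in> insert v B \<rightarrow> carrier R"
  shows "lincomb a (insert v B) = a v \<odot>\<^bsub>M\<^esub> v \<oplus>\<^bsub>M\<^esub> lincomb a B"
  using lincomb_insert[of B a v] assms by simp

text \<open>Independence is decided modulo \<open>p\<close>, as in Nakayama's lemma. Counting the
  extensions of an independent set thus becomes counting the complement of one submodule.\<close>

lemma indep_insert_iff:
  assumes E: "indep E" "span E = carrier M" and B: "indep B" and v: "v \<in> carrier M"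
  shows "v \<notin> B \<and> indep (insert v B) \<longleftrightarrow> v \<notin> span B <+>\<^bsub>M\<^esub> scaled 1 (carrier M)"
proof
  note B' = indepD(1,2)[OF B]
  assume L: "v \<notin> B \<and> indep (insert v B)"
  show "v \<notin> span B <+>\<^bsub>M\<^esub> scaled 1 (carrier M)"
  proof
    assume "v \<in> span B <+>\<^bsub>M\<^esub> scaled 1 (carrier M)"
    then obtain s m where s: "s \<in> span B" and m: "m \<in> carrier M" and vs: "v = s \<oplus>\<^bsub>M\<^esub> p \<odot>\<^bsub>M\<^esub> m"
      by (auto simp: set_add_def' scaled_def)
    obtain a where a: "a \<in> B \<rightarrow> carrier R" "s = lincomb a B" using in_spanE[OF B' s] .
    have sc: "s \<in> carrier M" using s span_closed[OF B'(2)] by blast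
    \<comment> \<open>Multiplying \<open>v = s + p m\<close> by \<open>p^(r-1)\<close> removes
      \<open>m\<close> and leaves a relation in which \<open>v\<close> has the nonzero coefficient
      \<open>p^(r-1)\<close>.\<close>
    let ?t = "p [^] (r - 1)"
    have pr: "?t \<otimes> p = \<zero>" using nat_pow_mult[of p "r - 1" 1] length_pos uniformizer_pow_r by simp
    define c where "c w = (if w = v then ?t else \<ominus> (?t \<otimes> a w))" for w
    have cc: "c \<in> insert v B \<rightarrow> carrier R" unfolding c_def using funcset_mem[OF a(1)] by auto
    have "lincomb c B = lincomb (\<lambda>w. (\<ominus> ?t) \<otimes> a w) B"
      using a L B' by (intro lincomb_cong) (auto simp: c_def l_minus Pi_def)
    also have "\<dots> = (\<ominus> ?t) \<odot>\<^bsub>M\<^esub> s" unfolding a(2) using a(1) B' by (intro lincomb_smult) auto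
    also have "\<dots> = \<ominus>\<^bsub>M\<^esub> (?t \<odot>\<^bsub>M\<^esub> s)" using sc by (simp add: smult_l_minus)
    finally have "lincomb c (insert v B) = ?t \<odot>\<^bsub>M\<^esub> v \<oplus>\<^bsub>M\<^esub> \<ominus>\<^bsub>M\<^esub> (?t \<odot>\<^bsub>M\<^esub> s)"
      using lincomb_insert_eq[OF B' v _ cc] L by (simp add: c_def)
    also have "?t \<odot>\<^bsub>M\<^esub> v = ?t \<odot>\<^bsub>M\<^esub> s \<oplus>\<^bsub>M\<^esub> (?t \<otimes> p) \<odot>\<^bsub>M\<^esub> m"
      unfolding vs using sc m by (simp add: smult_r_distr smult_assoc1)
    also have "\<dots> = ?t \<odot>\<^bsub>M\<^esub> s" unfolding pr using sc m by simp
    finally have "lincomb c (insert v B) = \<zero>\<^bsub>M\<^esub>" using sc by (simp add: M.r_neg)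
    then have "c v = \<zero>" using indep_coeff_zero[of "insert v B" c v] L cc by blast
    then show False using uniformizer_pow_less[of "r - 1"] length_pos by (simp add: c_def)
  qed
next
  note B' = indepD(1,2)[OF B]
  assume R: "v \<notin> span B <+>\<^bsub>M\<^esub> scaled 1 (carrier M)"
  have vB: "v \<notin> span B"
  proof
    assume "v \<in> span B"
    moreover have "\<zero>\<^bsub>M\<^esub> \<in> scaled 1 (carrier M)" by (auto simp: scaled_def intro!: image_eqI[of _ _ "\<zero>\<^bsub>M\<^esub>"])
    moreover have "v = v \<oplus>\<^bsub>M\<^esub> \<zero>\<^bsub>M\<^esub>" using v by simp
    ultimately show False using R unfolding set_add_def' by blast
  qed
  then have vB': "v \<notin> B" using in_own_span[OF B'(2)] by blast
  have "indep (insert v B)"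
  proof (rule indepI)
    fix a w assume a: "a \<in> insert v B \<rightarrow> carrier R" and 0: "lincomb a (insert v B) = \<zero>\<^bsub>M\<^esub>"
      and w: "w \<in> insert v B"
    have av: "a v \<in> carrier R" and aB: "a \<in> B \<rightarrow> carrier R" using a by auto
    define s where "s = lincomb a B"
    have s: "s \<in> span B" unfolding s_def using lincomb_in_span[OF B' aB] .
    have sc: "s \<in> carrier M" using s span_closed[OF B'(2)] by blast
    have sum0: "a v \<odot>\<^bsub>M\<^esub> v \<oplus>\<^bsub>M\<^esub> s = \<zero>\<^bsub>M\<^esub>"
      using lincomb_insert_eq[OF B' v vB' a] 0 by (simp add: s_def)
    have "a v = \<zero>"
    proof (rule ccontr)
      \<comment> \<open>Write the coefficient of \<open>v\<close> as \<open>p^k u\<close>. Then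
        \<open>p^k v\<close> is in \<open>span B\<close>, by purity it is \<open>p^k b\<close> with
        \<open>b\<close> in \<open>span B\<close>, and so \<open>v - b\<close> is killed by
        \<open>p^k\<close>. It therefore lies in \<open>p^(r-k) M\<close>, which is inside
        \<open>p M\<close> because \<open>k < r\<close>.\<close>
      assume "a v \<noteq> \<zero>"
      then obtain u k where u: "u \<in> Units R" "k < r" "a v = p [^] k \<otimes> u"
        using unit_times_pow[OF av] by blast
      define t where "t = (\<ominus> (inv u)) \<odot>\<^bsub>M\<^esub> s"
      have uc: "u \<in> carrier R" "inv u \<in> carrier R" using u by auto
      have t: "t \<in> span B" unfolding t_def using span_smult[OF B'(2) _ s] uc by blast
      have tc: "t \<in> carrier M" using t span_closed[OF B'(2)] by blast
      have "inv u \<otimes> a v = p [^] k" using u uc m_lcomm[of "inv u" "p [^] k" u] by simp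
      then have "p [^] k \<odot>\<^bsub>M\<^esub> v = inv u \<odot>\<^bsub>M\<^esub> (a v \<odot>\<^bsub>M\<^esub> v)"
        using uc av v by (simp add: smult_assoc1[symmetric])
      also have "a v \<odot>\<^bsub>M\<^esub> v = \<ominus>\<^bsub>M\<^esub> s" using sum0 av v sc by (simp add: M.minus_equality M.add.inv_equality)
      also have "inv u \<odot>\<^bsub>M\<^esub> \<ominus>\<^bsub>M\<^esub> s = t" unfolding t_def using uc sc by (simp add: smult_r_minus smult_l_minus)
      finally have pv: "p [^] k \<odot>\<^bsub>M\<^esub> v = t" .
      then have "t \<in> scaled k (span B)"
        using span_Int_scaled[OF B, of k] t u(2) v unfolding scaled_def by auto
      then obtain b where b: "b \<in> span B" "t = p [^] k \<odot>\<^bsub>M\<^esub> b" by (auto simp: scaled_def)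
      have bc: "b \<in> carrier M" using b span_closed[OF B'(2)] by blast
      have "p [^] k \<odot>\<^bsub>M\<^esub> (v \<ominus>\<^bsub>M\<^esub> b) = \<zero>\<^bsub>M\<^esub>"
        using pv b bc v by (simp add: M.minus_eq smult_r_distr smult_r_minus M.r_neg)
      then have "v \<ominus>\<^bsub>M\<^esub> b \<in> scaled (r - k) (carrier M)"
        using annihilator_span[OF E(1), of "v \<ominus>\<^bsub>M\<^esub> b" k] E(2) u(2) v bc by simp
      then obtain m where m: "m \<in> carrier M" "v \<ominus>\<^bsub>M\<^esub> b = p [^] (r - k) \<odot>\<^bsub>M\<^esub> m" by (auto simp: scaled_def)
      have "r - k = Suc (r - k - 1)" using u(2) by simp
      then have "p [^] (r - k) = p \<otimes> p [^] (r - k - 1)"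
        using m_comm[of p "p [^] (r - k - 1)"] by (metis nat_pow_Suc nat_pow_closed uniformizer_closed)
      then have "v \<ominus>\<^bsub>M\<^esub> b = p [^] (1::nat) \<odot>\<^bsub>M\<^esub> (p [^] (r - k - 1) \<odot>\<^bsub>M\<^esub> m)"
        using m by (simp add: smult_assoc1)
      then have "v \<ominus>\<^bsub>M\<^esub> b \<in> scaled 1 (carrier M)" using m unfolding scaled_def by blast
      moreover have "v = b \<oplus>\<^bsub>M\<^esub> (v \<ominus>\<^bsub>M\<^esub> b)"
        using v bc by (simp add: M.minus_eq M.a_lcomm[of b v] M.r_neg)
      ultimately show False using R b unfolding set_add_def' by blast
    qed
    moreover have "a w = \<zero>" if "w \<in> B"
    proof -
      have "lincomb a B = \<zero>\<^bsub>M\<^esub>" using sum0 \<open>a v = \<zero>\<close> v sc by (simp add: s_def)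
      then show ?thesis using indep_coeff_zero[OF B aB _ that] by blast
    qed
    ultimately show "a w = \<zero>" using w by blast
  qed (use B' v in auto)
  then show "v \<notin> B \<and> indep (insert v B)" using vB' by blast
qed

end

section \<open>Counting free submodules of a free module\<close>

locale free_chain_module = chain_module R p r M
  for R (structure) and p and r and M (structure) +
  fixes E :: "'c set"
  assumes basis: "indep E" "span E = carrier M"
begin

abbreviation q :: nat where "q \<equiv> residue_order"

text \<open>\<open>W\<close> is a parameter because the same count serves the whole module and each
  of its free submodules.\<close>

definition free_subs :: "nat \<Rightarrow> 'c set \<Rightarrow> 'c set set" where
  "free_subs n W = {V. V \<subseteq> W \<and> (\<exists>B. indep B \<and> card B = n \<and> span B = V)}"

text \<open>Bases are sets, not tuples; this is the origin of the factor \<open>fact n\<close> in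
  the counts.\<close>

definition indep_sets :: "nat \<Rightarrow> 'c set \<Rightarrow> 'c set set" where
  "indep_sets n W = {B. indep B \<and> card B = n \<and> B \<subseteq> W}"

lemma add_minus_cancel:
  assumes "x \<in> carrier M" "y \<in> carrier M"
  shows "x \<oplus>\<^bsub>M\<^esub> (y \<ominus>\<^bsub>M\<^esub> x) = y" "(x \<oplus>\<^bsub>M\<^esub> y) \<ominus>\<^bsub>M\<^esub> x = y"
  using assms M.a_comm[of y "\<ominus>\<^bsub>M\<^esub> x"] M.a_comm[of "x \<oplus>\<^bsub>M\<^esub> y" "\<ominus>\<^bsub>M\<^esub> x"]
  by (simp_all add: M.minus_eq M.r_neg1 M.r_neg2)

lemma scaled_submodule:
  assumes "submodule R A M"
  shows "submodule R (scaled k A) M"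
proof -
  have A: "A \<subseteq> carrier M" "\<zero>\<^bsub>M\<^esub> \<in> A" "\<And>x y. x \<in> A \<Longrightarrow> y \<in> A \<Longrightarrow> x \<oplus>\<^bsub>M\<^esub> y \<in> A"
    "\<And>c x. c \<in> carrier R \<Longrightarrow> x \<in> A \<Longrightarrow> c \<odot>\<^bsub>M\<^esub> x \<in> A"
    using assms unfolding submodule_def by auto
  show ?thesis
    unfolding submodule_def
  proof (intro conjI allI impI module_axioms)
    show "scaled k A \<subseteq> carrier M" using A(1) by (auto simp: scaled_def)
    show "\<zero>\<^bsub>M\<^esub> \<in> scaled k A" unfolding scaled_def by (rule image_eqI[OF _ A(2)]) simp
    fix x y assume xy: "x \<in> scaled k A" "y \<in> scaled k A"
    then obtain a b where ab: "a \<in> A" "b \<in> A" "x = p [^] k \<odot>\<^bsub>M\<^esub> a" "y = p [^] k \<odot>\<^bsub>M\<^esub> b"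
      by (auto simp: scaled_def)
    then have "x \<oplus>\<^bsub>M\<^esub> y = p [^] k \<odot>\<^bsub>M\<^esub> (a \<oplus>\<^bsub>M\<^esub> b)" using A(1) by (simp add: smult_r_distr subset_iff)
    then show "x \<oplus>\<^bsub>M\<^esub> y \<in> scaled k A" using A(3) ab unfolding scaled_def by blast
  next
    fix c x assume c: "c \<in> carrier R" and x: "x \<in> scaled k A"
    then obtain a where a: "a \<in> A" "x = p [^] k \<odot>\<^bsub>M\<^esub> a" by (auto simp: scaled_def)
    then have "c \<odot>\<^bsub>M\<^esub> x = p [^] k \<odot>\<^bsub>M\<^esub> (c \<odot>\<^bsub>M\<^esub> a)"
      using A(1) c by (simp add: smult_assoc1[symmetric] m_comm subset_iff)
    then show "c \<odot>\<^bsub>M\<^esub> x \<in> scaled k A" using A(4) a c unfolding scaled_def by blast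
  qed
qed

text \<open>The addition map from pairs in \<open>A\<close> and \<open>B\<close> onto the sum has
  the fibres \<open>(a0 + t, b0 - t)\<close> with \<open>t\<close> in the intersection.\<close>

lemma card_set_add:
  assumes A: "submodule R A M" and B: "submodule R B M" and fin: "finite A" "finite B"
  shows "card (A <+>\<^bsub>M\<^esub> B) * card (A \<inter> B) = card A * card B"
proof -
  have A': "A \<subseteq> carrier M" "\<And>x y. x \<in> A \<Longrightarrow> y \<in> A \<Longrightarrow> x \<oplus>\<^bsub>M\<^esub> y \<in> A"
    "\<And>c x. c \<in> carrier R \<Longrightarrow> x \<in> A \<Longrightarrow> c \<odot>\<^bsub>M\<^esub> x \<in> A"
    using A unfolding submodule_def by auto
  have B': "B \<subseteq> carrier M" "\<And>x y. x \<in> B \<Longrightarrow> y \<in> B \<Longrightarrow> x \<oplus>\<^bsub>M\<^esub> y \<in> B"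
    "\<And>c x. c \<in> carrier R \<Longrightarrow> x \<in> B \<Longrightarrow> c \<odot>\<^bsub>M\<^esub> x \<in> B"
    using B unfolding submodule_def by auto
  have neg: "\<ominus>\<^bsub>M\<^esub> x = (\<ominus> \<one>) \<odot>\<^bsub>M\<^esub> x" if "x \<in> carrier M" for x
    using smult_l_minus[of \<one> x] that by simp
  have negA: "\<ominus>\<^bsub>M\<^esub> x \<in> A" if "x \<in> A" for x
    using neg[of x] A'(3)[of "\<ominus> \<one>" x] that A'(1) by auto
  have negB: "\<ominus>\<^bsub>M\<^esub> x \<in> B" if "x \<in> B" for x
    using neg[of x] B'(3)[of "\<ominus> \<one>" x] that B'(1) by auto
  let ?f = "\<lambda>(a, b). a \<oplus>\<^bsub>M\<^esub> b"
  have im: "?f ` (A \<times> B) = A <+>\<^bsub>M\<^esub> B" by (auto simp: set_add_def')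
  have fiber: "{ab \<in> A \<times> B. ?f ab = s} = (\<lambda>t. (a0 \<oplus>\<^bsub>M\<^esub> t, b0 \<ominus>\<^bsub>M\<^esub> t)) ` (A \<inter> B)"
    if ab0: "a0 \<in> A" "b0 \<in> B" "s = a0 \<oplus>\<^bsub>M\<^esub> b0" for a0 b0 s
  proof (intro equalityI subsetI)
    have c0: "a0 \<in> carrier M" "b0 \<in> carrier M" using ab0 A'(1) B'(1) by auto
    fix x assume "x \<in> {ab \<in> A \<times> B. ?f ab = s}"
    then obtain a b where ab: "a \<in> A" "b \<in> B" "x = (a, b)" "a \<oplus>\<^bsub>M\<^esub> b = a0 \<oplus>\<^bsub>M\<^esub> b0" using ab0 by auto
    have c: "a \<in> carrier M" "b \<in> carrier M" using ab A'(1) B'(1) by auto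
    define t where "t = a \<ominus>\<^bsub>M\<^esub> a0"
    have tc: "t \<in> carrier M" unfolding t_def using c c0 by simp
    have at: "a0 \<oplus>\<^bsub>M\<^esub> t = a" unfolding t_def using add_minus_cancel(1) c c0 by blast
    then have "a0 \<oplus>\<^bsub>M\<^esub> (t \<oplus>\<^bsub>M\<^esub> b) = a0 \<oplus>\<^bsub>M\<^esub> b0"
      using ab(4) c c0 tc by (simp add: M.a_assoc[symmetric])
    then have tb: "b0 = t \<oplus>\<^bsub>M\<^esub> b" using c c0 tc by simp
    have bt: "b0 \<ominus>\<^bsub>M\<^esub> t = b" unfolding tb using add_minus_cancel(2) c tc by blast
    have t2: "t = b0 \<ominus>\<^bsub>M\<^esub> b"
      unfolding tb M.a_comm[OF tc c(2)] using add_minus_cancel(2)[OF c(2) tc] by simp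
    have tA: "t \<in> A" unfolding t_def M.minus_eq using ab ab0 negA A'(2) by blast
    have tB: "t \<in> B" unfolding t2 M.minus_eq using ab ab0 negB B'(2) by blast
    show "x \<in> (\<lambda>t. (a0 \<oplus>\<^bsub>M\<^esub> t, b0 \<ominus>\<^bsub>M\<^esub> t)) ` (A \<inter> B)"
      using tA tB ab(3) at bt by blast
  next
    have c0: "a0 \<in> carrier M" "b0 \<in> carrier M" using ab0 A'(1) B'(1) by auto
    fix x assume "x \<in> (\<lambda>t. (a0 \<oplus>\<^bsub>M\<^esub> t, b0 \<ominus>\<^bsub>M\<^esub> t)) ` (A \<inter> B)"
    then obtain t where t: "t \<in> A" "t \<in> B" "x = (a0 \<oplus>\<^bsub>M\<^esub> t, b0 \<ominus>\<^bsub>M\<^esub> t)" by blast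
    have tc: "t \<in> carrier M" using t A'(1) by auto
    have "a0 \<oplus>\<^bsub>M\<^esub> t \<in> A" using A'(2) t ab0 by blast
    moreover have "b0 \<ominus>\<^bsub>M\<^esub> t \<in> B" unfolding M.minus_eq using B'(2) negB t ab0 by blast
    moreover have "(a0 \<oplus>\<^bsub>M\<^esub> t) \<oplus>\<^bsub>M\<^esub> (b0 \<ominus>\<^bsub>M\<^esub> t) = s"
      unfolding ab0 using tc c0 add_minus_cancel(1)[OF tc c0(2)] by (simp add: M.a_assoc)
    ultimately show "x \<in> {ab \<in> A \<times> B. ?f ab = s}" using t(3) by simp
  qed
  have inj: "inj_on (\<lambda>t. (a0 \<oplus>\<^bsub>M\<^esub> t, b0 \<ominus>\<^bsub>M\<^esub> t)) (A \<inter> B)" if "a0 \<in> A" for a0 b0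
  proof (rule inj_onI)
    fix s t assume st: "s \<in> A \<inter> B" "t \<in> A \<inter> B"
      "(a0 \<oplus>\<^bsub>M\<^esub> s, b0 \<ominus>\<^bsub>M\<^esub> s) = (a0 \<oplus>\<^bsub>M\<^esub> t, b0 \<ominus>\<^bsub>M\<^esub> t)"
    then have "s \<in> carrier M" "t \<in> carrier M" "a0 \<in> carrier M" using A'(1) that by auto
    then show "s = t" using st(3) by simp
  qed
  have fin': "finite (A <+>\<^bsub>M\<^esub> B)" unfolding im[symmetric] using fin by simp
  have "card (A \<times> B) = card (A \<inter> B) * card (A <+>\<^bsub>M\<^esub> B)"
  proof (rule card_eq_fibers(2)[OF fin' im])
    fix s assume "s \<in> A <+>\<^bsub>M\<^esub> B"
    then obtain a0 b0 where ab0: "a0 \<in> A" "b0 \<in> B" "s = a0 \<oplus>\<^bsub>M\<^esub> b0" unfolding set_add_def' by blast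
    show "finite {ab \<in> A \<times> B. ?f ab = s}" unfolding fiber[OF ab0] using fin by simp
    show "card {ab \<in> A \<times> B. ?f ab = s} = card (A \<inter> B)"
      unfolding fiber[OF ab0] by (rule card_image[OF inj[OF ab0(1)]])
  qed
  then show ?thesis by (simp add: card_cartesian_product mult.commute)
qed

text \<open>By purity \<open>span B\<close> meets \<open>p span F\<close> in
  \<open>p span B\<close>: modulo \<open>p\<close> the set \<open>B\<close> stays
  independent.\<close>

lemma card_span_add_scaled:
  assumes F: "indep F" and B: "indep B" "B \<subseteq> span F"
  shows "card (span B <+>\<^bsub>M\<^esub> scaled 1 (span F)) = q ^ ((r - 1) * card F + card B)"
proof -
  note B' = indepD(1,2)[OF B(1)] and F' = indepD(1,2)[OF F]
  have q0: "q > 0" using residue_order_ge_2 by simp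
  have "scaled 1 (span B) \<subseteq> scaled 1 (span F)" by (intro scaled_mono span_subset_spanI F' B)
  moreover have "scaled 1 (span F) \<subseteq> scaled 1 (carrier M)" by (intro scaled_mono span_closed F')
  ultimately have int: "span B \<inter> scaled 1 (span F) = scaled 1 (span B)"
    using span_Int_scaled[OF B(1) length_pos] by blast
  have "card (span B <+>\<^bsub>M\<^esub> scaled 1 (span F)) * q ^ ((r - 1) * card B)
      = q ^ (r * card B) * q ^ ((r - 1) * card F)"
    using card_set_add[of "span B" "scaled 1 (span F)"] int card_span[OF B(1)]
      card_scaled_span[OF F length_pos] card_scaled_span[OF B(1) length_pos]
      span_is_submodule B' F' span_finite scaled_submodule[of "span F" 1]
    by (simp add: scaled_def)
  also have "r * card B = card B + (r - 1) * card B" using length_pos by (cases r) auto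
  finally show ?thesis using q0 by (simp add: power_add mult_ac)
qed

text \<open>\<open>indep_insert_iff\<close> works modulo \<open>p M\<close>, while vectors are
  counted inside \<open>span F\<close>; purity of \<open>span F\<close> reconciles the two.\<close>

lemma mem_span_add_scaled_iff:
  assumes F: "indep F" and B: "B \<subseteq> span F" and v: "v \<in> span F"
  shows "v \<in> span B <+>\<^bsub>M\<^esub> scaled 1 (carrier M) \<longleftrightarrow> v \<in> span B <+>\<^bsub>M\<^esub> scaled 1 (span F)"
proof
  note F' = indepD(1,2)[OF F]
  assume "v \<in> span B <+>\<^bsub>M\<^esub> scaled 1 (carrier M)"
  then obtain s t where s: "s \<in> span B" and t: "t \<in> scaled 1 (carrier M)" and v': "v = s \<oplus>\<^bsub>M\<^esub> t"
    unfolding set_add_def' by blast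
  have sF: "s \<in> span F" using s span_subset_spanI[OF F'(2) B] by blast
  have c: "s \<in> carrier M" "t \<in> carrier M" using sF t span_closed[OF F'(2)] scaled_closed[of "carrier M"] by auto
  have "t = v \<oplus>\<^bsub>M\<^esub> \<ominus>\<^bsub>M\<^esub> s" unfolding v' using add_minus_cancel(2)[OF c] by (simp add: M.minus_eq)
  then have "t \<in> span F" using span_add[OF F'(2) v span_neg[OF F'(2) sF]] by simp
  then have "t \<in> scaled 1 (span F)" using span_Int_scaled[OF F length_pos] t by blast
  then show "v \<in> span B <+>\<^bsub>M\<^esub> scaled 1 (span F)" using s v' unfolding set_add_def' by blast
next
  assume "v \<in> span B <+>\<^bsub>M\<^esub> scaled 1 (span F)"
  then show "v \<in> span B <+>\<^bsub>M\<^esub> scaled 1 (carrier M)"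
    using scaled_mono[OF span_closed[OF indepD(2)[OF F]], of 1] unfolding set_add_def' by blast
qed

lemma card_extensions:
  assumes F: "indep F" and B: "indep B" "B \<subseteq> span F"
  shows "card {v \<in> span F. v \<notin> B \<and> indep (insert v B)}
    = q ^ (r * card F) - q ^ ((r - 1) * card F + card B)"
proof -
  note B' = indepD(1,2)[OF B(1)] and F' = indepD(1,2)[OF F]
  let ?U = "span B <+>\<^bsub>M\<^esub> scaled 1 (span F)"
  have U: "?U \<subseteq> span F"
    using span_subset_spanI[OF F'(2) B(2)] scaled_span_subset[OF F'(2), of 1] span_add[OF F'(2)]
    unfolding set_add_def' by blast
  have "{v \<in> span F. v \<notin> B \<and> indep (insert v B)} = span F - ?U"
    using indep_insert_iff[OF basis B(1)] mem_span_add_scaled_iff[OF F B(2)] span_closed[OF F'(2)] by blast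
  then show ?thesis
    using card_Diff_subset[OF finite_subset[OF U] U] span_finite[OF F'] card_span[OF F]
      card_span_add_scaled[OF F B] by simp
qed

lemma finite_indep_sets: "finite W \<Longrightarrow> finite (indep_sets n W)"
  by (rule finite_subset[of _ "Pow W"]) (auto simp: indep_sets_def)

text \<open>Double counting of the pairs of an independent set of size \<open>Suc n\<close> and one
  of its elements: removing the element leaves a set of size \<open>n\<close> with an admissible
  extension.\<close>

lemma card_indep_sets_Suc:
  assumes F: "indep F"
  shows "card (indep_sets (Suc n) (span F)) * Suc n
    = card (indep_sets n (span F)) * (q ^ (r * card F) - q ^ ((r - 1) * card F + n))"
proof -
  note F' = indepD(1,2)[OF F]
  let ?W = "span F" and ?ext = "\<lambda>B. {v \<in> span F. v \<notin> B \<and> indep (insert v B)}"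
  have fW: "finite ?W" using span_finite[OF F'] .
  have "bij_betw (\<lambda>(B, v). (B - {v}, v)) (Sigma (indep_sets (Suc n) ?W) (\<lambda>B. B)) (Sigma (indep_sets n ?W) ?ext)"
  proof (rule bij_betw_byWitness[where f' = "\<lambda>(B, v). (insert v B, v)"])
    show "(\<lambda>(B, v). (B - {v}, v)) ` (Sigma (indep_sets (Suc n) ?W) (\<lambda>B. B)) \<subseteq> Sigma (indep_sets n ?W) ?ext"
      by (auto simp: indep_sets_def insert_absorb intro: indep_subset dest: indepD)
    show "(\<lambda>(B, v). (insert v B, v)) ` (Sigma (indep_sets n ?W) ?ext) \<subseteq> Sigma (indep_sets (Suc n) ?W) (\<lambda>B. B)"
      by (auto simp: indep_sets_def dest: indepD(1))
  qed auto
  then have "card (Sigma (indep_sets (Suc n) ?W) (\<lambda>B. B)) = card (Sigma (indep_sets n ?W) ?ext)"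
    by (rule bij_betw_same_card)
  moreover have "card (Sigma (indep_sets (Suc n) ?W) (\<lambda>B. B)) = (\<Sum>B\<in>indep_sets (Suc n) ?W. Suc n)"
    using finite_indep_sets[OF fW]
    by (subst card_SigmaI) (auto simp: indep_sets_def indepD intro!: sum.cong)
  moreover have "card (Sigma (indep_sets n ?W) ?ext)
      = (\<Sum>B\<in>indep_sets n ?W. q ^ (r * card F) - q ^ ((r - 1) * card F + n))"
    using finite_indep_sets[OF fW] fW card_extensions[OF F]
    by (subst card_SigmaI) (auto simp: indep_sets_def intro!: sum.cong)
  ultimately show ?thesis by simp
qed

text \<open>Times \<open>fact n\<close> this counts ordered tuples: independent tuples over the
  residue field, each vector having \<open>q^((r-1) * card F)\<close> lifts.\<close>

lemma card_indep_sets: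
  assumes F: "indep F"
  shows "card (indep_sets n (span F)) * fact n = q ^ ((r - 1) * card F * n) * (\<Prod>i<n. q ^ card F - q ^ i)"
proof (induction n)
  case 0
  have "indep {}" using indep_subset[OF F] by blast
  then have "indep_sets 0 (span F) = {{}}" by (auto simp: indep_sets_def dest: indepD(1))
  then show ?case by simp
next
  case (Suc n)
  have r': "r * card F = (r - 1) * card F + card F" using length_pos by (cases r) auto
  have "card (indep_sets (Suc n) (span F)) * fact (Suc n)
      = (card (indep_sets (Suc n) (span F)) * Suc n) * fact n" by (simp only: fact_Suc of_nat_id mult_ac)
  also have "\<dots> = (card (indep_sets n (span F)) * fact n) * (q ^ (r * card F) - q ^ ((r - 1) * card F + n))"
    unfolding card_indep_sets_Suc[OF F] by (simp add: mult_ac)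
  also have "q ^ (r * card F) - q ^ ((r - 1) * card F + n) = q ^ ((r - 1) * card F) * (q ^ card F - q ^ n)"
    unfolding r' by (simp add: power_add diff_mult_distrib2)
  finally have "card (indep_sets (Suc n) (span F)) * fact (Suc n)
      = q ^ ((r - 1) * card F * n) * (\<Prod>i<n. q ^ card F - q ^ i)
        * (q ^ ((r - 1) * card F) * (q ^ card F - q ^ n))" unfolding Suc .
  then show ?case unfolding mult_Suc_right power_add prod.lessThan_Suc by (simp only: mult_ac)
qed

lemma exists_extension:
  assumes F: "indep F" and B: "indep B" "B \<subseteq> span F" and less: "card B < card F"
  shows "\<exists>v\<in>span F. v \<notin> B \<and> indep (insert v B)"
proof -
  have "r * card F = (r - 1) * card F + card F" using length_pos by (cases r) auto
  then have "(r - 1) * card F + card B < r * card F" using less by linarith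
  then have "q ^ ((r - 1) * card F + card B) < q ^ (r * card F)"
    using residue_order_ge_2 by (intro power_strict_increasing) auto
  then have "card {v \<in> span F. v \<notin> B \<and> indep (insert v B)} \<noteq> 0" using card_extensions[OF F B] by simp
  then show ?thesis by (metis (mono_tags, lifting) Collect_empty_eq card.empty)
qed

lemma span_eq_of_card:
  assumes F: "indep F" and B: "indep B" "B \<subseteq> span F" "card B = card F"
  shows "span B = span F"
  using card_subset_eq[OF span_finite[OF indepD(1,2)[OF F]] span_subset_spanI[OF indepD(2)[OF F] B(2)]]
    card_span[OF F] card_span[OF B(1)] B(3) by simp

lemma card_le_of_subset_span:
  assumes F: "indep F" and B: "indep B" "B \<subseteq> span F"
  shows "card B \<le> card F"
proof -
  have "q ^ (r * card B) \<le> q ^ (r * card F)"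
    using card_mono[OF span_finite[OF indepD(1,2)[OF F]] span_subset_spanI[OF indepD(2)[OF F] B(2)]]
      card_span[OF F] card_span[OF B(1)] by simp
  then have "r * card B \<le> r * card F" using residue_order_ge_2 by (simp add: power_le_imp_le_exp)
  then show ?thesis using length_pos by simp
qed

lemma extend_to_basis:
  assumes F: "indep F" and B: "indep B" "B \<subseteq> span F"
  obtains C where "indep C" "B \<subseteq> C" "C \<subseteq> span F" "card C = card F" "span C = span F"
proof -
  have "\<exists>C. indep C \<and> B \<subseteq> C \<and> C \<subseteq> span F \<and> card C = card F"
    using B
  proof (induction "card F - card B" arbitrary: B)
    case 0 then show ?case using card_le_of_subset_span[OF F] by (metis diff_is_0_eq order_antisym order_refl)
  next
    case (Suc n)
    have "card B < card F" using Suc(2) by simp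
    then obtain v where v: "v \<in> span F" "v \<notin> B" "indep (insert v B)"
      using exists_extension[OF F Suc(3,4)] by blast
    have "card (insert v B) = Suc (card B)" using v indepD(1)[OF Suc(3)] by simp
    then have "\<exists>C. indep C \<and> insert v B \<subseteq> C \<and> C \<subseteq> span F \<and> card C = card F"
      using Suc(1)[of "insert v B"] Suc(2,4) v by simp
    then show ?case by blast
  qed
  then show ?thesis using that span_eq_of_card[OF F] by blast
qed

lemma free_subsE:
  assumes "V \<in> free_subs n W"
  obtains B where "indep B" "card B = n" "span B = V" "B \<subseteq> W" "V \<subseteq> W"
  using assms in_own_span unfolding free_subs_def indep_def by blast

lemma finite_free_subs: "finite W \<Longrightarrow> finite (free_subs n W)"
  by (rule finite_subset[of _ "Pow W"]) (auto simp: free_subs_def)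

text \<open>All free submodules of rank \<open>n\<close> have equally many bases, so their number is
  a quotient of two basis counts.\<close>

lemma card_free_subs:
  assumes F: "indep F" and n: "n \<le> card F"
  shows "card (free_subs n (span F)) = q_binomial q (card F) n * q ^ ((r - 1) * n * (card F - n))"
proof -
  note F' = indepD(1,2)[OF F]
  let ?e = "card F"
  have fW: "finite (span F)" using span_finite[OF F'] .
  have im: "span ` indep_sets n (span F) = free_subs n (span F)"
  proof (intro equalityI subsetI)
    fix V assume "V \<in> span ` indep_sets n (span F)"
    then show "V \<in> free_subs n (span F)"
      using span_subset_spanI[OF F'(2)] by (auto simp: indep_sets_def free_subs_def)
  next
    fix V assume "V \<in> free_subs n (span F)"
    then show "V \<in> span ` indep_sets n (span F)"
      by (elim free_subsE) (auto simp: indep_sets_def intro!: image_eqI)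
  qed
  \<comment> \<open>\<open>g\<close> is the number of ordered bases of one free module of rank
    \<open>n\<close>.\<close>
  define g where "g = q ^ ((r - 1) * n * n) * (\<Prod>i<n. q ^ n - q ^ i)"
  have fib: "card {B \<in> indep_sets n (span F). span B = V} * fact n = g" if V: "V \<in> free_subs n (span F)" for V
  proof -
    obtain B where B: "indep B" "card B = n" "span B = V" "V \<subseteq> span F" using V by (elim free_subsE)
    have "{B \<in> indep_sets n (span F). span B = V} = indep_sets n (span B)"
    proof (intro equalityI subsetI)
      fix C assume "C \<in> {B \<in> indep_sets n (span F). span B = V}"
      then show "C \<in> indep_sets n (span B)"
        using in_own_span[of C] B(3) unfolding indep_sets_def indep_def by blast
    next
      fix C assume C: "C \<in> indep_sets n (span B)"
      then have "span C = V" using span_eq_of_card[OF B(1), of C] B by (auto simp: indep_sets_def)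
      then show "C \<in> {B \<in> indep_sets n (span F). span B = V}"
        using C B by (auto simp: indep_sets_def)
    qed
    then show ?thesis using card_indep_sets[OF B(1), of n] B(2) by (simp add: g_def)
  qed
  have gpos: "g > 0"
  proof -
    have "q ^ i < q ^ n" if "i < n" for i using residue_order_ge_2 that by simp
    then show ?thesis using residue_order_ge_2 by (simp add: g_def)
  qed
  \<comment> \<open>By \<open>fib\<close> this division is exact as soon as a submodule of rank
    \<open>n\<close> exists.\<close>
  define c where "c = g div fact n"
  have c: "c * fact n = g" if "V \<in> free_subs n (span F)" for V
    using fib[OF that] unfolding c_def by (metis dvd_triv_right dvd_div_mult_self)
  have "card (indep_sets n (span F)) = c * card (free_subs n (span F))"
  proof (rule card_eq_fibers(2)[OF finite_free_subs[OF fW] im])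
    fix V assume V: "V \<in> free_subs n (span F)"
    show "finite {B \<in> indep_sets n (span F). span B = V}" using finite_indep_sets[OF fW] by simp
    have "card {B \<in> indep_sets n (span F). span B = V} * fact n = c * fact n" using fib[OF V] c[OF V] by simp
    then show "card {B \<in> indep_sets n (span F). span B = V} = c" by (simp only: mult_cancel2 fact_nonzero simp_thms)
  qed
  moreover have "free_subs n (span F) \<noteq> {}"
  proof -
    obtain B where "B \<subseteq> F" "card B = n" using n by (meson obtain_subset_with_card_n)
    then have "B \<in> indep_sets n (span F)"
      using indep_subset[OF F] in_own_span[OF F'(2)] by (auto simp: indep_sets_def)
    then show ?thesis using im by blast
  qed
  ultimately have "card (free_subs n (span F)) * g = card (indep_sets n (span F)) * fact n"
    using c by auto
  also have "\<dots> = q ^ ((r - 1) * ?e * n) * (q_binomial q ?e n * (\<Prod>i<n. q ^ n - q ^ i))"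
    unfolding card_indep_sets[OF F] q_binomial_prod[OF residue_order_ge_2 n] ..
  also have "(r - 1) * ?e * n = (r - 1) * n * (?e - n) + (r - 1) * n * n"
  proof -
    have "(r - 1) * ?e * n = (r - 1) * n * ((?e - n) + n)" using n by (simp add: mult_ac)
    then show ?thesis by (simp only: distrib_left)
  qed
  also have "q ^ ((r - 1) * n * (?e - n) + (r - 1) * n * n) * (q_binomial q ?e n * (\<Prod>i<n. q ^ n - q ^ i))
     = q_binomial q ?e n * q ^ ((r - 1) * n * (?e - n)) * g"
    unfolding g_def by (simp add: power_add mult_ac)
  finally show ?thesis using gpos by simp
qed

end

section \<open>Congruence classes of lines\<close>

context free_chain_module begin

text \<open>The full preimage of the image of \<open>V\<close> in \<open>M / p^k M\<close>. Two
  lines are congruent modulo \<open>p^k\<close> iff their thickenings are equal, which stands in for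
  the quotient modules.\<close>

definition thick :: "nat \<Rightarrow> 'c set \<Rightarrow> 'c set" where
  "thick k V = V <+>\<^bsub>M\<^esub> scaled k (carrier M)"

lemma carrier_submodule: "submodule R (carrier M) M"
  using span_is_submodule[OF indepD(2)[OF basis(1)]] basis(2) by simp

lemma finite_M: "finite (carrier M)"
  using span_finite[OF indepD(1,2)[OF basis(1)]] basis(2) by simp

lemma scaled_M_add: "s \<in> scaled k (carrier M) \<Longrightarrow> t \<in> scaled k (carrier M) \<Longrightarrow> s \<oplus>\<^bsub>M\<^esub> t \<in> scaled k (carrier M)"
  and scaled_M_smult: "c \<in> carrier R \<Longrightarrow> t \<in> scaled k (carrier M) \<Longrightarrow> c \<odot>\<^bsub>M\<^esub> t \<in> scaled k (carrier M)"
  and scaled_M_zero: "\<zero>\<^bsub>M\<^esub> \<in> scaled k (carrier M)"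
  and scaled_M_closed: "t \<in> scaled k (carrier M) \<Longrightarrow> t \<in> carrier M"
  using scaled_submodule[OF carrier_submodule, of k] unfolding submodule_def by auto

lemma scaled_M_neg: "t \<in> scaled k (carrier M) \<Longrightarrow> \<ominus>\<^bsub>M\<^esub> t \<in> scaled k (carrier M)"
  using scaled_M_smult[of "\<ominus> \<one>" t k] smult_l_minus[of \<one> t] scaled_M_closed[of t k] by simp

lemma scaled_antimono:
  assumes "j \<le> k" "V \<subseteq> carrier M" "\<And>c x. c \<in> carrier R \<Longrightarrow> x \<in> V \<Longrightarrow> c \<odot>\<^bsub>M\<^esub> x \<in> V"
  shows "scaled k V \<subseteq> scaled j V"
proof
  fix x assume "x \<in> scaled k V"
  then obtain m where m: "m \<in> V" "x = p [^] k \<odot>\<^bsub>M\<^esub> m" by (auto simp: scaled_def)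
  have "p [^] k = p [^] j \<otimes> p [^] (k - j)" using assms(1) by (simp add: nat_pow_mult)
  then have "x = p [^] j \<odot>\<^bsub>M\<^esub> (p [^] (k - j) \<odot>\<^bsub>M\<^esub> m)" using m assms(2) by (simp add: smult_assoc1 subset_iff)
  moreover have "p [^] (k - j) \<odot>\<^bsub>M\<^esub> m \<in> V" using assms(3) m by simp
  ultimately show "x \<in> scaled j V" unfolding scaled_def by blast
qed

lemma scaled_M_antimono: "j \<le> k \<Longrightarrow> scaled k (carrier M) \<subseteq> scaled j (carrier M)"
  by (rule scaled_antimono) auto

lemma scaled_r: "V \<subseteq> carrier M \<Longrightarrow> V \<noteq> {} \<Longrightarrow> scaled r V = {\<zero>\<^bsub>M\<^esub>}"
  unfolding scaled_def uniformizer_pow_r by (auto simp: subset_iff)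

lemma scaled_0: "V \<subseteq> carrier M \<Longrightarrow> scaled 0 V = V"
  unfolding scaled_def by (force simp: subset_iff)

lemma span_empty_eq: "span {} = {\<zero>\<^bsub>M\<^esub>}"
  using finite_span[of "{}"] by (auto simp: lincomb_def)

lemma span_singleton: "x \<in> carrier M \<Longrightarrow> span {x} = {c \<odot>\<^bsub>M\<^esub> x | c. c \<in> carrier R}"
proof -
  assume x: "x \<in> carrier M"
  have "lincomb a {x} = a x \<odot>\<^bsub>M\<^esub> x" if "a \<in> {x} \<rightarrow> carrier R" for a
    using lincomb_insert_eq[of "{}" x a] x that by (simp add: lincomb_def)
  then have "span {x} = {a x \<odot>\<^bsub>M\<^esub> x | a. a \<in> {x} \<rightarrow> carrier R}"
    using finite_span[of "{x}"] x by force
  also have "\<dots> = {c \<odot>\<^bsub>M\<^esub> x | c. c \<in> carrier R}"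
  proof (intro equalityI subsetI)
    fix y assume "y \<in> {c \<odot>\<^bsub>M\<^esub> x | c. c \<in> carrier R}"
    then obtain c where "c \<in> carrier R" "y = c \<odot>\<^bsub>M\<^esub> x" by blast
    then show "y \<in> {a x \<odot>\<^bsub>M\<^esub> x | a. a \<in> {x} \<rightarrow> carrier R}"
      by (intro CollectI exI[of _ "\<lambda>_. c"]) auto
  qed auto
  finally show ?thesis .
qed

lemma indep_empty: "indep {}"
  using indep_subset[OF basis(1)] by blast

lemma indep_singleton_iff: "indep {x} \<longleftrightarrow> x \<in> carrier M \<and> x \<notin> scaled 1 (carrier M)"
proof (cases "x \<in> carrier M")
  case True
  have "{\<zero>\<^bsub>M\<^esub>} <+>\<^bsub>M\<^esub> scaled 1 (carrier M) = scaled 1 (carrier M)"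
    unfolding set_add_def' using scaled_M_closed[of _ 1] by force
  then show ?thesis using indep_insert_iff[OF basis indep_empty True] True unfolding span_empty_eq by simp
qed (auto simp: indep_def)

lemma free_subs_1E:
  assumes "l \<in> free_subs 1 W"
  obtains x where "indep {x}" "l = span {x}" "x \<in> W" "l \<subseteq> W" "x \<in> carrier M"
proof -
  obtain B where B: "indep B" "card B = 1" "span B = l" "B \<subseteq> W" "l \<subseteq> W" using free_subsE[OF assms] .
  obtain x where "B = {x}" using B(2) card_1_singletonE by blast
  then show ?thesis using that[of x] B indepD(2)[OF B(1)] by auto
qed

lemma free_subs_1I: "indep {x} \<Longrightarrow> x \<in> span F \<Longrightarrow> indep F \<Longrightarrow> span {x} \<in> free_subs 1 (span F)"
  using span_subset_spanI[OF indepD(2), of F "{x}"] unfolding free_subs_def by force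

lemma thick_iff: "z \<in> thick k V \<longleftrightarrow> (\<exists>s\<in>V. \<exists>t\<in>scaled k (carrier M). z = s \<oplus>\<^bsub>M\<^esub> t)"
  by (auto simp: thick_def set_add_def')

lemma thick_closed: "V \<subseteq> carrier M \<Longrightarrow> thick k V \<subseteq> carrier M"
  using scaled_M_closed[of _ k] by (auto simp: thick_iff subset_iff)

lemma subset_thick: "V \<subseteq> carrier M \<Longrightarrow> V \<subseteq> thick k V"
  using scaled_M_zero[of k] by (force simp: thick_iff)

lemma thick_r: "V \<subseteq> carrier M \<Longrightarrow> V \<noteq> {} \<Longrightarrow> thick r V = V"
proof -
  assume V: "V \<subseteq> carrier M" "V \<noteq> {}"
  have "scaled r (carrier M) = {\<zero>\<^bsub>M\<^esub>}" using M.zero_closed by (intro scaled_r) auto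
  then show ?thesis using V(1) unfolding thick_def set_add_def' by force
qed

lemma thick_0: "V \<subseteq> carrier M \<Longrightarrow> \<zero>\<^bsub>M\<^esub> \<in> V \<Longrightarrow> thick 0 V = carrier M"
proof -
  assume V: "V \<subseteq> carrier M" "\<zero>\<^bsub>M\<^esub> \<in> V"
  have "carrier M \<subseteq> thick 0 V"
    unfolding thick_def set_add_def' scaled_0[OF order_refl] using V(2) by force
  then show ?thesis using thick_closed[OF V(1)] by blast
qed

lemma thick_thick:
  assumes "i \<le> j" "V \<subseteq> carrier M"
  shows "thick i (thick j V) = thick i V"
proof (intro equalityI subsetI)
  fix z assume "z \<in> thick i (thick j V)"
  then obtain s t t' where st: "s \<in> V" "t' \<in> scaled j (carrier M)" "t \<in> scaled i (carrier M)"
    "z = (s \<oplus>\<^bsub>M\<^esub> t') \<oplus>\<^bsub>M\<^esub> t" by (auto simp: thick_iff)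
  have t': "t' \<in> scaled i (carrier M)" using st(2) scaled_M_antimono[OF assms(1)] by blast
  have "z = s \<oplus>\<^bsub>M\<^esub> (t' \<oplus>\<^bsub>M\<^esub> t)"
    unfolding st(4) using st assms(2) scaled_M_closed by (intro M.a_assoc) auto
  then show "z \<in> thick i V" unfolding thick_iff using st(1) scaled_M_add[OF t' st(3)] by blast
next
  fix z assume "z \<in> thick i V"
  then show "z \<in> thick i (thick j V)"
    using subset_thick[OF assms(2), of j] unfolding thick_iff[of z i] by blast
qed

lemma thick_eq_mono:
  assumes "i \<le> j" "V \<subseteq> carrier M" "W \<subseteq> carrier M" "thick j V = thick j W"
  shows "thick i V = thick i W"
  using thick_thick[OF assms(1,2)] thick_thick[OF assms(1,3)] assms(4) by simp

lemma thick_span_subset: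
  assumes x: "x \<in> carrier M" and y: "y \<in> thick k (span {x})"
  shows "thick k (span {y}) \<subseteq> thick k (span {x})"
proof
  obtain c t where c: "c \<in> carrier R" "t \<in> scaled k (carrier M)" "y = c \<odot>\<^bsub>M\<^esub> x \<oplus>\<^bsub>M\<^esub> t"
    using y unfolding thick_iff span_singleton[OF x] by blast
  have tc: "t \<in> carrier M" using c scaled_M_closed by blast
  have yc: "y \<in> carrier M" using c x tc by simp
  fix z assume "z \<in> thick k (span {y})"
  then obtain b s where b: "b \<in> carrier R" "s \<in> scaled k (carrier M)" "z = b \<odot>\<^bsub>M\<^esub> y \<oplus>\<^bsub>M\<^esub> s"
    unfolding thick_iff span_singleton[OF yc] by blast
  have sc: "s \<in> carrier M" using b scaled_M_closed by blast
  have "z = (b \<otimes> c) \<odot>\<^bsub>M\<^esub> x \<oplus>\<^bsub>M\<^esub> (b \<odot>\<^bsub>M\<^esub> t \<oplus>\<^bsub>M\<^esub> s)"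
    unfolding b c using b(1) c(1) x tc sc by (simp add: smult_r_distr smult_assoc1 M.a_assoc)
  moreover have "b \<odot>\<^bsub>M\<^esub> t \<oplus>\<^bsub>M\<^esub> s \<in> scaled k (carrier M)"
    using scaled_M_add scaled_M_smult b c by blast
  moreover have "b \<otimes> c \<in> carrier R" using b c by simp
  ultimately show "z \<in> thick k (span {x})" unfolding thick_iff span_singleton[OF x] by blast
qed

text \<open>Write \<open>y = c x + t\<close> with \<open>t\<close> in \<open>p^k M\<close>. A
  nonunit \<open>c\<close> would put \<open>y\<close> into \<open>p M\<close>, which is impossible
  for an independent vector; a unit \<open>c\<close> lets the relation be solved for
  \<open>x\<close>.\<close>

lemma thick_span_eq_iff:
  assumes x: "indep {x}" and y: "indep {y}" and k: "1 \<le> k"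
  shows "thick k (span {y}) = thick k (span {x}) \<longleftrightarrow> y \<in> thick k (span {x})"
proof
  have xc: "x \<in> carrier M" and yc: "y \<in> carrier M" using x y indepD(2) by auto
  assume "thick k (span {y}) = thick k (span {x})"
  then show "y \<in> thick k (span {x})"
    using subset_thick[OF span_closed, of "{y}" k] in_own_span[of "{y}"] yc by auto
next
  have xc: "x \<in> carrier M" and yc: "y \<in> carrier M" using x y indepD(2) by auto
  assume y': "y \<in> thick k (span {x})"
  obtain c t where c: "c \<in> carrier R" "t \<in> scaled k (carrier M)" "y = c \<odot>\<^bsub>M\<^esub> x \<oplus>\<^bsub>M\<^esub> t"
    using y' unfolding thick_iff span_singleton[OF xc] by blast
  have tc: "t \<in> carrier M" using c scaled_M_closed by blast
  have "c \<in> Units R"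
  proof (rule ccontr)
    assume "c \<notin> Units R"
    then obtain b where b: "b \<in> carrier R" "c = p \<otimes> b" using nonunit[OF c(1)] by (blast elim: multiplesE)
    have "c \<odot>\<^bsub>M\<^esub> x = p [^] (1::nat) \<odot>\<^bsub>M\<^esub> (b \<odot>\<^bsub>M\<^esub> x)" using b xc by (simp add: smult_assoc1)
    then have "c \<odot>\<^bsub>M\<^esub> x \<in> scaled 1 (carrier M)" using b xc unfolding scaled_def by blast
    then have "y \<in> scaled 1 (carrier M)"
      unfolding c(3) using scaled_M_add scaled_M_antimono[OF k] c(2) by blast
    then show False using y indep_singleton_iff by blast
  qed
  then have ic: "inv c \<in> carrier R" "inv c \<otimes> c = \<one>" by auto
  have "inv c \<odot>\<^bsub>M\<^esub> y = x \<oplus>\<^bsub>M\<^esub> inv c \<odot>\<^bsub>M\<^esub> t"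
    unfolding c(3) using ic c(1) xc tc by (simp add: smult_r_distr smult_assoc1[symmetric])
  then have "x = inv c \<odot>\<^bsub>M\<^esub> y \<oplus>\<^bsub>M\<^esub> \<ominus>\<^bsub>M\<^esub> (inv c \<odot>\<^bsub>M\<^esub> t)"
    using xc tc ic by (simp add: M.a_assoc M.r_neg)
  moreover have "\<ominus>\<^bsub>M\<^esub> (inv c \<odot>\<^bsub>M\<^esub> t) \<in> scaled k (carrier M)"
    using scaled_M_neg scaled_M_smult ic c by blast
  ultimately have "x \<in> thick k (span {y})"
    unfolding thick_iff span_singleton[OF yc] using ic by blast
  then show "thick k (span {y}) = thick k (span {x})"
    using thick_span_subset[OF xc y'] thick_span_subset[OF yc] by blast
qed

lemma span_singleton_eq_iff:
  assumes "indep {x}" "indep {y}"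
  shows "span {y} = span {x} \<longleftrightarrow> y \<in> span {x}"
  using span_eq_of_card[OF assms] in_own_span[of "{y}"] indepD(2)[OF assms(2)] by auto

text \<open>
  The generators of the lines of \<open>V\<close> congruent to \<open>l\<close> are the elements of
  \<open>(l + p^k V) - (p l + p^k V)\<close>; each line has \<open>q^r - q^(r-1)\<close> of them.
\<close>

lemma card_line_class:
  assumes F: "indep F" and l: "l \<in> free_subs 1 (span F)" and k: "1 \<le> k" "k \<le> r"
  shows "card {l' \<in> free_subs 1 (span F). thick k l' = thick k l} = q ^ ((r - k) * (card F - 1))"
proof -
  note F' = indepD(1,2)[OF F]
  let ?V = "span F"
  have VM: "?V \<subseteq> carrier M" using span_closed[OF F'(2)] .
  obtain x where x: "indep {x}" "l = span {x}" "x \<in> ?V" "x \<in> carrier M" using free_subs_1E[OF l] by metis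
  have lV: "l \<subseteq> ?V" unfolding x(2) using span_subset_spanI[OF F'(2)] x(3) by simp
  have lc: "l \<subseteq> carrier M" using lV VM by blast
  have cF: "1 \<le> card F" using card_le_of_subset_span[OF F x(1)] x(3) by simp
  \<comment> \<open>The generators of lines among the elements of \<open>A\<close>; by
    \<open>indep_singleton_iff\<close> these are the elements outside \<open>p M\<close>.\<close>
  define G where "G A = {y \<in> A. indep {y}}" for A
  define Y where "Y = G (?V \<inter> thick k l)"
  have G_span: "G (span {y}) = span {y} - scaled 1 (span {y})" if y: "indep {y}" for y
  proof -
    have "span {y} \<inter> scaled 1 (carrier M) = scaled 1 (span {y})" using span_Int_scaled[OF y length_pos] .
    then show ?thesis unfolding G_def indep_singleton_iff using span_closed[OF indepD(2)[OF y]] by blast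
  qed
  have card_G: "card (G (span {y})) = q ^ r - q ^ (r - 1)" if y: "indep {y}" for y
    unfolding G_span[OF y]
    using card_Diff_subset[OF _ scaled_span_subset[OF indepD(2)[OF y], of 1]]
      span_finite[OF indepD(1,2)[OF y]] finite_subset[OF scaled_span_subset[OF indepD(2)[OF y], of 1]]
      card_span[OF y] card_scaled_span[OF y length_pos] by simp
  \<comment> \<open>By purity of \<open>V\<close> the correction from \<open>p^k M\<close> may be
    taken in \<open>p^k V\<close>.\<close>
  have Vthick: "?V \<inter> thick k l = l <+>\<^bsub>M\<^esub> scaled k ?V"
  proof (intro equalityI subsetI)
    fix z assume z: "z \<in> ?V \<inter> thick k l"
    then obtain s t where st: "s \<in> l" "t \<in> scaled k (carrier M)" "z = s \<oplus>\<^bsub>M\<^esub> t" by (auto simp: thick_iff)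
    have c: "s \<in> carrier M" "t \<in> carrier M" using st lc scaled_M_closed by auto
    have "t = z \<oplus>\<^bsub>M\<^esub> \<ominus>\<^bsub>M\<^esub> s" unfolding st(3) using add_minus_cancel(2)[OF c] by (simp add: M.minus_eq)
    then have "t \<in> ?V" using z span_add[OF F'(2) _ span_neg[OF F'(2)]] st(1) lV by blast
    then have "t \<in> scaled k ?V" using span_Int_scaled[OF F k(2)] st(2) by blast
    then show "z \<in> l <+>\<^bsub>M\<^esub> scaled k ?V" using st unfolding set_add_def' by blast
  next
    fix z assume "z \<in> l <+>\<^bsub>M\<^esub> scaled k ?V"
    then obtain s t where st: "s \<in> l" "t \<in> scaled k ?V" "z = s \<oplus>\<^bsub>M\<^esub> t" unfolding set_add_def' by blast
    have t: "t \<in> ?V" "t \<in> scaled k (carrier M)"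
      using st(2) scaled_span_subset[OF F'(2), of k] scaled_mono[OF VM, of k] by blast+
    have "s \<in> ?V" using st(1) lV by blast
    then have "z \<in> ?V" unfolding st(3) using t(1) by (rule span_add[OF F'(2)])
    moreover have "z \<in> thick k l" unfolding thick_iff using st t(2) by blast
    ultimately show "z \<in> ?V \<inter> thick k l" by blast
  qed
  have s1l: "scaled 1 l \<subseteq> l" unfolding x(2) using scaled_span_subset x(4) by simp
  \<comment> \<open>As \<open>k\<close> is at least 1, the term from \<open>p^k V\<close> lies in
    \<open>p M\<close>; whether the sum does is decided by the term from \<open>l\<close>.\<close>
  have Y: "Y = (l <+>\<^bsub>M\<^esub> scaled k ?V) - (scaled 1 l <+>\<^bsub>M\<^esub> scaled k ?V)"
  proof -
    have "z \<in> scaled 1 (carrier M) \<longleftrightarrow> z \<in> scaled 1 l <+>\<^bsub>M\<^esub> scaled k ?V"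
      if z: "z \<in> l <+>\<^bsub>M\<^esub> scaled k ?V" for z
    proof
      assume z1: "z \<in> scaled 1 (carrier M)"
      obtain s t where st: "s \<in> l" "t \<in> scaled k ?V" "z = s \<oplus>\<^bsub>M\<^esub> t" using z unfolding set_add_def' by blast
      have t1: "t \<in> scaled 1 (carrier M)"
        using st(2) scaled_mono[OF VM, of k] scaled_M_antimono[OF k(1)] by blast
      have c: "s \<in> carrier M" "t \<in> carrier M" using st lc t1 scaled_M_closed by auto
      have "s = z \<oplus>\<^bsub>M\<^esub> \<ominus>\<^bsub>M\<^esub> t"
        unfolding st(3) M.a_comm[OF c] using add_minus_cancel(2)[OF c(2,1)] by (simp add: M.minus_eq)
      then have "s \<in> scaled 1 (carrier M)" using scaled_M_add[OF z1 scaled_M_neg[OF t1]] by simp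
      then have "s \<in> scaled 1 l" using span_Int_scaled[OF x(1) length_pos] st(1) x(2) by blast
      then show "z \<in> scaled 1 l <+>\<^bsub>M\<^esub> scaled k ?V" using st unfolding set_add_def' by blast
    next
      assume "z \<in> scaled 1 l <+>\<^bsub>M\<^esub> scaled k ?V"
      then obtain s t where st: "s \<in> scaled 1 l" "t \<in> scaled k ?V" "z = s \<oplus>\<^bsub>M\<^esub> t" unfolding set_add_def' by blast
      have "s \<in> scaled 1 (carrier M)" using st(1) scaled_mono[OF lc, of 1] by blast
      moreover have "t \<in> scaled 1 (carrier M)"
        using st(2) scaled_mono[OF VM, of k] scaled_M_antimono[OF k(1)] by blast
      ultimately show "z \<in> scaled 1 (carrier M)" unfolding st(3) by (rule scaled_M_add)
    qed
    moreover have "l <+>\<^bsub>M\<^esub> scaled k ?V \<subseteq> carrier M" using Vthick VM by blast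
    ultimately show ?thesis unfolding Y_def G_def Vthick indep_singleton_iff by blast
  qed
  have subm: "submodule R l M" "submodule R (scaled 1 l) M" "submodule R (scaled k ?V) M"
    using span_is_submodule[of "{x}"] x span_is_submodule[OF F'(2)] scaled_submodule by auto
  have fin: "finite l" "finite (scaled 1 l)" "finite (scaled k ?V)"
    using finite_subset[OF lc finite_M] span_finite[OF F'] by (auto simp: scaled_def)
  have skl: "scaled k l \<subseteq> scaled 1 l"
    unfolding x(2) using span_closed span_smult x(4) by (intro scaled_antimono[OF k(1)]) auto
  \<comment> \<open>Both \<open>l\<close> and \<open>p l\<close> meet \<open>p^k V\<close> in
    \<open>p^k l\<close>, so the orders of the two sums have the same denominator and can be
    subtracted.\<close>
  have int1: "l \<inter> scaled k ?V = scaled k l"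
    using span_Int_scaled[OF x(1) k(2)] scaled_mono[OF VM, of k] scaled_mono[OF lV, of k]
      skl s1l x(2) by blast
  have int2: "scaled 1 l \<inter> scaled k ?V = scaled k l" using int1 skl s1l by blast
  have cl: "card l = q ^ r" "card (scaled 1 l) = q ^ (r - 1)" "card (scaled k l) = q ^ (r - k)"
    "card (scaled k ?V) = q ^ ((r - k) * card F)"
    using card_span[OF x(1)] card_scaled_span[OF x(1)] card_scaled_span[OF F] k length_pos x(2) by auto
  have "card Y = card (l <+>\<^bsub>M\<^esub> scaled k ?V) - card (scaled 1 l <+>\<^bsub>M\<^esub> scaled k ?V)"
    unfolding Y
  proof (rule card_Diff_subset)
    show "scaled 1 l <+>\<^bsub>M\<^esub> scaled k ?V \<subseteq> l <+>\<^bsub>M\<^esub> scaled k ?V"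
      using s1l unfolding set_add_def' by blast
    show "finite (scaled 1 l <+>\<^bsub>M\<^esub> scaled k ?V)"
      using fin finite_subset[of _ "(\<lambda>(a, b). a \<oplus>\<^bsub>M\<^esub> b) ` (scaled 1 l \<times> scaled k ?V)"]
      unfolding set_add_def' by auto
  qed
  then have "card Y * q ^ (r - k) = (q ^ r - q ^ (r - 1)) * q ^ ((r - k) * card F)"
    using card_set_add[OF subm(1,3) fin(1,3)] card_set_add[OF subm(2,3) fin(2,3)]
    unfolding int1 int2 cl by (simp add: diff_mult_distrib)
  also have "(r - k) * card F = (r - k) * (card F - 1) + (r - k)"
    using cF by (cases "card F") auto
  finally have cY: "card Y = (q ^ r - q ^ (r - 1)) * q ^ ((r - k) * (card F - 1))"
    using residue_order_ge_2 by (simp add: power_add)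
  let ?C = "{l' \<in> free_subs 1 ?V. thick k l' = thick k l}"
  have im: "(\<lambda>y. span {y}) ` Y = ?C"
  proof (intro equalityI subsetI)
    fix l' assume "l' \<in> (\<lambda>y. span {y}) ` Y"
    then obtain y where y: "y \<in> ?V" "y \<in> thick k l" "indep {y}" "l' = span {y}"
      unfolding Y_def G_def by blast
    then show "l' \<in> ?C" using free_subs_1I[OF y(3,1) F] thick_span_eq_iff[OF x(1) y(3) k(1)] x(2) by auto
  next
    fix l' assume l': "l' \<in> ?C"
    then obtain y where y: "indep {y}" "l' = span {y}" "y \<in> ?V" using free_subs_1E by blast
    then have "y \<in> thick k l" using thick_span_eq_iff[OF x(1) y(1) k(1)] x(2) l' by simp
    then show "l' \<in> (\<lambda>y. span {y}) ` Y" using y unfolding Y_def G_def by blast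
  qed
  have fib: "{y \<in> Y. span {y} = l'} = G l'" if l': "l' \<in> ?C" for l'
  proof -
    obtain y0 where y0: "indep {y0}" "l' = span {y0}" "y0 \<in> ?V" "l' \<subseteq> ?V" using l' free_subs_1E by blast
    have sub: "l' \<subseteq> thick k l" using l' subset_thick[of l' k] y0(4) VM by auto
    have iff: "span {y} = l' \<longleftrightarrow> y \<in> l'" if "indep {y}" for y
      unfolding y0(2) by (rule span_singleton_eq_iff[OF y0(1) that])
    show ?thesis using iff sub y0(4) unfolding Y_def G_def by blast
  qed
  have "card Y = (q ^ r - q ^ (r - 1)) * card ?C"
  proof (rule card_eq_fibers(2)[OF _ im])
    show "finite ?C" using finite_free_subs[OF span_finite[OF F']] by simp
    fix l' assume l': "l' \<in> ?C"
    then obtain y0 where y0: "indep {y0}" "l' = span {y0}" using free_subs_1E by blast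
    show "card {y \<in> Y. span {y} = l'} = q ^ r - q ^ (r - 1)" using fib[OF l'] card_G[OF y0(1)] y0(2) by simp
    have "finite l'" using y0 span_finite[OF indepD(1,2)[OF y0(1)]] by simp
    then show "finite {y \<in> Y. span {y} = l'}" unfolding fib[OF l'] G_def by simp
  qed
  moreover have "q ^ r - q ^ (r - 1) > 0" using residue_order_ge_2 length_pos by simp
  ultimately show ?thesis using cY by simp
qed

end

section \<open>Transitivity and joint degrees\<close>

context free_chain_module begin

text \<open>An injection gives an inequality between two counts of submodules; exchanging the two
  configurations gives the reverse inequality. This replaces the construction of inverse
  maps.\<close>

definition linear_injection :: "('c \<Rightarrow> 'c) \<Rightarrow> bool" where
  "linear_injection g \<longleftrightarrow> g \<in> carrier M \<rightarrow> carrier M \<and> inj_on g (carrier M) \<and>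
     (\<forall>x\<in>carrier M. \<forall>y\<in>carrier M. g (x \<oplus>\<^bsub>M\<^esub> y) = g x \<oplus>\<^bsub>M\<^esub> g y) \<and>
     (\<forall>c\<in>carrier R. \<forall>x\<in>carrier M. g (c \<odot>\<^bsub>M\<^esub> x) = c \<odot>\<^bsub>M\<^esub> g x)"

lemma linear_injectionD:
  assumes "linear_injection g"
  shows "x \<in> carrier M \<Longrightarrow> g x \<in> carrier M"
    and "inj_on g (carrier M)"
    and "x \<in> carrier M \<Longrightarrow> y \<in> carrier M \<Longrightarrow> g (x \<oplus>\<^bsub>M\<^esub> y) = g x \<oplus>\<^bsub>M\<^esub> g y"
    and "c \<in> carrier R \<Longrightarrow> x \<in> carrier M \<Longrightarrow> g (c \<odot>\<^bsub>M\<^esub> x) = c \<odot>\<^bsub>M\<^esub> g x"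
  using assms unfolding linear_injection_def by auto

lemma linear_injection_zero: "linear_injection g \<Longrightarrow> g \<zero>\<^bsub>M\<^esub> = \<zero>\<^bsub>M\<^esub>"
  using linear_injectionD(4)[of g \<zero> "\<zero>\<^bsub>M\<^esub>"] linear_injectionD(1)[of g "\<zero>\<^bsub>M\<^esub>"] by simp

lemma lincomb_empty: "lincomb a {} = \<zero>\<^bsub>M\<^esub>"
  by (simp add: lincomb_def)

lemma linear_injection_lincomb:
  assumes g: "linear_injection g" and C: "finite C" "C \<subseteq> carrier M" "c \<in> g ` C \<rightarrow> carrier R"
  shows "lincomb c (g ` C) = g (lincomb (c \<circ> g) C)"
  using C
proof (induction C rule: finite_induct)
  case empty
  then show ?case by (simp add: lincomb_empty linear_injection_zero[OF g])
next
  case (insert v C)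
  note gD = linear_injectionD[OF g]
  have v: "v \<in> carrier M" "C \<subseteq> carrier M" "g v \<in> carrier M" "g ` C \<subseteq> carrier M"
    using insert(4) gD(1) by auto
  have gv: "g v \<notin> g ` C" using gD(2) v insert(2) by (auto simp: inj_on_def)
  have cg: "c \<circ> g \<in> insert v C \<rightarrow> carrier R" using insert(5) by auto
  have lc: "lincomb (c \<circ> g) C \<in> carrier M" using cg v by (intro lincomb_closed) auto
  have cv: "c (g v) \<in> carrier R" using insert(5) by auto
  have "lincomb c (g ` insert v C) = c (g v) \<odot>\<^bsub>M\<^esub> g v \<oplus>\<^bsub>M\<^esub> lincomb c (g ` C)"
    using lincomb_insert_eq[OF _ v(4) v(3) gv] insert by simp
  also have "lincomb c (g ` C) = g (lincomb (c \<circ> g) C)" by (rule insert.IH) (use insert.prems in auto)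
  also have "c (g v) \<odot>\<^bsub>M\<^esub> g v \<oplus>\<^bsub>M\<^esub> g (lincomb (c \<circ> g) C)
      = g (c (g v) \<odot>\<^bsub>M\<^esub> v \<oplus>\<^bsub>M\<^esub> lincomb (c \<circ> g) C)"
    using gD(3,4) v(1) lc cv by simp
  also have "c (g v) \<odot>\<^bsub>M\<^esub> v \<oplus>\<^bsub>M\<^esub> lincomb (c \<circ> g) C = lincomb (c \<circ> g) (insert v C)"
    using lincomb_insert_eq[OF insert(1) v(2) v(1) insert(2) cg] by simp
  finally show ?case .
qed

lemma linear_injection_free_subs:
  assumes g: "linear_injection g" and V: "V \<in> free_subs n (carrier M)"
  shows "g ` V \<in> free_subs n (carrier M)"
proof -
  note gD = linear_injectionD[OF g]
  obtain C where C: "indep C" "card C = n" "span C = V" using free_subsE[OF V] by metis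
  note C' = indepD(1,2)[OF C(1)]
  have gC: "finite (g ` C)" "g ` C \<subseteq> carrier M" using C' gD(1) by auto
  have inj: "inj_on g C" using gD(2) C'(2) inj_on_subset by blast
  have ind: "indep (g ` C)"
  proof (rule indepI[OF gC])
    fix a w assume a: "a \<in> g ` C \<rightarrow> carrier R" "lincomb a (g ` C) = \<zero>\<^bsub>M\<^esub>" and w: "w \<in> g ` C"
    have ag: "a \<circ> g \<in> C \<rightarrow> carrier R" using a(1) by auto
    have lc: "lincomb (a \<circ> g) C \<in> carrier M" using ag C' by (intro lincomb_closed) auto
    have "g (lincomb (a \<circ> g) C) = g \<zero>\<^bsub>M\<^esub>"
      using linear_injection_lincomb[OF g C' a(1)] a(2) linear_injection_zero[OF g] by simp
    then have "lincomb (a \<circ> g) C = \<zero>\<^bsub>M\<^esub>" using gD(2) lc by (simp add: inj_on_eq_iff)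
    then have "\<forall>v\<in>C. (a \<circ> g) v = \<zero>" using indep_coeff_zero[OF C(1) ag] by blast
    then show "a w = \<zero>" using w by auto
  qed
  have "span (g ` C) = g ` V"
  proof (intro equalityI subsetI)
    fix x assume "x \<in> span (g ` C)"
    then obtain a where a: "a \<in> g ` C \<rightarrow> carrier R" "x = lincomb a (g ` C)" using in_spanE[OF gC] by blast
    have "a \<circ> g \<in> C \<rightarrow> carrier R" using a(1) by auto
    then show "x \<in> g ` V"
      using linear_injection_lincomb[OF g C' a(1)] a(2) lincomb_in_span[OF C'] C(3) by auto
  next
    fix x assume "x \<in> g ` V"
    then obtain a where a: "a \<in> C \<rightarrow> carrier R" "x = g (lincomb a C)" using in_spanE[OF C'] C(3) by blast
    let ?c = "a \<circ> inv_into C g"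
    have c: "?c \<in> g ` C \<rightarrow> carrier R" using a(1) inj by (auto simp: inv_into_f_f)
    have "lincomb (?c \<circ> g) C = lincomb a C"
      using a(1) C' inj by (intro lincomb_cong) (auto simp: inv_into_f_f)
    then have "x = lincomb ?c (g ` C)" using linear_injection_lincomb[OF g C' c] a(2) by simp
    then show "x \<in> span (g ` C)" using lincomb_in_span[OF gC c] by simp
  qed
  moreover have "card (g ` C) = n" using card_image[OF inj] C(2) by simp
  moreover have "g ` V \<subseteq> carrier M" using V gD(1) by (auto simp: free_subs_def)
  ultimately show ?thesis using ind unfolding free_subs_def by blast
qed

lemma lincomb_delta:
  assumes "finite B" "B \<subseteq> carrier M" "b \<in> B"
  shows "lincomb (\<lambda>w. if w = b then \<one> else \<zero>) B = b"
proof -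
  let ?d = "\<lambda>w. if w = b then \<one> else \<zero>"
  have B: "B = insert b (B - {b})" using assms(3) by blast
  have bc: "b \<in> carrier M" using assms by auto
  have "lincomb ?d (B - {b}) = lincomb (\<lambda>w. \<zero> \<otimes> \<zero>) (B - {b})"
    using assms by (intro lincomb_cong) auto
  also have "\<dots> = \<zero> \<odot>\<^bsub>M\<^esub> lincomb (\<lambda>w. \<zero>) (B - {b})" using assms by (intro lincomb_smult) auto
  also have "\<dots> = \<zero>\<^bsub>M\<^esub>" using assms by (intro smult_l_null lincomb_closed) auto
  finally have 0: "lincomb ?d (B - {b}) = \<zero>\<^bsub>M\<^esub>" .
  have "lincomb ?d (insert b (B - {b})) = ?d b \<odot>\<^bsub>M\<^esub> b \<oplus>\<^bsub>M\<^esub> lincomb ?d (B - {b})"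
    using assms bc by (intro lincomb_insert_eq) auto
  then show ?thesis unfolding B[symmetric] 0 using bc by simp
qed

text \<open>Both sets extend to bases of equal size, and \<open>i\<close> extends to a bijection
  between these bases, along which coordinates are transported.\<close>

lemma exists_linear_injection:
  assumes A: "indep A" and A': "indep A'" and i: "bij_betw i A' A"
  obtains g where "linear_injection g" "\<And>a. a \<in> A' \<Longrightarrow> g (i a) = a"
proof -
  obtain B where B: "indep B" "A \<subseteq> B" "card B = card E" "span B = carrier M"
    using extend_to_basis[OF basis(1) A] indepD(2)[OF A] basis(2) by metis
  obtain B' where B': "indep B'" "A' \<subseteq> B'" "card B' = card E"
    using extend_to_basis[OF basis(1) A'] indepD(2)[OF A'] basis(2) by metis
  note b = indepD(1,2)[OF B(1)] and b' = indepD(1,2)[OF B'(1)]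
  have "card (B' - A') = card (B - A)"
    using B B' bij_betw_same_card[OF i] b(1) b'(1) by (simp add: card_Diff_subset finite_subset)
  then obtain j where j: "bij_betw j (B' - A') (B - A)"
    using finite_same_card_bij[of "B' - A'" "B - A"] b(1) b'(1) by auto
  \<comment> \<open>\<open>h\<close> runs from the target basis \<open>B'\<close> back to
    \<open>B\<close>, so that the coefficient of \<open>w\<close> in \<open>g m\<close> is the
    coordinate of \<open>m\<close> at \<open>h w\<close>; this is why \<open>i\<close> is given from
    \<open>A'\<close> to \<open>A\<close>.\<close>
  define h where "h w = (if w \<in> A' then i w else j w)" for w
  have "bij_betw h (A' \<union> (B' - A')) (A \<union> (B - A))"
  proof (rule bij_betw_combine)
    show "bij_betw h A' A" using i by (rule bij_betw_cong[THEN iffD1, rotated]) (simp add: h_def)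
    show "bij_betw h (B' - A') (B - A)" using j by (rule bij_betw_cong[THEN iffD1, rotated]) (simp add: h_def)
  qed auto
  then have h: "bij_betw h B' B" using B(2) B'(2) by (simp add: Un_absorb1)
  have hB: "h w \<in> B" if "w \<in> B'" for w using h that by (auto simp: bij_betw_def)
  have "\<forall>m\<in>carrier M. \<exists>a. a \<in> B \<rightarrow> carrier R \<and> m = lincomb a B"
    using in_spanE[OF b] B(4) by metis
  then obtain a where a: "\<And>m. m \<in> carrier M \<Longrightarrow> a m \<in> B \<rightarrow> carrier R \<and> m = lincomb (a m) B" by metis
  have ac: "a m v \<in> carrier R" if "m \<in> carrier M" "v \<in> B" for m v using a[OF that(1)] that(2) by auto
  \<comment> \<open>Uniqueness of coordinates with respect to \<open>B\<close> is what makes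
    \<open>g\<close> linear.\<close>
  have uniq: "a m v = c v" if "m \<in> carrier M" "c \<in> B \<rightarrow> carrier R" "m = lincomb c B" "v \<in> B" for m c v
    using lincomb_inj[OF B(1) _ that(2) _ that(4), of "a m"] a[OF that(1)] that(3) by auto
  define g where "g m = lincomb (\<lambda>w. a m (h w)) B'" for m
  have ah: "(\<lambda>w. a m (h w)) \<in> B' \<rightarrow> carrier R" if "m \<in> carrier M" for m using ac[OF that] hB by auto
  have "linear_injection g"
    unfolding linear_injection_def
  proof (intro conjI ballI)
    show "g \<in> carrier M \<rightarrow> carrier M" unfolding g_def using ah b' by (auto intro!: lincomb_closed)
    show "inj_on g (carrier M)"
    proof (rule inj_onI)
      fix x y assume xy: "x \<in> carrier M" "y \<in> carrier M" "g x = g y"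
      have "a x v = a y v" if v: "v \<in> B" for v
      proof -
        obtain w where w: "w \<in> B'" "v = h w" using h v unfolding bij_betw_def by blast
        then show ?thesis
          using lincomb_inj[OF B'(1) ah[OF xy(1)] ah[OF xy(2)] _ w(1)] xy(3) unfolding g_def by simp
      qed
      then have "lincomb (a x) B = lincomb (a y) B" using a[OF xy(2)] b by (intro lincomb_cong) auto
      then show "x = y" using a[OF xy(1)] a[OF xy(2)] by metis
    qed
    fix x y assume xy: "x \<in> carrier M" "y \<in> carrier M"
    have e: "x \<oplus>\<^bsub>M\<^esub> y = lincomb (\<lambda>v. a x v \<oplus> a y v) B"
      using lincomb_sum[OF b, of "a x" "a y"] a[OF xy(1)] a[OF xy(2)] by metis
    have "a (x \<oplus>\<^bsub>M\<^esub> y) v = a x v \<oplus> a y v" if "v \<in> B" for v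
      by (rule uniq[OF M.a_closed[OF xy] _ e that]) (use xy ac in auto)
    then have "g (x \<oplus>\<^bsub>M\<^esub> y) = lincomb (\<lambda>w. a x (h w) \<oplus> a y (h w)) B'"
      unfolding g_def using xy hB ac b' by (intro lincomb_cong) auto
    also have "\<dots> = g x \<oplus>\<^bsub>M\<^esub> g y" unfolding g_def using ah xy by (intro lincomb_sum b') auto
    finally show "g (x \<oplus>\<^bsub>M\<^esub> y) = g x \<oplus>\<^bsub>M\<^esub> g y" .
  next
    fix c x assume c: "c \<in> carrier R" and x: "x \<in> carrier M"
    have e: "c \<odot>\<^bsub>M\<^esub> x = lincomb (\<lambda>v. c \<otimes> a x v) B"
      using lincomb_smult[OF b(2) _ c, of "a x"] a[OF x] by metis
    have "a (c \<odot>\<^bsub>M\<^esub> x) v = c \<otimes> a x v" if "v \<in> B" for v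
      by (rule uniq[OF smult_closed[OF c x] _ e that]) (use x c ac in auto)
    then have "g (c \<odot>\<^bsub>M\<^esub> x) = lincomb (\<lambda>w. c \<otimes> a x (h w)) B'"
      unfolding g_def using x c hB ac b' by (intro lincomb_cong) auto
    also have "\<dots> = c \<odot>\<^bsub>M\<^esub> g x" unfolding g_def using ah x c by (intro lincomb_smult b') auto
    finally show "g (c \<odot>\<^bsub>M\<^esub> x) = c \<odot>\<^bsub>M\<^esub> g x" .
  qed
  moreover have "g (i v) = v" if v: "v \<in> A'" for v
  proof -
    have vB: "v \<in> B'" and hv: "h v = i v" and iv: "i v \<in> B"
      using v B'(2) hB[of v] by (auto simp: h_def)
    have ic: "i v \<in> carrier M" using iv b(2) by auto
    have inj: "h w = i v \<longleftrightarrow> w = v" if "w \<in> B'" for w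
      using h that vB hv unfolding bij_betw_def inj_on_def by metis
    have "a (i v) w = (if w = i v then \<one> else \<zero>)" if "w \<in> B" for w
      using that ic lincomb_delta[OF b iv] by (intro uniq) auto
    then have "g (i v) = lincomb (\<lambda>w. if w = v then \<one> else \<zero>) B'"
      unfolding g_def using inj hB b' by (intro lincomb_cong) auto
    then show ?thesis using lincomb_delta[OF b' vB] by simp
  qed
  ultimately show ?thesis using that by blast
qed

lemma card_containing_le:
  assumes g: "linear_injection g" and T: "T \<subseteq> carrier M"
  shows "card {V \<in> free_subs n (carrier M). T \<subseteq> V} \<le> card {V \<in> free_subs n (carrier M). g ` T \<subseteq> V}"
proof (rule card_inj_on_le[where f = "\<lambda>V. g ` V"])
  show "inj_on (\<lambda>V. g ` V) {V \<in> free_subs n (carrier M). T \<subseteq> V}"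
    using inj_on_image_Pow[OF linear_injectionD(2)[OF g]]
    by (rule inj_on_subset) (auto simp: free_subs_def)
  show "(\<lambda>V. g ` V) ` {V \<in> free_subs n (carrier M). T \<subseteq> V} \<subseteq> {V \<in> free_subs n (carrier M). g ` T \<subseteq> V}"
    using linear_injection_free_subs[OF g] by auto
  show "finite {V \<in> free_subs n (carrier M). g ` T \<subseteq> V}" using finite_free_subs[OF finite_M] by simp
qed

text \<open>A linear injection with \<open>x\<close> to \<open>x'\<close> and \<open>w\<close> to
  \<open>w'\<close> also sends \<open>p^j w\<close> to \<open>p^j w'\<close>; so the number depends
  on \<open>j\<close> alone.\<close>

lemma card_containing_pair_eq:
  assumes xw: "indep {x, w}" "x \<noteq> w" and xw': "indep {x', w'}" "x' \<noteq> w'"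
  shows "card {V \<in> free_subs n (carrier M). {x, p [^] (j::nat) \<odot>\<^bsub>M\<^esub> w} \<subseteq> V}
       = card {V \<in> free_subs n (carrier M). {x', p [^] j \<odot>\<^bsub>M\<^esub> w'} \<subseteq> V}"
proof -
  have le: "card {V \<in> free_subs n (carrier M). {x, p [^] j \<odot>\<^bsub>M\<^esub> w} \<subseteq> V}
       \<le> card {V \<in> free_subs n (carrier M). {x', p [^] j \<odot>\<^bsub>M\<^esub> w'} \<subseteq> V}"
    if xw: "indep {x, w}" "x \<noteq> w" and xw': "indep {x', w'}" "x' \<noteq> w'" for x w x' w'
  proof -
    have c: "x \<in> carrier M" "w \<in> carrier M" using indepD(2)[OF xw(1)] by auto
    define i where "i v = (if v = x' then x else w)" for v
    have "bij_betw i {x', w'} {x, w}"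
      using xw(2) xw'(2) by (auto simp: bij_betw_def inj_on_def i_def)
    then obtain g where g: "linear_injection g" "\<And>a. a \<in> {x', w'} \<Longrightarrow> g (i a) = a"
      using exists_linear_injection[OF xw(1) xw'(1)] by blast
    have "g x = x'" "g w = w'" using g(2)[of x'] g(2)[of w'] xw'(2) by (auto simp: i_def)
    then have "g ` {x, p [^] j \<odot>\<^bsub>M\<^esub> w} = {x', p [^] j \<odot>\<^bsub>M\<^esub> w'}"
      using linear_injectionD(4)[OF g(1), of "p [^] j" w] c by simp
    then show ?thesis using card_containing_le[OF g(1), of "{x, p [^] j \<odot>\<^bsub>M\<^esub> w}" n] c by simp
  qed
  show ?thesis using le[OF xw xw'] le[OF xw' xw] by (rule order_antisym)
qed

lemma span_singleton_subset_iff: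
  assumes "x \<in> carrier M" "V \<in> free_subs n (carrier M)"
  shows "span {x} \<subseteq> V \<longleftrightarrow> x \<in> V"
proof -
  obtain B where B: "indep B" "span B = V" using free_subsE[OF assms(2)] by metis
  show ?thesis
    using span_subset_spanI[OF indepD(2)[OF B(1)], of "{x}"] in_own_span[of "{x}"] assms(1) B(2) by auto
qed

lemma degree_const:
  assumes l: "l \<in> free_subs 1 (carrier M)" and l': "l' \<in> free_subs 1 (carrier M)"
  shows "card {V \<in> free_subs n (carrier M). l \<subseteq> V} = card {V \<in> free_subs n (carrier M). l' \<subseteq> V}"
proof -
  have le: "card {V \<in> free_subs n (carrier M). l \<subseteq> V} \<le> card {V \<in> free_subs n (carrier M). l' \<subseteq> V}"
    if l: "l \<in> free_subs 1 (carrier M)" and l': "l' \<in> free_subs 1 (carrier M)" for l l'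
  proof -
    obtain x where x: "indep {x}" "l = span {x}" "x \<in> carrier M" using free_subs_1E[OF l] by metis
    obtain y where y: "indep {y}" "l' = span {y}" "y \<in> carrier M" using free_subs_1E[OF l'] by metis
    have "bij_betw (\<lambda>_. x) {y} {x}" by (auto simp: bij_betw_def)
    then obtain g where g: "linear_injection g" "\<And>a. a \<in> {y} \<Longrightarrow> g x = a"
      using exists_linear_injection[OF x(1) y(1)] by blast
    have "g ` {x} = {y}" using g(2)[of y] by simp
    then have "card {V \<in> free_subs n (carrier M). {x} \<subseteq> V} \<le> card {V \<in> free_subs n (carrier M). {y} \<subseteq> V}"
      using card_containing_le[OF g(1), of "{x}" n] x(3) by simp
    moreover have "{V \<in> free_subs n (carrier M). {x} \<subseteq> V} = {V \<in> free_subs n (carrier M). l \<subseteq> V}"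
      using span_singleton_subset_iff[OF x(3)] x(2) by auto
    moreover have "{V \<in> free_subs n (carrier M). {y} \<subseteq> V} = {V \<in> free_subs n (carrier M). l' \<subseteq> V}"
      using span_singleton_subset_iff[OF y(3)] y(2) by auto
    ultimately show ?thesis by simp
  qed
  show ?thesis using le[OF l l'] le[OF l' l] by (rule order_antisym)
qed

text \<open>
  If \<open>l = span {x}\<close> and \<open>l' = span {y}\<close> agree modulo \<open>p^k\<close> but not modulo \<open>p^(k+1)\<close>, then
  \<open>y = u x + p^k w\<close> with \<open>x, w\<close> independent.
\<close>

lemma line_pair_normal_form:
  assumes l: "l \<in> free_subs 1 (carrier M)" and l': "l' \<in> free_subs 1 (carrier M)"
    and k: "thick k l = thick k l'" "thick (Suc k) l \<noteq> thick (Suc k) l'"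
  obtains x w where "indep {x, w}" "x \<noteq> w"
    "{V \<in> free_subs n (carrier M). l \<subseteq> V \<and> l' \<subseteq> V}
       = {V \<in> free_subs n (carrier M). {x, p [^] k \<odot>\<^bsub>M\<^esub> w} \<subseteq> V}"
proof -
  obtain x where x: "indep {x}" "l = span {x}" "x \<in> carrier M" using free_subs_1E[OF l] by metis
  obtain y where y: "indep {y}" "l' = span {y}" "y \<in> carrier M" using free_subs_1E[OF l'] by metis
  have "y \<in> thick k l" using subset_thick[OF span_closed, of "{y}" k] in_own_span[of "{y}"] y k(1) by auto
  then obtain u w where u: "u \<in> carrier R" "w \<in> carrier M" "y = u \<odot>\<^bsub>M\<^esub> x \<oplus>\<^bsub>M\<^esub> p [^] k \<odot>\<^bsub>M\<^esub> w"
    unfolding thick_iff scaled_def x(2) span_singleton[OF x(3)] by blast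
  \<comment> \<open>If \<open>w\<close> were in \<open>span {x} + p M\<close>, then \<open>y\<close>
    would be in \<open>span {x} + p^(k+1) M\<close>, and the lines would agree one level
    deeper.\<close>
  have "w \<notin> span {x} <+>\<^bsub>M\<^esub> scaled 1 (carrier M)"
  proof
    assume "w \<in> span {x} <+>\<^bsub>M\<^esub> scaled 1 (carrier M)"
    then obtain s m where sm: "s \<in> span {x}" "m \<in> carrier M" "w = s \<oplus>\<^bsub>M\<^esub> p [^] (1::nat) \<odot>\<^bsub>M\<^esub> m"
      unfolding set_add_def' scaled_def by blast
    obtain c where c: "c \<in> carrier R" "s = c \<odot>\<^bsub>M\<^esub> x" using sm(1) unfolding span_singleton[OF x(3)] by blast
    have "y = (u \<oplus> p [^] k \<otimes> c) \<odot>\<^bsub>M\<^esub> x \<oplus>\<^bsub>M\<^esub> p [^] Suc k \<odot>\<^bsub>M\<^esub> m"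
      unfolding u(3) sm(3) c(2) using u(1) c(1) sm(2) x(3)
      by (simp add: smult_r_distr smult_l_distr smult_assoc1 M.a_assoc)
    then have "y \<in> thick (Suc k) (span {x})"
      unfolding thick_iff scaled_def span_singleton[OF x(3)] using u(1) c(1) sm(2)
      by (blast intro: m_closed a_closed nat_pow_closed uniformizer_closed)
    then show False using thick_span_eq_iff[OF x(1) y(1), of "Suc k"] k(2) x(2) y(2) by simp
  qed
  then have w: "w \<notin> {x}" "indep {w, x}" using indep_insert_iff[OF basis x(1) u(2)] by auto
  have "l \<subseteq> V \<and> l' \<subseteq> V \<longleftrightarrow> {x, p [^] k \<odot>\<^bsub>M\<^esub> w} \<subseteq> V" if V: "V \<in> free_subs n (carrier M)" for V
  proof -
    obtain B where B: "indep B" "span B = V" using free_subsE[OF V] by metis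
    note Bc = indepD(2)[OF B(1)]
    have ux: "u \<odot>\<^bsub>M\<^esub> x \<in> V" if "x \<in> V" using span_smult[OF Bc u(1)] that B(2) by simp
    have pw: "p [^] k \<odot>\<^bsub>M\<^esub> w = y \<oplus>\<^bsub>M\<^esub> \<ominus>\<^bsub>M\<^esub> (u \<odot>\<^bsub>M\<^esub> x)"
      using add_minus_cancel(2)[of "u \<odot>\<^bsub>M\<^esub> x" "p [^] k \<odot>\<^bsub>M\<^esub> w"] u x(3) by (simp add: M.minus_eq)
    have "y \<in> V \<longleftrightarrow> p [^] k \<odot>\<^bsub>M\<^esub> w \<in> V" if xV: "x \<in> V"
    proof
      assume "y \<in> V"
      then show "p [^] k \<odot>\<^bsub>M\<^esub> w \<in> V"
        unfolding pw using span_add[OF Bc] span_neg[OF Bc] ux[OF xV] B(2) by blast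
    next
      assume "p [^] k \<odot>\<^bsub>M\<^esub> w \<in> V"
      then show "y \<in> V" unfolding u(3) using span_add[OF Bc] ux[OF xV] B(2) by blast
    qed
    then show ?thesis
      unfolding x(2) y(2) span_singleton_subset_iff[OF x(3) V] span_singleton_subset_iff[OF y(3) V] by blast
  qed
  then have "{V \<in> free_subs n (carrier M). l \<subseteq> V \<and> l' \<subseteq> V}
       = {V \<in> free_subs n (carrier M). {x, p [^] k \<odot>\<^bsub>M\<^esub> w} \<subseteq> V}" by blast
  moreover have "indep {x, w}" using w(2) by (simp add: insert_commute)
  ultimately show ?thesis using that w(1) by blast
qed

lemma joint_degree_const:
  assumes "l1 \<in> free_subs 1 (carrier M)" "l2 \<in> free_subs 1 (carrier M)"
    and "thick k l1 = thick k l2" "thick (Suc k) l1 \<noteq> thick (Suc k) l2"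
    and "l1' \<in> free_subs 1 (carrier M)" "l2' \<in> free_subs 1 (carrier M)"
    and "thick k l1' = thick k l2'" "thick (Suc k) l1' \<noteq> thick (Suc k) l2'"
  shows "card {V \<in> free_subs n (carrier M). l1 \<subseteq> V \<and> l2 \<subseteq> V}
       = card {V \<in> free_subs n (carrier M). l1' \<subseteq> V \<and> l2' \<subseteq> V}"
proof -
  obtain x w where xw: "indep {x, w}" "x \<noteq> w"
    "{V \<in> free_subs n (carrier M). l1 \<subseteq> V \<and> l2 \<subseteq> V}
       = {V \<in> free_subs n (carrier M). {x, p [^] k \<odot>\<^bsub>M\<^esub> w} \<subseteq> V}"
    using line_pair_normal_form[OF assms(1-4)] .
  obtain x' w' where xw': "indep {x', w'}" "x' \<noteq> w'"
    "{V \<in> free_subs n (carrier M). l1' \<subseteq> V \<and> l2' \<subseteq> V}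
       = {V \<in> free_subs n (carrier M). {x', p [^] k \<odot>\<^bsub>M\<^esub> w'} \<subseteq> V}"
    using line_pair_normal_form[OF assms(5-8)] .
  show ?thesis unfolding xw(3) xw'(3) by (rule card_containing_pair_eq[OF xw(1,2) xw'(1,2)])
qed

lemma sum_card_swap:
  assumes "finite A" "finite B"
  shows "(\<Sum>a\<in>A. card {b \<in> B. P a b}) = (\<Sum>b\<in>B. card {a \<in> A. P a b})"
proof -
  have "(\<Sum>a\<in>A. card {b \<in> B. P a b}) = (\<Sum>a\<in>A. \<Sum>b\<in>B. if P a b then 1 else 0)"
    using assms by (simp add: sum.If_cases Int_def)
  also have "\<dots> = (\<Sum>b\<in>B. \<Sum>a\<in>A. if P a b then 1 else 0)" by (rule sum.swap)
  also have "\<dots> = (\<Sum>b\<in>B. card {a \<in> A. P a b})" using assms by (simp add: sum.If_cases Int_def)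
  finally show ?thesis .
qed

lemma card_lines: "indep F \<Longrightarrow> 1 \<le> card F \<Longrightarrow>
  card (free_subs 1 (span F)) = q_int q (card F) * q ^ ((r - 1) * (card F - 1))"
  using card_free_subs[of F 1] q_binomial_1[OF residue_order_ge_2, of "card F"] by simp

text \<open>Incident pairs of lines and submodules of rank \<open>n\<close>, counted in both ways;
  transitivity makes the sum over the lines a product.\<close>

lemma degree_sum:
  assumes l: "l \<in> free_subs 1 (carrier M)" and n: "1 \<le> n"
  shows "card (free_subs 1 (carrier M)) * card {V \<in> free_subs n (carrier M). l \<subseteq> V}
       = card (free_subs n (carrier M)) * (q_int q n * q ^ ((r - 1) * (n - 1)))"
proof -
  let ?X = "free_subs n (carrier M)" and ?L = "free_subs 1 (carrier M)"
  have "card ?L * card {V \<in> ?X. l \<subseteq> V} = (\<Sum>l'\<in>?L. card {V \<in> ?X. l' \<subseteq> V})"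
    using degree_const[OF _ l] by simp
  also have "\<dots> = (\<Sum>V\<in>?X. card {l' \<in> ?L. l' \<subseteq> V})"
    using sum_card_swap[OF finite_free_subs[OF finite_M] finite_free_subs[OF finite_M]] .
  also have "\<dots> = (\<Sum>V\<in>?X. q_int q n * q ^ ((r - 1) * (n - 1)))"
  proof (rule sum.cong)
    fix V assume V: "V \<in> ?X"
    then obtain B where B: "indep B" "card B = n" "span B = V" "V \<subseteq> carrier M" using free_subsE by metis
    have "{l' \<in> ?L. l' \<subseteq> V} = free_subs 1 (span B)" using B by (auto simp: free_subs_def)
    then show "card {l' \<in> ?L. l' \<subseteq> V} = q_int q n * q ^ ((r - 1) * (n - 1))"
      using card_lines[OF B(1)] B(2) n by simp
  qed simp
  finally show ?thesis by simp
qed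

text \<open>The pairs \<open>(l', V)\<close> are counted by \<open>V\<close>: inside each
  \<open>V\<close> containing \<open>l\<close> the lines congruent to \<open>l\<close> are known
  from \<open>card_line_class\<close>, and at level 0 they are all lines of \<open>V\<close>.
  Differences of consecutive levels will isolate the individual joint degrees.\<close>

lemma joint_degree_sum:
  assumes l: "l \<in> free_subs 1 (carrier M)" and k: "k \<le> r" and n: "1 \<le> n"
  shows "(\<Sum>l'\<in>{l' \<in> free_subs 1 (carrier M). thick k l' = thick k l}.
            card {V \<in> free_subs n (carrier M). l \<subseteq> V \<and> l' \<subseteq> V})
       = card {V \<in> free_subs n (carrier M). l \<subseteq> V} *
         (if k = 0 then q_int q n * q ^ ((r - 1) * (n - 1)) else q ^ ((r - k) * (n - 1)))"
    (is "_ = _ * ?c")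
proof -
  let ?X = "{V \<in> free_subs n (carrier M). l \<subseteq> V}"
    and ?L = "{l' \<in> free_subs 1 (carrier M). thick k l' = thick k l}"
  have fin: "finite ?X" "finite ?L" using finite_free_subs[OF finite_M] by auto
  have "(\<Sum>l'\<in>?L. card {V \<in> free_subs n (carrier M). l \<subseteq> V \<and> l' \<subseteq> V})
      = (\<Sum>l'\<in>?L. card {V \<in> ?X. l' \<subseteq> V})"
    by (intro sum.cong refl arg_cong[where f = card]) blast
  also have "\<dots> = (\<Sum>V\<in>?X. card {l' \<in> ?L. l' \<subseteq> V})" using sum_card_swap[OF fin(2,1)] .
  also have "\<dots> = (\<Sum>V\<in>?X. ?c)"
  proof (rule sum.cong)
    fix V assume V: "V \<in> ?X"
    then have "V \<in> free_subs n (carrier M)" by simp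
    then obtain B where B: "indep B" "card B = n" "span B = V" "V \<subseteq> carrier M" using free_subsE by metis
    have lV: "l \<in> free_subs 1 (span B)" using l V B(3) by (auto simp: free_subs_def)
    have eq: "{l' \<in> ?L. l' \<subseteq> V} = {l' \<in> free_subs 1 (span B). thick k l' = thick k l}"
      using B by (auto simp: free_subs_def)
    show "card {l' \<in> ?L. l' \<subseteq> V} = ?c"
    proof (cases "k = 0")
      case True
      have "thick 0 l' = carrier M" if l': "l' \<in> free_subs 1 (carrier M)" for l'
      proof -
        obtain x where x: "l' = span {x}" "x \<in> carrier M" using free_subs_1E[OF l'] by metis
        then show ?thesis using thick_0[OF span_closed, of "{x}"] span_zero[of "{x}"] by simp
      qed
      then have "{l' \<in> free_subs 1 (span B). thick k l' = thick k l} = free_subs 1 (span B)"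
        using True l B(3,4) by (auto simp: free_subs_def)
      then show ?thesis unfolding eq using True card_lines[OF B(1)] B(2) n by simp
    next
      case False
      then show ?thesis unfolding eq using card_line_class[OF B(1) lV, of k] k B(2) by simp
    qed
  qed simp
  finally show ?thesis by simp
qed

end

section \<open>Characteristic polynomials\<close>

text \<open>Matrices indexed by vertices instead of positions: products become sums over sets, and
  identities are checked on pairs of vertices.\<close>

definition pair_mat :: "'u list \<Rightarrow> 'v list \<Rightarrow> ('u \<Rightarrow> 'v \<Rightarrow> 'a) \<Rightarrow> 'a mat" where
  "pair_mat us vs f = mat (length us) (length vs) (\<lambda>(i, j). f (us ! i) (vs ! j))"

abbreviation kernel_mat :: "'v list \<Rightarrow> ('v \<Rightarrow> 'v \<Rightarrow> 'a) \<Rightarrow> 'a mat" where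
  "kernel_mat vs \<equiv> pair_mat vs vs"

lemma pair_mat_carrier [simp]: "pair_mat us vs f \<in> carrier_mat (length us) (length vs)"
  and dim_pair_mat [simp]: "dim_row (pair_mat us vs f) = length us" "dim_col (pair_mat us vs f) = length vs"
  and index_pair_mat [simp]:
    "i < length us \<Longrightarrow> j < length vs \<Longrightarrow> pair_mat us vs f $$ (i, j) = f (us ! i) (vs ! j)"
  by (simp_all add: pair_mat_def)

lemma pair_mat_cong:
  "(\<And>u v. u \<in> set us \<Longrightarrow> v \<in> set vs \<Longrightarrow> f u v = g u v) \<Longrightarrow> pair_mat us vs f = pair_mat us vs g"
  by (intro eq_matI) auto

lemma pair_mat_mult:
  fixes f :: "'u \<Rightarrow> 'v \<Rightarrow> 'a :: semiring_0"
  assumes "distinct vs"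
  shows "pair_mat us vs f * pair_mat vs ws g = pair_mat us ws (\<lambda>u w. \<Sum>v\<in>set vs. f u v * g v w)"
proof (rule eq_matI)
  fix i j assume "i < dim_row (pair_mat us ws (\<lambda>u w. \<Sum>v\<in>set vs. f u v * g v w))"
    "j < dim_col (pair_mat us ws (\<lambda>u w. \<Sum>v\<in>set vs. f u v * g v w))"
  then have ij: "i < length us" "j < length ws" by auto
  have "(pair_mat us vs f * pair_mat vs ws g) $$ (i, j)
      = (\<Sum>k<length vs. f (us ! i) (vs ! k) * g (vs ! k) (ws ! j))"
    using ij by (auto simp: scalar_prod_def atLeast0LessThan intro!: sum.cong)
  also have "\<dots> = (\<Sum>v\<in>set vs. f (us ! i) v * g v (ws ! j))"
    using sum.reindex_bij_betw[OF bij_betw_nth[OF assms refl refl], of "\<lambda>v. f (us ! i) v * g v (ws ! j)"] .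
  finally show "(pair_mat us vs f * pair_mat vs ws g) $$ (i, j)
      = pair_mat us ws (\<lambda>u w. \<Sum>v\<in>set vs. f u v * g v w) $$ (i, j)" using ij by simp
qed auto

lemma sum_delta_mult:
  fixes h :: "'v \<Rightarrow> 'a :: semiring_1"
  assumes "finite A" "u \<in> A"
  shows "(\<Sum>v\<in>A. (if u = v then 1 else 0) * h v) = h u" "(\<Sum>v\<in>A. h v * (if v = u then 1 else 0)) = h u"
proof -
  have "(\<Sum>v\<in>A. (if u = v then 1 else 0) * h v) = (\<Sum>v\<in>A. if v = u then h u else 0)"
    "(\<Sum>v\<in>A. h v * (if v = u then 1 else 0)) = (\<Sum>v\<in>A. if v = u then h u else 0)"
    by (auto intro!: sum.cong)
  then show "(\<Sum>v\<in>A. (if u = v then 1 else 0) * h v) = h u" "(\<Sum>v\<in>A. h v * (if v = u then 1 else 0)) = h u"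
    using assms by simp_all
qed

lemma pair_mat_delta: "distinct vs \<Longrightarrow> kernel_mat vs (\<lambda>u v. if u = v then 1 else 0) = 1\<^sub>m (length vs)"
  by (intro eq_matI) (auto simp: nth_eq_iff_index_eq)

text \<open>\<open>adjacency_spectrum\<close> chooses an enumeration by \<open>SOME\<close>, while
  the block form requires the lines to come first. The permutation matrices \<open>?P\<close> and
  \<open>?Q\<close> give the similarity.\<close>

lemma char_poly_kernel_mat_reorder:
  fixes f :: "'v \<Rightarrow> 'v \<Rightarrow> 'a :: comm_ring_1"
  assumes vs: "distinct vs" and ws: "distinct ws" and eq: "set vs = set ws"
  shows "char_poly (kernel_mat vs f) = char_poly (kernel_mat ws f)"
proof -
  have len: "length ws = length vs" using vs ws eq by (metis distinct_card)
  let ?d = "\<lambda>u v. if u = v then 1 else 0 :: 'a"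
  let ?P = "pair_mat vs ws ?d" and ?Q = "pair_mat ws vs ?d"
  have PQ: "?P * ?Q = 1\<^sub>m (length vs)"
    unfolding pair_mat_mult[OF ws] pair_mat_delta[OF vs, symmetric]
    using eq by (intro pair_mat_cong) (simp add: sum_delta_mult)
  have QP: "?Q * ?P = 1\<^sub>m (length vs)"
    unfolding pair_mat_mult[OF vs] pair_mat_delta[OF ws, symmetric] len[symmetric]
    using eq by (intro pair_mat_cong) (simp add: sum_delta_mult)
  have "?P * kernel_mat ws f = pair_mat vs ws f"
    unfolding pair_mat_mult[OF ws] using eq by (intro pair_mat_cong) (simp add: sum_delta_mult)
  moreover have "pair_mat vs ws f * ?Q = kernel_mat vs f"
    unfolding pair_mat_mult[OF ws] using eq by (intro pair_mat_cong) (simp add: sum_delta_mult)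
  ultimately have PBQ: "kernel_mat vs f = ?P * kernel_mat ws f * ?Q" by simp
  have "similar_mat_wit (kernel_mat vs f) (kernel_mat ws f) ?P ?Q"
    using pair_mat_carrier[of ws ws f] pair_mat_carrier[of vs ws ?d] pair_mat_carrier[of ws vs ?d]
    unfolding len by (intro similar_mat_witI[OF PQ QP PBQ pair_mat_carrier])
  then show ?thesis by (intro char_poly_similar) (auto simp: similar_mat_def)
qed

lemma poly_char_poly:
  fixes A :: "'a :: field mat"
  assumes A: "A \<in> carrier_mat n n"
  shows "poly (char_poly A) x = det (x \<cdot>\<^sub>m 1\<^sub>m n - A)"
proof -
  have "- char_matrix A x = x \<cdot>\<^sub>m 1\<^sub>m n - A"
    using A by (intro eq_matI) (auto simp: char_matrix_def)
  then show ?thesis using char_poly_matrix[OF A, of x] by simp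
qed

lemma mult_smult_one_right [simp]:
  fixes A :: "'a :: comm_ring_1 mat"
  shows "A \<in> carrier_mat n m \<Longrightarrow> A * (x \<cdot>\<^sub>m 1\<^sub>m m) = x \<cdot>\<^sub>m A"
  by (subst mult_smult_distrib[of _ n m _ m]) auto

lemma mult_smult_one_left [simp]:
  fixes A :: "'a :: comm_ring_1 mat"
  shows "A \<in> carrier_mat n m \<Longrightarrow> (x \<cdot>\<^sub>m 1\<^sub>m n) * A = x \<cdot>\<^sub>m A"
  by (subst mult_smult_assoc_mat[of _ n n _ m]) auto

lemma det_smult_one: "det (x \<cdot>\<^sub>m 1\<^sub>m n) = (x :: 'a :: comm_ring_1) ^ n"
  by (simp add: det_smult)

text \<open>The product with \<open>?D\<close> is block upper triangular with diagonal blocks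
  \<open>x^2 - B C\<close> and \<open>x\<close>. Keeping the powers of \<open>x\<close> on both
  sides makes the identity valid at \<open>x = 0\<close> too.\<close>

lemma det_bipartite:
  fixes x :: "'a :: field"
  assumes B: "B \<in> carrier_mat l m" and C: "C \<in> carrier_mat m l"
  shows "det (four_block_mat (x \<cdot>\<^sub>m 1\<^sub>m l) (- B) (- C) (x \<cdot>\<^sub>m 1\<^sub>m m)) * x ^ l
       = det (x\<^sup>2 \<cdot>\<^sub>m 1\<^sub>m l - B * C) * x ^ m"
proof -
  let ?A = "four_block_mat (x \<cdot>\<^sub>m 1\<^sub>m l) (- B) (- C) (x \<cdot>\<^sub>m 1\<^sub>m m)"
  let ?D = "four_block_mat (x \<cdot>\<^sub>m 1\<^sub>m l) (0\<^sub>m l m) C (1\<^sub>m m)"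
  have B': "- B \<in> carrier_mat l m" and C': "- C \<in> carrier_mat m l" using B C by auto
  have "?A * ?D = four_block_mat (x\<^sup>2 \<cdot>\<^sub>m 1\<^sub>m l - B * C) (- B) (0\<^sub>m m l) (x \<cdot>\<^sub>m 1\<^sub>m m)"
  proof -
    have 1: "(x \<cdot>\<^sub>m 1\<^sub>m l) * (x \<cdot>\<^sub>m 1\<^sub>m l) + (- B) * C = x\<^sup>2 \<cdot>\<^sub>m 1\<^sub>m l - B * C"
    proof -
      have "(- B) * C = - (B * C)" using B C by simp
      moreover have "(x \<cdot>\<^sub>m 1\<^sub>m l) * (x \<cdot>\<^sub>m 1\<^sub>m l) = x\<^sup>2 \<cdot>\<^sub>m 1\<^sub>m l"
        by (subst mult_smult_one_right[where n = l]) (auto intro!: eq_matI simp: power2_eq_square)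
      ultimately show ?thesis using B C by (intro eq_matI) auto
    qed
    have 2: "(x \<cdot>\<^sub>m 1\<^sub>m l) * (0\<^sub>m l m) + (- B) * 1\<^sub>m m = - B" using B' by simp
    have 3: "(- C) * (x \<cdot>\<^sub>m 1\<^sub>m l) + (x \<cdot>\<^sub>m 1\<^sub>m m) * C = 0\<^sub>m m l"
      unfolding mult_smult_one_right[OF C'] mult_smult_one_left[OF C] using C by (intro eq_matI) auto
    have 4: "(- C) * (0\<^sub>m l m) + (x \<cdot>\<^sub>m 1\<^sub>m m) * 1\<^sub>m m = x \<cdot>\<^sub>m 1\<^sub>m m" using C' by simp
    show ?thesis
      using mult_four_block_mat[OF smult_carrier_mat[OF one_carrier_mat] B' C' smult_carrier_mat[OF one_carrier_mat]
          smult_carrier_mat[OF one_carrier_mat] zero_carrier_mat C one_carrier_mat, of x x x]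
      unfolding 1 2 3 4 .
  qed
  moreover have "det (four_block_mat (x\<^sup>2 \<cdot>\<^sub>m 1\<^sub>m l - B * C) (- B) (0\<^sub>m m l) (x \<cdot>\<^sub>m 1\<^sub>m m))
      = det (x\<^sup>2 \<cdot>\<^sub>m 1\<^sub>m l - B * C) * x ^ m"
    using B C by (subst det_four_block_mat_lower_left_zero[where n = l and m = m]) (auto simp: det_smult_one)
  moreover have "det ?D = x ^ l"
    using C by (subst det_four_block_mat_upper_right_zero[where n = l and m = m]) (auto simp: det_smult_one)
  moreover have "det (?A * ?D) = det ?A * det ?D"
    using B C by (intro det_mult[where n = "l + m"]) auto
  ultimately show ?thesis by simp
qed

text \<open>The determinant of one block matrix is evaluated twice: \<open>?D1\<close> clears its
  lower left block, \<open>?D2\<close> the upper right one. As \<open>V * U\<close> is the identity,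
  \<open>U * V\<close> is a projection of rank \<open>c\<close>, whence the \<open>c\<close> factors
  \<open>b + t\<close>.\<close>

lemma det_low_rank_update:
  fixes b t :: "'a :: field"
  assumes U: "U \<in> carrier_mat n c" and V: "V \<in> carrier_mat c n" and VU: "V * U = 1\<^sub>m c"
  shows "det (b \<cdot>\<^sub>m 1\<^sub>m n + t \<cdot>\<^sub>m (U * V)) * b ^ c = b ^ n * (b + t) ^ c"
proof -
  let ?A = "four_block_mat (b \<cdot>\<^sub>m 1\<^sub>m n) (- (t \<cdot>\<^sub>m U)) V (1\<^sub>m c)"
  let ?D1 = "four_block_mat (1\<^sub>m n) (0\<^sub>m n c) (- V) (1\<^sub>m c)"
  let ?D2 = "four_block_mat (1\<^sub>m n) (t \<cdot>\<^sub>m U) (0\<^sub>m c n) (b \<cdot>\<^sub>m 1\<^sub>m c)"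
  have tU: "t \<cdot>\<^sub>m U \<in> carrier_mat n c" "- (t \<cdot>\<^sub>m U) \<in> carrier_mat n c" "- V \<in> carrier_mat c n" using U V by auto
  have tUV: "(t \<cdot>\<^sub>m U) * V = t \<cdot>\<^sub>m (U * V)" using mult_smult_assoc_mat[OF U V] .
  have "?A * ?D1 = four_block_mat (b \<cdot>\<^sub>m 1\<^sub>m n + t \<cdot>\<^sub>m (U * V)) (- (t \<cdot>\<^sub>m U)) (0\<^sub>m c n) (1\<^sub>m c)"
  proof -
    have 1: "b \<cdot>\<^sub>m 1\<^sub>m n * 1\<^sub>m n + (- (t \<cdot>\<^sub>m U)) * (- V) = b \<cdot>\<^sub>m 1\<^sub>m n + t \<cdot>\<^sub>m (U * V)"
    proof -
      have "(- (t \<cdot>\<^sub>m U)) * (- V) = (t \<cdot>\<^sub>m U) * V"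
        using tU V uminus_mult_left_mat[of "t \<cdot>\<^sub>m U" "- V"] uminus_mult_right_mat[of "t \<cdot>\<^sub>m U" V] U by auto
      then show ?thesis unfolding tUV by simp
    qed
    have 2: "b \<cdot>\<^sub>m 1\<^sub>m n * 0\<^sub>m n c + (- (t \<cdot>\<^sub>m U)) * 1\<^sub>m c = - (t \<cdot>\<^sub>m U)"
      unfolding right_mult_one_mat[OF tU(2)] using tU by (subst right_mult_zero_mat[of _ n n]) auto
    have 3: "V * 1\<^sub>m n + 1\<^sub>m c * (- V) = 0\<^sub>m c n" using V by (simp, intro eq_matI) auto
    have 4: "V * 0\<^sub>m n c + 1\<^sub>m c * 1\<^sub>m c = 1\<^sub>m c" using V by simp
    show ?thesis
      using mult_four_block_mat[OF smult_carrier_mat[OF one_carrier_mat] tU(2) V one_carrier_mat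
          one_carrier_mat zero_carrier_mat tU(3) one_carrier_mat, of b]
      unfolding 1 2 3 4 .
  qed
  moreover have "det (?A * ?D1) = det ?A * det ?D1" using U V by (intro det_mult[where n = "n + c"]) auto
  moreover have "det ?D1 = 1"
    using V by (subst det_four_block_mat_upper_right_zero[where n = n and m = c]) auto
  moreover have "det (four_block_mat (b \<cdot>\<^sub>m 1\<^sub>m n + t \<cdot>\<^sub>m (U * V)) (- (t \<cdot>\<^sub>m U)) (0\<^sub>m c n) (1\<^sub>m c))
      = det (b \<cdot>\<^sub>m 1\<^sub>m n + t \<cdot>\<^sub>m (U * V))"
    using U V by (subst det_four_block_mat_lower_left_zero[where n = n and m = c]) auto
  ultimately have A1: "det ?A = det (b \<cdot>\<^sub>m 1\<^sub>m n + t \<cdot>\<^sub>m (U * V))" by simp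
  have "?A * ?D2 = four_block_mat (b \<cdot>\<^sub>m 1\<^sub>m n) (0\<^sub>m n c) V ((b + t) \<cdot>\<^sub>m 1\<^sub>m c)"
  proof -
    have 1: "b \<cdot>\<^sub>m 1\<^sub>m n * 1\<^sub>m n + (- (t \<cdot>\<^sub>m U)) * 0\<^sub>m c n = b \<cdot>\<^sub>m 1\<^sub>m n"
      unfolding right_mult_zero_mat[OF tU(2)] by (subst right_mult_one_mat[of _ n n]) auto
    have 2: "b \<cdot>\<^sub>m 1\<^sub>m n * (t \<cdot>\<^sub>m U) + (- (t \<cdot>\<^sub>m U)) * (b \<cdot>\<^sub>m 1\<^sub>m c) = 0\<^sub>m n c"
      unfolding mult_smult_one_left[OF tU(1)] mult_smult_one_right[OF tU(2)] using U by (intro eq_matI) auto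
    have 3: "V * 1\<^sub>m n + 1\<^sub>m c * 0\<^sub>m c n = V" using V by simp
    have 4: "V * (t \<cdot>\<^sub>m U) + 1\<^sub>m c * (b \<cdot>\<^sub>m 1\<^sub>m c) = (b + t) \<cdot>\<^sub>m 1\<^sub>m c"
      unfolding mult_smult_distrib[OF V U] VU by (simp, intro eq_matI) auto
    show ?thesis
      using mult_four_block_mat[OF smult_carrier_mat[OF one_carrier_mat] tU(2) V one_carrier_mat
          one_carrier_mat tU(1) zero_carrier_mat smult_carrier_mat[OF one_carrier_mat], of b b]
      unfolding 1 2 3 4 .
  qed
  moreover have "det (?A * ?D2) = det ?A * det ?D2" using U V by (intro det_mult[where n = "n + c"]) auto
  moreover have "det ?D2 = b ^ c"
    using U by (subst det_four_block_mat_lower_left_zero[where n = n and m = c]) (auto simp: det_smult_one)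
  moreover have "det (four_block_mat (b \<cdot>\<^sub>m 1\<^sub>m n) (0\<^sub>m n c) V ((b + t) \<cdot>\<^sub>m 1\<^sub>m c)) = b ^ n * (b + t) ^ c"
    using V by (subst det_four_block_mat_upper_right_zero[where n = n and m = c]) (auto simp: det_smult_one)
  ultimately show ?thesis using A1 by simp
qed

text \<open>With \<open>L\<close> listed first the diagonal blocks vanish, so
  \<open>det_bipartite\<close> ties the characteristic polynomial at \<open>x\<close> to that of the
  joint degree matrix at \<open>x^2\<close>; each factor \<open>x^2 - lam j\<close> splits because
  \<open>lam j\<close> is positive.\<close>

lemma adjacency_spectrum_bipartite:
  fixes L Y :: "'v set"
  assumes fin: "finite L" "finite Y" and disj: "L \<inter> Y = {}"
    and sym: "\<And>u v. adj u v = adj v u"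
    and LL: "\<And>u v. u \<in> L \<Longrightarrow> v \<in> L \<Longrightarrow> \<not> adj u v"
    and XX: "\<And>u v. u \<in> Y \<Longrightarrow> v \<in> Y \<Longrightarrow> \<not> adj u v"
    and ls: "distinct ls" "set ls = L"
    and cp: "char_poly (kernel_mat ls (\<lambda>u v. real (card {x \<in> Y. adj u x \<and> adj v x})))
       = (\<Prod>j\<in>J. [:- lam j, 1:] ^ mlt j)"
    and J: "finite J" and pos: "\<And>j. j \<in> J \<Longrightarrow> lam j > 0"
  shows "adjacency_spectrum (L \<union> Y) adj
       = (\<Sum>j\<in>J. pm_mset (mlt j) (sqrt (lam j))) + replicate_mset (card Y - card L) 0"
proof -
  define a :: "'v \<Rightarrow> 'v \<Rightarrow> real" where "a u v = (if adj u v then 1 else 0)" for u v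
  define M where "M = kernel_mat ls (\<lambda>u v. real (card {x \<in> Y. adj u x \<and> adj v x}))"
  obtain ms where ms: "distinct ms" "set ms = Y" using finite_distinct_list[OF fin(2)] by blast
  define l m where "l = length ls" and "m = length ms"
  have lm: "l = card L" "m = card Y" using ls ms distinct_card unfolding l_def m_def by metis+
  define vs where "vs = (SOME vs. distinct vs \<and> set vs = L \<union> Y)"
  have "\<exists>vs. distinct vs \<and> set vs = L \<union> Y" using finite_distinct_list[of "L \<union> Y"] fin by auto
  then have vs: "distinct vs" "set vs = L \<union> Y" unfolding vs_def by (metis (mono_tags, lifting) someI_ex)+
  define A where "A = kernel_mat (ls @ ms) a"
  have "adjacency_mat vs adj = kernel_mat vs a" by (simp add: adjacency_mat_def pair_mat_def a_def)
  moreover have "char_poly (kernel_mat vs a) = char_poly A"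
    unfolding A_def using vs ls ms disj by (intro char_poly_kernel_mat_reorder) auto
  ultimately have spec: "adjacency_spectrum (L \<union> Y) adj = proots (char_poly A)"
    unfolding adjacency_spectrum_def vs_def by simp
  have Ac: "A \<in> carrier_mat (l + m) (l + m)" unfolding A_def l_def m_def using pair_mat_carrier[of "ls @ ms" "ls @ ms" a] by simp
  define B where "B = pair_mat ls ms a"
  define C where "C = pair_mat ms ls a"
  have Bc: "B \<in> carrier_mat l m" "C \<in> carrier_mat m l" by (simp_all add: B_def C_def l_def m_def)
  have "(\<Sum>x\<in>Y. a u x * a x v) = real (card {x \<in> Y. adj u x \<and> adj v x})" for u v
  proof -
    have "(\<Sum>x\<in>Y. a u x * a x v) = (\<Sum>x\<in>Y. if adj u x \<and> adj v x then 1 else 0)"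
      using sym[of _ v] by (intro sum.cong) (auto simp: a_def)
    then show ?thesis using fin(2) by (simp add: sum.If_cases Int_def)
  qed
  then have BC: "B * C = M" unfolding B_def C_def M_def pair_mat_mult[OF ms(1)] ms(2) by simp
  have Mc: "M \<in> carrier_mat l l" unfolding M_def l_def by simp
  have blk: "x \<cdot>\<^sub>m 1\<^sub>m (l + m) - A = four_block_mat (x \<cdot>\<^sub>m 1\<^sub>m l) (- B) (- C) (x \<cdot>\<^sub>m 1\<^sub>m m)" for x
  proof (rule eq_matI)
    fix i j assume "i < dim_row (four_block_mat (x \<cdot>\<^sub>m 1\<^sub>m l) (- B) (- C) (x \<cdot>\<^sub>m 1\<^sub>m m))"
      "j < dim_col (four_block_mat (x \<cdot>\<^sub>m 1\<^sub>m l) (- B) (- C) (x \<cdot>\<^sub>m 1\<^sub>m m))"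
    then have ij: "i < l + m" "j < l + m" by auto
    have Aij: "A $$ (i, j) = a ((ls @ ms) ! i) ((ls @ ms) ! j)"
      using ij by (simp add: A_def l_def m_def)
    have 0: "a u v = 0" if "u \<in> L \<and> v \<in> L \<or> u \<in> Y \<and> v \<in> Y" for u v
      using that LL XX by (auto simp: a_def)
    show "(x \<cdot>\<^sub>m 1\<^sub>m (l + m) - A) $$ (i, j)
        = four_block_mat (x \<cdot>\<^sub>m 1\<^sub>m l) (- B) (- C) (x \<cdot>\<^sub>m 1\<^sub>m m) $$ (i, j)"
    proof (cases "i < l"; cases "j < l")
      assume "i < l" "j < l"
      then show ?thesis using ij Ac Aij 0[of "ls ! i" "ls ! j"] ls by (auto simp: nth_append l_def)
    next
      assume "i < l" "\<not> j < l"
      then show ?thesis using ij Ac Aij by (auto simp: nth_append l_def m_def B_def C_def)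
    next
      assume "\<not> i < l" "j < l"
      then show ?thesis using ij Ac Aij by (auto simp: nth_append l_def m_def B_def C_def)
    next
      assume h: "\<not> i < l" "\<not> j < l"
      then have "ms ! (i - l) \<in> Y" "ms ! (j - l) \<in> Y" using ij ms(2) nth_mem[of _ ms] by (auto simp: m_def)
      then show ?thesis using h ij Ac Aij 0[of "ms ! (i - l)" "ms ! (j - l)"]
        by (auto simp: nth_append l_def m_def B_def C_def)
    qed
  qed (use Ac in auto)
  let ?s = "\<lambda>j. sqrt (lam j)"
  let ?q = "\<lambda>j. ([:- ?s j, 1:] * [:?s j, 1:]) ^ mlt j"
  have "char_poly A * [:0, 1:] ^ l = (\<Prod>j\<in>J. ?q j) * [:0, 1:] ^ m"
  proof (rule poly_ext)
    fix x :: real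
    have lin: "poly [:- lam j, 1:] (x\<^sup>2) = poly ([:- ?s j, 1:] * [:?s j, 1:]) x" if "j \<in> J" for j
      using real_sqrt_pow2[of "lam j"] pos[OF that] by (simp add: algebra_simps power2_eq_square)
    have "poly (char_poly A) x * x ^ l = det (x\<^sup>2 \<cdot>\<^sub>m 1\<^sub>m l - M) * x ^ m"
      unfolding poly_char_poly[OF Ac] blk BC[symmetric] by (rule det_bipartite[OF Bc])
    also have "det (x\<^sup>2 \<cdot>\<^sub>m 1\<^sub>m l - M) = poly (\<Prod>j\<in>J. [:- lam j, 1:] ^ mlt j) (x\<^sup>2)"
      unfolding cp[symmetric] M_def[symmetric] poly_char_poly[OF Mc] ..
    also have "\<dots> = poly (\<Prod>j\<in>J. ?q j) x"
      unfolding poly_prod poly_power using lin by (intro prod.cong) auto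
    finally show "poly (char_poly A * [:0, 1:] ^ l) x = poly ((\<Prod>j\<in>J. ?q j) * [:0, 1:] ^ m) x"
      by simp
  qed
  moreover have nz: "char_poly A \<noteq> 0" using degree_monic_char_poly[OF Ac] by auto
  moreover have "(\<Prod>j\<in>J. ?q j) \<noteq> 0" using J by (simp add: prod_zero_iff)
  ultimately have "proots (char_poly A) + proots ([:0, 1:] ^ l) = proots (\<Prod>j\<in>J. ?q j) + proots ([:0, 1:] ^ m)"
    by (metis (no_types, lifting) pCons_eq_0_iff power_not_zero proots_mult zero_neq_one)
  moreover have "proots (\<Prod>j\<in>J. ?q j) = (\<Sum>j\<in>J. pm_mset (mlt j) (?s j))"
  proof -
    have "proots (?q j) = pm_mset (mlt j) (?s j)" for j
      by (subst proots_power, subst proots_mult) (auto simp: pm_mset_def multiset_eq_iff)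
    then show ?thesis by (subst proots_prod) auto
  qed
  moreover have "proots ([:0, 1 :: real:] ^ k) = replicate_mset k 0" for k
    by (subst proots_power) (auto simp: multiset_eq_iff)
  ultimately have eq: "proots (char_poly A) + replicate_mset l 0
      = (\<Sum>j\<in>J. pm_mset (mlt j) (?s j)) + replicate_mset m 0" by simp
  \<comment> \<open>Positivity of all \<open>lam j\<close> keeps zero out of the first sum.
    Comparing multiplicities of 0 then forces \<open>l\<close> to be at most \<open>m\<close>, so
    the truncated difference \<open>m - l\<close> is the true one.\<close>
  have c0: "count (\<Sum>j\<in>J. pm_mset (mlt j) (?s j)) 0 = 0"
    unfolding count_sum using pos by (intro sum.neutral) (force simp: pm_mset_def)
  have "proots (char_poly A) = (\<Sum>j\<in>J. pm_mset (mlt j) (?s j)) + replicate_mset (m - l) 0"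
  proof (rule multiset_eqI)
    fix z
    have "count (proots (char_poly A)) z + count (replicate_mset l 0) z
      = count (\<Sum>j\<in>J. pm_mset (mlt j) (?s j)) z + count (replicate_mset m 0) z"
      using arg_cong[OF eq, of "\<lambda>S. count S z"] by simp
    then show "count (proots (char_poly A)) z
        = count ((\<Sum>j\<in>J. pm_mset (mlt j) (?s j)) + replicate_mset (m - l) 0) z"
      using c0 by (cases "z = 0") auto
  qed
  then show ?thesis unfolding spec lm .
qed

section \<open>Matrices built from nested partitions: determinants and characteristic
  polynomials\<close>

locale hierarchy =
  fixes vs :: "'v list" and cls :: "nat \<Rightarrow> 'v \<Rightarrow> 'k" and r :: nat and s :: "nat \<Rightarrow> nat"
  assumes dist: "distinct vs"
    and refine: "\<And>u v i j. u \<in> set vs \<Longrightarrow> v \<in> set vs \<Longrightarrow> i \<le> j \<Longrightarrow> cls j u = cls j v \<Longrightarrow> cls i u = cls i v"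
    and size: "\<And>u j. u \<in> set vs \<Longrightarrow> j < r \<Longrightarrow> card {v \<in> set vs. cls j v = cls j u} = s j"
begin

text \<open>For \<open>j < r\<close>, the kernel of the orthogonal projection onto the functions
  that are constant on the classes of level \<open>j\<close>.\<close>

definition avg :: "nat \<Rightarrow> 'v \<Rightarrow> 'v \<Rightarrow> real" where
  "avg j u v = (if cls j u = cls j v then 1 / s j else 0)"

definition num_classes :: "nat \<Rightarrow> nat" where
  "num_classes j = card (cls j ` set vs)"

text \<open>The value 0 at the coarsest level makes \<open>num_classes j - coarser_num j\<close> the
  dimension, for every \<open>j\<close>, of the functions that are constant at level
  \<open>j\<close> and have zero sums over the classes of the preceding level.\<close>

definition coarser_num :: "nat \<Rightarrow> nat" where
  "coarser_num j = (case j of 0 \<Rightarrow> 0 | Suc i \<Rightarrow> num_classes i)"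

abbreviation delta :: "'v \<Rightarrow> 'v \<Rightarrow> real" where
  "delta u v \<equiv> (if u = v then 1 else 0)"

lemma size_pos: "u \<in> set vs \<Longrightarrow> j < r \<Longrightarrow> s j > 0"
  using size[of u j] card_gt_0_iff[of "{v \<in> set vs. cls j v = cls j u}"] by force

text \<open>As a function of \<open>w\<close> the coarser kernel is constant on the finer classes,
  so averaging over these leaves it unchanged.\<close>

lemma avg_mult:
  assumes "u \<in> set vs" "v \<in> set vs" "i \<le> j" "j < r"
  shows "(\<Sum>w\<in>set vs. avg i u w * avg j w v) = avg i u v"
proof -
  have "(\<Sum>w\<in>set vs. avg i u w * avg j w v) = (\<Sum>w\<in>set vs. if cls j w = cls j v then avg i u v / s j else 0)"
    using refine[OF _ assms(2,3)] by (intro sum.cong) (auto simp: avg_def)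
  also have "\<dots> = (\<Sum>w\<in>{w \<in> set vs. cls j w = cls j v}. avg i u v / s j)"
    by (subst sum.inter_filter[symmetric]) auto
  also have "\<dots> = avg i u v"
    using size[OF assms(2,4)] size_pos[OF assms(2,4)] by simp
  finally show ?thesis .
qed

lemma num_classes_mono:
  assumes "i \<le> j"
  shows "num_classes i \<le> num_classes j"
proof -
  have "cls i ` set vs \<subseteq> (\<lambda>k. cls i (SOME v. v \<in> set vs \<and> cls j v = k)) ` cls j ` set vs"
  proof
    fix k assume "k \<in> cls i ` set vs"
    then obtain u where u: "u \<in> set vs" "k = cls i u" by blast
    let ?v = "SOME v. v \<in> set vs \<and> cls j v = cls j u"
    have "?v \<in> set vs \<and> cls j ?v = cls j u" using u(1) by (intro someI) auto
    then have "cls i ?v = k" using refine[of ?v u i j] u assms by simp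
    then show "k \<in> (\<lambda>k. cls i (SOME v. v \<in> set vs \<and> cls j v = k)) ` cls j ` set vs" using u by force
  qed
  then show ?thesis unfolding num_classes_def by (rule surj_card_le[rotated]) simp
qed

lemma num_classes_le: "num_classes j \<le> length vs"
  unfolding num_classes_def using card_image_le[of "set vs" "cls j"] card_length[of vs] by simp

lemma coarser_le: "coarser_num j \<le> num_classes j"
  by (cases j) (auto simp: coarser_num_def intro: num_classes_mono)

lemma num_classes_times_size:
  assumes "j < r"
  shows "num_classes j * s j = length vs"
proof -
  have "card (set vs) = s j * card (cls j ` set vs)"
  proof (rule card_eq_fibers(2)[OF _ refl])
    fix k assume "k \<in> cls j ` set vs"
    then obtain u where "u \<in> set vs" "k = cls j u" by blast
    then show "card {v \<in> set vs. cls j v = k} = s j" using size[OF _ assms] by simp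
  qed auto
  then show ?thesis using distinct_card[OF dist] by (simp add: num_classes_def mult.commute)
qed

text \<open>The columns of \<open>?U\<close> are the indicator functions of the classes, and
  \<open>?V\<close> is its transpose divided by the class size. So \<open>avg j\<close> is
  \<open>?U * ?V\<close>, a projection of rank \<open>num_classes j\<close>.\<close>

lemma det_avg:
  assumes j: "j < r"
  shows "det (kernel_mat vs (\<lambda>u v. b * delta u v + t * avg j u v)) * b ^ num_classes j
    = b ^ length vs * (b + t) ^ num_classes j"
proof -
  let ?n = "length vs"
  obtain ks where ks: "distinct ks" "set ks = cls j ` set vs" using finite_distinct_list[of "cls j ` set vs"] by auto
  have len: "length ks = num_classes j" using distinct_card[OF ks(1)] ks(2) by (simp add: num_classes_def)
  let ?d = "\<lambda>v c. if cls j v = c then 1 else 0 :: real"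
  let ?U = "pair_mat vs ks ?d" and ?V = "pair_mat ks vs (\<lambda>c v. ?d v c / s j)"
  have Uc: "?U \<in> carrier_mat ?n (num_classes j)" "?V \<in> carrier_mat (num_classes j) ?n"
    using pair_mat_carrier[of vs ks ?d] pair_mat_carrier[of ks vs "\<lambda>c v. ?d v c / s j"] unfolding len .
  have "(\<Sum>v\<in>set vs. ?d v c / s j * ?d v c') = (if c = c' then 1 else 0)"
    if c: "c \<in> set ks" for c c'
  proof -
    obtain u where u: "u \<in> set vs" "c = cls j u" using c ks(2) by auto
    have "(\<Sum>v\<in>set vs. ?d v c / s j * ?d v c')
        = (\<Sum>v\<in>set vs. if cls j v = cls j u then (if c = c' then 1 else 0) / s j else 0)"
      using u(2) by (intro sum.cong) auto
    also have "\<dots> = (\<Sum>v\<in>{v \<in> set vs. cls j v = cls j u}. (if c = c' then 1 else 0) / s j)"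
      by (subst sum.inter_filter[symmetric]) auto
    finally show ?thesis using size[OF u(1) j] size_pos[OF u(1) j] by simp
  qed
  then have VU: "?V * ?U = 1\<^sub>m (num_classes j)"
    unfolding pair_mat_mult[OF dist] len[symmetric] pair_mat_delta[OF ks(1), symmetric]
    by (intro pair_mat_cong) simp
  have "(\<Sum>c\<in>set ks. ?d u c * (?d v c / s j)) = avg j u v" if "u \<in> set vs" for u v
    using sum_delta_mult(1)[of "set ks" "cls j u" "\<lambda>c. ?d v c / s j"] that ks(2) by (auto simp: avg_def)
  then have UV: "?U * ?V = kernel_mat vs (avg j)"
    unfolding pair_mat_mult[OF ks(1)] by (intro pair_mat_cong) simp
  have "kernel_mat vs (\<lambda>u v. b * delta u v + t * avg j u v) = b \<cdot>\<^sub>m 1\<^sub>m ?n + t \<cdot>\<^sub>m (?U * ?V)"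
    unfolding UV pair_mat_delta[OF dist, symmetric] by (intro eq_matI) auto
  then show ?thesis using det_low_rank_update[OF Uc VU, of b t] by simp
qed

text \<open>By summation by parts this is the operator with eigenvalue \<open>y j\<close> on the
  range of \<open>avg j - avg (j-1)\<close> for \<open>j < k\<close> and eigenvalue
  \<open>y k\<close> on the kernel of \<open>avg (k-1)\<close>, where the projection before
  \<open>avg 0\<close> is read as zero.\<close>

definition tower :: "(nat \<Rightarrow> real) \<Rightarrow> nat \<Rightarrow> 'v \<Rightarrow> 'v \<Rightarrow> real" where
  "tower y k u v = y k * delta u v + (\<Sum>j<k. (y j - y (Suc j)) * avg j u v)"

text \<open>The second factor acts as \<open>y k\<close> on the range of \<open>avg k\<close> and as
  \<open>y (Suc k)\<close> on its kernel, where the first factor acts as \<open>y k\<close>. So the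
  product is \<open>y k\<close> times the next tower.\<close>

lemma tower_Suc:
  assumes k: "k < r"
  shows "y k \<cdot>\<^sub>m kernel_mat vs (tower y (Suc k))
    = kernel_mat vs (tower y k) * kernel_mat vs (\<lambda>u v. y (Suc k) * delta u v + (y k - y (Suc k)) * avg k u v)"
proof -
  let ?g = "\<lambda>u v. y (Suc k) * delta u v + (y k - y (Suc k)) * avg k u v"
  have "(\<Sum>w\<in>set vs. tower y k u w * ?g w v) = y k * tower y (Suc k) u v"
    if u: "u \<in> set vs" and v: "v \<in> set vs" for u v
  proof -
    let ?c = "\<lambda>j. y j - y (Suc j)"
    have d1: "(\<Sum>w\<in>set vs. delta u w * h w) = h u" for h
      using u by (simp add: sum_delta_mult)
    have d2: "(\<Sum>w\<in>set vs. h w * delta w v) = h v" for h :: "'v \<Rightarrow> real"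
      using v by (simp add: sum_delta_mult)
    have avg_g: "(\<Sum>w\<in>set vs. avg j u w * ?g w v) = y k * avg j u v" if "j < k" for j
    proof -
      have "(\<Sum>w\<in>set vs. avg j u w * ?g w v)
         = y (Suc k) * (\<Sum>w\<in>set vs. avg j u w * delta w v) + ?c k * (\<Sum>w\<in>set vs. avg j u w * avg k w v)"
        unfolding sum_distrib_left sum.distrib[symmetric] by (intro sum.cong) (auto simp: algebra_simps)
      also have "\<dots> = y k * avg j u v"
        unfolding d2 using avg_mult[OF u v _ k, of j] that by (simp add: algebra_simps)
      finally show ?thesis .
    qed
    have "(\<Sum>w\<in>set vs. tower y k u w * ?g w v)
       = y k * (\<Sum>w\<in>set vs. delta u w * ?g w v) + (\<Sum>w\<in>set vs. \<Sum>j<k. ?c j * (avg j u w * ?g w v))"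
      unfolding tower_def sum_distrib_left sum.distrib[symmetric]
      by (intro sum.cong) (simp_all add: distrib_right sum_distrib_right mult.assoc)
    also have "(\<Sum>w\<in>set vs. \<Sum>j<k. ?c j * (avg j u w * ?g w v)) = (\<Sum>j<k. ?c j * (\<Sum>w\<in>set vs. avg j u w * ?g w v))"
      unfolding sum_distrib_left by (rule sum.swap)
    also have "\<dots> = (\<Sum>j<k. y k * (?c j * avg j u v))" using avg_g by (intro sum.cong) auto
    also have "\<dots> = y k * (\<Sum>j<k. ?c j * avg j u v)" by (simp only: sum_distrib_left)
    finally show ?thesis unfolding d1 tower_def by (simp add: algebra_simps)
  qed
  then have "kernel_mat vs (\<lambda>u v. \<Sum>w\<in>set vs. tower y k u w * ?g w v) = y k \<cdot>\<^sub>m kernel_mat vs (tower y (Suc k))"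
    by (intro eq_matI) auto
  then show ?thesis unfolding pair_mat_mult[OF dist] by simp
qed

text \<open>Taking determinants in \<open>tower_Suc\<close> leaves powers of \<open>y k\<close> and
  \<open>y (Suc k)\<close> to be cancelled, hence the assumption that these are nonzero.\<close>

lemma det_tower:
  assumes "k \<le> r" "\<And>j. j \<le> k \<Longrightarrow> y j \<noteq> 0"
  shows "det (kernel_mat vs (tower y k))
    = (\<Prod>j<k. y j ^ (num_classes j - coarser_num j)) * y k ^ (length vs - coarser_num k)"
  using assms
proof (induction k)
  case 0
  have "kernel_mat vs (tower y 0) = y 0 \<cdot>\<^sub>m 1\<^sub>m (length vs)"
    using dist by (intro eq_matI) (auto simp: tower_def nth_eq_iff_index_eq)
  then show ?case by (simp add: det_smult_one coarser_num_def)
next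
  case (Suc k)
  let ?n = "length vs" and ?T = "\<lambda>k. kernel_mat vs (tower y k)"
  let ?G = "kernel_mat vs (\<lambda>u v. y (Suc k) * delta u v + (y k - y (Suc k)) * avg k u v)"
  let ?P = "\<Prod>j<k. y j ^ (num_classes j - coarser_num j)"
  have k: "k < r" and nz: "y k \<noteq> 0" "y (Suc k) \<noteq> 0" using Suc by auto
  have "y k ^ ?n * det (?T (Suc k)) = det (?T k) * det ?G"
    using arg_cong[OF tower_Suc[OF k, of y], of det] det_mult[OF pair_mat_carrier[of vs vs] pair_mat_carrier[of vs vs]]
    by (simp add: det_smult)
  moreover have "det ?G * y (Suc k) ^ num_classes k = y (Suc k) ^ ?n * y k ^ num_classes k"
    using det_avg[OF k, of "y (Suc k)" "y k - y (Suc k)"] by simp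
  moreover have "y (Suc k) ^ ?n = y (Suc k) ^ (?n - num_classes k) * y (Suc k) ^ num_classes k"
    using num_classes_le[of k] by (simp add: power_add[symmetric])
  ultimately have 1: "y k ^ ?n * det (?T (Suc k)) = det (?T k) * (y (Suc k) ^ (?n - num_classes k) * y k ^ num_classes k)"
    using nz(2) by simp
  have e: "?n - coarser_num k + num_classes k = ?n + (num_classes k - coarser_num k)"
    using num_classes_le[of k] coarser_le[of k] by simp
  have "det (?T k) = ?P * y k ^ (?n - coarser_num k)" using Suc by simp
  then have "y k ^ ?n * det (?T (Suc k))
      = ?P * y (Suc k) ^ (?n - num_classes k) * y k ^ (?n - coarser_num k + num_classes k)"
    using 1 by (simp add: power_add)
  then have "y k ^ ?n * det (?T (Suc k))
      = y k ^ ?n * (?P * y (Suc k) ^ (?n - num_classes k) * y k ^ (num_classes k - coarser_num k))"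
    unfolding e by (simp only: power_add mult_ac)
  then show ?case using nz(1) by (simp add: coarser_num_def)
qed

text \<open>Level \<open>r\<close> stands for the partition into single vertices, hence
  \<open>length vs\<close> there.\<close>

definition mlt :: "nat \<Rightarrow> nat" where
  "mlt j = (if j < r then num_classes j else length vs) - coarser_num j"

text \<open>Subtracting a tower from \<open>x\<close> gives the tower of the numbers
  \<open>x - lam j\<close>, so \<open>det_tower\<close> provides the value at every \<open>x\<close>
  that is none of the \<open>lam j\<close>; polynomials that agree off a finite set are
  equal.\<close>

lemma char_poly_tower:
  assumes f: "\<And>u v. u \<in> set vs \<Longrightarrow> v \<in> set vs \<Longrightarrow> f u v = tower lam r u v"
  shows "char_poly (kernel_mat vs f) = (\<Prod>j\<le>r. [:- lam j, 1:] ^ mlt j)" (is "?p = ?q")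
proof -
  have eq: "poly ?p x = poly ?q x" if x: "x \<notin> lam ` {..r}" for x
  proof -
    let ?y = "\<lambda>j. x - lam j"
    have "x \<cdot>\<^sub>m 1\<^sub>m (length vs) - kernel_mat vs f = kernel_mat vs (tower ?y r)"
    proof (rule eq_matI)
      fix i j assume "i < dim_row (kernel_mat vs (tower ?y r))" "j < dim_col (kernel_mat vs (tower ?y r))"
      then have ij: "i < length vs" "j < length vs" by auto
      have "(\<Sum>k<r. (?y k - ?y (Suc k)) * avg k u v) = - (\<Sum>k<r. (lam k - lam (Suc k)) * avg k u v)" for u v
        unfolding sum_negf[symmetric] by (intro sum.cong) (auto simp: algebra_simps)
      then show "(x \<cdot>\<^sub>m 1\<^sub>m (length vs) - kernel_mat vs f) $$ (i, j) = kernel_mat vs (tower ?y r) $$ (i, j)"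
        using ij dist by (simp add: f tower_def nth_eq_iff_index_eq algebra_simps)
    qed auto
    then have "poly ?p x = (\<Prod>j<r. ?y j ^ (num_classes j - coarser_num j)) * ?y r ^ (length vs - coarser_num r)"
      using poly_char_poly[OF pair_mat_carrier[of vs vs f], of x] det_tower[of r ?y] x by fastforce
    also have "\<dots> = (\<Prod>j<r. ?y j ^ mlt j) * ?y r ^ mlt r" by (simp add: mlt_def)
    also have "\<dots> = poly ?q x" by (simp add: poly_prod lessThan_Suc_atMost[symmetric])
    finally show ?thesis .
  qed
  show ?thesis
  proof (rule ccontr)
    assume "?p \<noteq> ?q"
    then have "finite {x. poly (?p - ?q) x = 0}" by (intro poly_roots_finite) simp
    moreover have "- (lam ` {..r}) \<subseteq> {x. poly (?p - ?q) x = 0}" using eq by auto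
    ultimately have "finite (- (lam ` {..r}))" by (rule rev_finite_subset)
    then have "finite (UNIV :: real set)" by (metis finite_Un Compl_partition finite_atMost finite_imageI)
    then show False using infinite_UNIV_char_0 by blast
  qed
qed

text \<open>
  \<open>N k\<close> is the value of the kernel on pairs that are equivalent at level \<open>k\<close> but not at level
  \<open>Suc k\<close>, and \<open>W k\<close> is its sum over a class of level \<open>k\<close>.
\<close>

lemma char_poly_hierarchy:
  fixes f :: "'v \<Rightarrow> 'v \<Rightarrow> real" and N N' W :: "nat \<Rightarrow> real"
  assumes sep: "\<And>u v. u \<in> set vs \<Longrightarrow> v \<in> set vs \<Longrightarrow> cls r u = cls r v \<Longrightarrow> u = v"
    and top: "\<And>u v. u \<in> set vs \<Longrightarrow> v \<in> set vs \<Longrightarrow> cls 0 u = cls 0 v"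
    and sr: "s r = 1"
    and diag: "\<And>u. u \<in> set vs \<Longrightarrow> f u u = N r"
    and lev: "\<And>u v k. u \<in> set vs \<Longrightarrow> v \<in> set vs \<Longrightarrow> k < r \<Longrightarrow> cls k u = cls k v \<Longrightarrow>
        cls (Suc k) u \<noteq> cls (Suc k) v \<Longrightarrow> f u v = N k"
    and Wr: "W r = N r"
    and WN: "\<And>k. k < r \<Longrightarrow> W k - W (Suc k) = N k * (real (s k) - real (s (Suc k)))"
  defines "N' \<equiv> \<lambda>k. case k of 0 \<Rightarrow> 0 | Suc i \<Rightarrow> N i"
  shows "char_poly (kernel_mat vs f) = (\<Prod>j\<le>r. [:- (W j - s j * N' j), 1:] ^ mlt j)"
proof (rule char_poly_tower)
  fix u v assume u: "u \<in> set vs" and v: "v \<in> set vs"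
  let ?lam = "\<lambda>j. W j - s j * N' j"
  \<comment> \<open>The factor \<open>s j\<close> cancels the \<open>1 / s j\<close> of
    \<open>avg j\<close>; what remains is a telescoping sum of \<open>N j - N' j\<close> over the
    levels at which \<open>u\<close> and \<open>v\<close> agree.\<close>
  have dl: "?lam j - ?lam (Suc j) = s j * (N j - N' j)" if "j < r" for j
    using WN[OF that] by (simp add: N'_def algebra_simps)
  have tel: "(\<Sum>j<k. N j - N' j) = N' k" for k
    by (induction k) (auto simp: N'_def)
  have summand: "(?lam j - ?lam (Suc j)) * avg j u v = (if cls j u = cls j v then N j - N' j else 0)" if "j < r" for j
    unfolding dl[OF that] avg_def using size_pos[OF u that] by simp
  have tw: "tower ?lam r u v = ?lam r * delta u v + (\<Sum>j<r. if cls j u = cls j v then N j - N' j else 0)"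
    unfolding tower_def using summand by (intro arg_cong2[where f = "(+)"] sum.cong) auto
  show "f u v = tower ?lam r u v"
  proof (cases "u = v")
    case True
    then show ?thesis unfolding tw using diag[OF u] tel[of r] sr Wr by simp
  next
    case False
    \<comment> \<open>The deepest level at which \<open>u\<close> and \<open>v\<close> agree:
      \<open>top\<close> makes it exist, and \<open>sep\<close> keeps it below
      \<open>r\<close>.\<close>
    define k where "k = (GREATEST k. k \<le> r \<and> cls k u = cls k v)"
    have k: "k \<le> r" "cls k u = cls k v"
      using GreatestI_nat[of "\<lambda>k. k \<le> r \<and> cls k u = cls k v" 0 r] top[OF u v] unfolding k_def by auto
    have kr: "k < r" using k sep[OF u v] False by (metis le_neq_implies_less)
    have k': "cls (Suc k) u \<noteq> cls (Suc k) v"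
    proof
      assume "cls (Suc k) u = cls (Suc k) v"
      then have "Suc k \<le> k" unfolding k_def
        using kr Greatest_le_nat[of "\<lambda>k. k \<le> r \<and> cls k u = cls k v" "Suc k" r] k_def by simp
      then show False by simp
    qed
    have iff: "cls j u = cls j v \<longleftrightarrow> j \<le> k" for j
      using refine[OF u v _ k(2), of j] refine[OF u v, of "Suc k" j] k' by (meson not_less_eq_eq)
    have "(\<Sum>j<r. if cls j u = cls j v then N j - N' j else 0) = (\<Sum>j<Suc k. N j - N' j)"
    proof -
      have "{j. j < r \<and> j \<le> k} = {..<Suc k}" using kr by auto
      then show ?thesis unfolding iff by (simp add: sum.If_cases Int_def)
    qed
    also have "\<dots> = N k" using tel[of "Suc k"] by (simp add: N'_def)
    finally show ?thesis unfolding tw using lev[OF u v kr k(2) k'] False by simp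
  qed
qed

end

section \<open>Gaussian identities and the estimate of the spectral ratio\<close>

lemma q_binomial_pos: "q \<ge> 2 \<Longrightarrow> n \<le> d \<Longrightarrow> q_binomial q d n > 0"
  using q_binomial_fact[of q n d] q_fact_pos[of q d] by (metis mult_eq_0_iff neq0_conv)

text \<open>Incident pairs of a point and an n-dimensional subspace of an F_q-space of dimension d,
  counted in both ways.\<close>

lemma q_binomial_absorb:
  assumes q: "q \<ge> 2" and n: "1 \<le> n" "n \<le> d"
  shows "q_int q d * q_binomial q (d - 1) (n - 1) = q_binomial q d n * q_int q n"
proof -
  obtain n' d' where nd: "n = Suc n'" "d = Suc d'" using n by (cases n; cases d) auto
  have "(q_int q d * q_binomial q d' n') * (q_fact q n' * q_fact q (d' - n')) = q_fact q (Suc d')"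
    using q_binomial_fact[OF q, of n' d'] n nd by (simp only: q_fact_Suc mult.assoc)
  also have "\<dots> = (q_binomial q d n * q_int q n) * (q_fact q n' * q_fact q (d' - n'))"
    using q_binomial_fact[OF q, of n d] n nd q_fact_Suc[of q n'] by (simp add: mult_ac)
  finally show ?thesis using q_fact_pos[OF q, of n'] q_fact_pos[OF q, of "d' - n'"] nd by simp
qed

lemma q_binomial_pred:
  assumes q: "q \<ge> 2" and n: "n \<le> d"
  shows "q_int q (Suc d) * q_binomial q d n = q_int q (Suc d - n) * q_binomial q (Suc d) n"
proof -
  have "(q_int q (Suc d) * q_binomial q d n) * (q_fact q n * q_fact q (d - n)) = q_fact q (Suc d)"
    using q_binomial_fact[OF q, of n d] n by (simp add: q_fact_Suc mult_ac)
  also have "\<dots> = (q_int q (Suc d - n) * q_binomial q (Suc d) n) * (q_fact q n * q_fact q (d - n))"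
    using q_binomial_fact[OF q, of n "Suc d"] n q_fact_Suc[of q "d - n"] by (simp add: Suc_diff_le mult_ac)
  finally show ?thesis using q_fact_pos[OF q, of n] q_fact_pos[OF q, of "d - n"] by simp
qed

text \<open>Clears the denominators \<open>q - 1\<close>. It turns the binomial with
  \<open>d - 1\<close>, which comes from the degree of a line, into the one with
  \<open>d - 2\<close> in the nontrivial eigenvalues.\<close>

lemma q_binomial_pred_real:
  assumes q: "q \<ge> 2" and n: "2 \<le> n" "n \<le> d - 1"
  shows "real (q_binomial q (d - 2) (n - 1)) * (real q ^ (d - 1) - 1)
       = real (q_binomial q (d - 1) (n - 1)) * (real q ^ (d - n) - 1)"
proof -
  have e: "Suc (d - 2) = d - 1" "d - 1 - (n - 1) = d - n" using n by auto
  have "n - 1 \<le> d - 2" using n by simp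
  then have "q_int q (d - 1) * q_binomial q (d - 2) (n - 1) = q_int q (d - n) * q_binomial q (d - 1) (n - 1)"
    using q_binomial_pred[OF q, of "n - 1" "d - 2"] unfolding e by blast
  then have "real (q_int q (d - 1)) * q_binomial q (d - 2) (n - 1) = real (q_int q (d - n)) * q_binomial q (d - 1) (n - 1)"
    by (simp only: of_nat_mult[symmetric])
  then have "(real q - 1) * real (q_int q (d - 1)) * q_binomial q (d - 2) (n - 1)
     = (real q - 1) * real (q_int q (d - n)) * q_binomial q (d - 1) (n - 1)" by simp
  moreover have "(real q - 1) * real (q_int q m) = real q ^ m - 1" for m
    using q by (simp add: q_int_exact)
  ultimately show ?thesis by (simp only: mult.commute)
qed

text \<open>
  Both sides of the estimate for the spectral expansion come from
  \<open>\<rho>\<^sup>2 q^(n-1) = (q^(d-n) - 1) q^(n-1) / (q^(d-1) - 1) * (q - 1) q^(n-1) / (q^n - 1)\<close>,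
  where each of the two factors lies between \<open>1 - 1/q\<close> and \<open>1\<close>.
\<close>

lemma expansion_ratio_bounds:
  fixes Q :: real
  assumes Q: "Q \<ge> 2" and n: "2 \<le> n" "n \<le> d - 1"
  defines "R \<equiv> (Q ^ (d - n) - 1) / (Q ^ (d - 1) - 1) * ((Q - 1) / (Q ^ n - 1)) * Q ^ (n - 1)"
  shows "(1 - 1 / Q)\<^sup>2 \<le> R * Q ^ (n - 1)" "R * Q ^ (n - 1) \<le> 1"
proof -
  define a where "a = Q ^ (n - 1)"
  define b where "b = Q ^ (d - n)"
  have ab: "Q ^ (d - 1) = a * b" unfolding a_def b_def using n by (simp add: power_add[symmetric])
  have an: "Q ^ n = Q * a" unfolding a_def using n by (cases n) auto
  have a: "a \<ge> Q" unfolding a_def using Q n power_increasing[of 1 "n - 1" Q] by simp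
  have b: "b \<ge> Q" unfolding b_def using Q n power_increasing[of 1 "d - n" Q] by simp
  have ab1: "a * b > 1" using a b Q mult_mono[of 2 a 2 b] by simp
  have Qa1: "Q * a > 1" using a Q mult_mono[of 2 Q 2 a] by simp
  define u where "u = (b - 1) * a / (a * b - 1)"
  define v where "v = (Q - 1) * a / (Q * a - 1)"
  have R: "R * Q ^ (n - 1) = u * v"
    unfolding R_def ab an b_def[symmetric] a_def[symmetric] u_def v_def by simp
  have u1: "u \<le> 1" unfolding u_def using ab1 a Q by (simp add: divide_le_eq algebra_simps)
  have v1: "v \<le> 1" unfolding v_def using Qa1 a Q by (simp add: divide_le_eq algebra_simps)
  have lo: "0 \<le> 1 - 1 / Q" using Q by simp
  \<comment> \<open>Replacing the denominator \<open>a b - 1\<close> by \<open>a b\<close> lowers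
    the quotient to \<open>1 - 1/b\<close>, and \<open>b\<close> is at least
    \<open>Q\<close>.\<close>
  have u2: "1 - 1 / Q \<le> u"
  proof -
    have "1 - 1 / Q \<le> 1 - 1 / b" using b Q by (simp add: frac_le)
    also have "\<dots> = (b - 1) * a / (a * b)" using a b Q by (simp add: field_simps)
    also have "\<dots> \<le> u" unfolding u_def using ab1 a b Q by (intro divide_left_mono) auto
    finally show ?thesis .
  qed
  have v2: "1 - 1 / Q \<le> v"
  proof -
    have "1 - 1 / Q = (Q - 1) * a / (Q * a)" using a Q by (simp add: field_simps)
    also have "\<dots> \<le> v" unfolding v_def using Qa1 a Q by (intro divide_left_mono) auto
    finally show ?thesis .
  qed
  show "(1 - 1 / Q)\<^sup>2 \<le> R * Q ^ (n - 1)"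
    unfolding R power2_eq_square using u2 v2 lo by (intro mult_mono) auto
  show "R * Q ^ (n - 1) \<le> 1"
    unfolding R using u1 v1 u2 v2 lo mult_mono[of u 1 v 1] by simp
qed

section \<open>The graph of lines and free submodules\<close>

lemma free_mod_simps:
  "carrier (free_mod S d) = {..<d} \<rightarrow>\<^sub>E carrier S"
  "\<zero>\<^bsub>free_mod S d\<^esub> = restrict (\<lambda>_. \<zero>\<^bsub>S\<^esub>) {..<d}"
  "f \<oplus>\<^bsub>free_mod S d\<^esub> g = restrict (\<lambda>i. f i \<oplus>\<^bsub>S\<^esub> g i) {..<d}"
  "c \<odot>\<^bsub>free_mod S d\<^esub> f = restrict (\<lambda>i. c \<otimes>\<^bsub>S\<^esub> f i) {..<d}"
  if "ring S"
  using that by (simp_all add: free_mod_def ring.func_space_def)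

context finite_chain_ring
begin

definition unit_vec :: "nat \<Rightarrow> nat \<Rightarrow> nat \<Rightarrow> 'a" where
  "unit_vec d i = restrict (\<lambda>j. if j = i then \<one> else \<zero>) {..<d}"

lemma free_mod_chain_module: "chain_module R p r (free_mod R d)"
  unfolding chain_module_def free_mod_def using func_space_is_module finite_chain_ring_axioms by auto

lemma free_mod_free_chain_module:
  shows "free_chain_module R p r (free_mod R d) (unit_vec d ` {..<d})"
    and "card (unit_vec d ` {..<d}) = d"
proof -
  let ?M = "free_mod R d"
  interpret M: chain_module R p r ?M by (rule free_mod_chain_module)
  note simps = free_mod_simps[OF ring_axioms]
  have uc: "unit_vec d i \<in> carrier ?M" for i by (auto simp: simps unit_vec_def)
  have inj: "inj_on (unit_vec d) {..<d}"
  proof (rule inj_onI)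
    fix i j assume ij: "i \<in> {..<d}" "j \<in> {..<d}" "unit_vec d i = unit_vec d j"
    then have "unit_vec d i i = unit_vec d j i" by simp
    then show "i = j" using ij one_neq_zero by (auto simp: unit_vec_def split: if_splits)
  qed
  then show cardE: "card (unit_vec d ` {..<d}) = d" by (simp add: card_image)
  \<comment> \<open>Stated for every subset of the indices so that the induction can add one unit
    vector at a time.\<close>
  have lc: "M.lincomb a (unit_vec d ` I) = restrict (\<lambda>j. if j \<in> I then a (unit_vec d j) else \<zero>) {..<d}"
    if "finite I" "I \<subseteq> {..<d}" "a \<in> unit_vec d ` I \<rightarrow> carrier R" for a I
    using that
  proof (induction I rule: finite_induct)
    case empty
    then show ?case by (simp add: M.lincomb_def simps)
  next
    case (insert i I)
    have ni: "unit_vec d i \<notin> unit_vec d ` I"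
      using inj_on_image_mem_iff[OF inj, of i I] insert by auto
    have ac: "a (unit_vec d j) \<in> carrier R" if "j \<in> insert i I" for j using insert(5) that by auto
    have "M.lincomb a (insert (unit_vec d i) (unit_vec d ` I))
      = a (unit_vec d i) \<odot>\<^bsub>?M\<^esub> unit_vec d i \<oplus>\<^bsub>?M\<^esub> M.lincomb a (unit_vec d ` I)"
      using insert uc ni by (intro M.lincomb_insert_eq) auto
    also have "M.lincomb a (unit_vec d ` I) = restrict (\<lambda>j. if j \<in> I then a (unit_vec d j) else \<zero>) {..<d}"
      using insert by auto
    finally have eq: "M.lincomb a (unit_vec d ` insert i I)
      = a (unit_vec d i) \<odot>\<^bsub>?M\<^esub> unit_vec d i \<oplus>\<^bsub>?M\<^esub>
        restrict (\<lambda>j. if j \<in> I then a (unit_vec d j) else \<zero>) {..<d}" unfolding image_insert .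
    show ?case
    proof (rule ext)
      fix j
      show "M.lincomb a (unit_vec d ` insert i I) j
          = restrict (\<lambda>j. if j \<in> insert i I then a (unit_vec d j) else \<zero>) {..<d} j"
      proof (cases "j < d")
        case True
        then have "unit_vec d i j = (if j = i then \<one> else \<zero>)" by (simp add: unit_vec_def)
        then show ?thesis unfolding eq using True insert(2) ac by (simp add: simps)
      next
        case False
        then show ?thesis unfolding eq by (simp add: simps)
      qed
    qed
  qed
  have E: "M.indep (unit_vec d ` {..<d})"
  proof (rule M.indepI)
    fix a v assume a: "a \<in> unit_vec d ` {..<d} \<rightarrow> carrier R" "M.lincomb a (unit_vec d ` {..<d}) = \<zero>\<^bsub>?M\<^esub>"
      and v: "v \<in> unit_vec d ` {..<d}"
    then obtain i where i: "i < d" "v = unit_vec d i" by auto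
    have "restrict (\<lambda>j. if j \<in> {..<d} then a (unit_vec d j) else \<zero>) {..<d} i = \<zero>\<^bsub>?M\<^esub> i"
      using lc[of "{..<d}" a] a by simp
    then show "a v = \<zero>" using i by (simp add: simps)
  qed (use uc in auto)
  \<comment> \<open>Spanning follows by counting: an independent set of \<open>d\<close> vectors
    spans \<open>q^(r d)\<close> elements, the order of the whole module.\<close>
  have "M.span (unit_vec d ` {..<d}) = carrier ?M"
  proof (rule card_subset_eq)
    show "finite (carrier ?M)" using finite_carrier by (simp add: simps finite_PiE)
    show "M.span (unit_vec d ` {..<d}) \<subseteq> carrier ?M" using uc by (intro M.span_closed) auto
    show "card (M.span (unit_vec d ` {..<d})) = card (carrier ?M)"
      using M.card_span[OF E] cardE card_carrier by (simp add: simps card_PiE power_mult)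
  qed
  then show "free_chain_module R p r ?M (unit_vec d ` {..<d})"
    using E by unfold_locales
qed

end

context free_chain_module
begin

lemma free_submodule_of_rank_iff:
  "free_submodule_of_rank R M m V \<longleftrightarrow> V \<in> free_subs m (carrier M)"
  using span_closed unfolding free_submodule_of_rank_def free_subs_def indep_def by blast

lemma card_free_sub:
  assumes "V \<in> free_subs m W"
  shows "card V = q ^ (r * m)" "finite V"
  using free_subsE[OF assms] card_span span_finite indepD by metis+

text \<open>The rank can be read off from the order \<open>q^(r m)\<close>, because q is at least 2
  and r at least 1.\<close>

lemma free_sub_card_eq:
  assumes "V \<in> free_subs m W" "V \<in> free_subs m' W'"
  shows "m = m'"
proof -
  have "q ^ (r * m) = q ^ (r * m')" using card_free_sub assms by metis
  then show ?thesis using residue_order_ge_2 length_pos by (auto simp: power_inject_exp)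
qed

lemma free_subs_subset_eq:
  assumes "V \<in> free_subs m W" "V' \<in> free_subs m W'" "V \<subseteq> V'"
  shows "V = V'"
  using card_subset_eq[OF card_free_sub(2)[OF assms(2)] assms(3)] card_free_sub(1)[OF assms(1)]
    card_free_sub(1)[OF assms(2)] by simp

lemma free_subs_subset_rank:
  assumes "V \<in> free_subs m W" "V' \<in> free_subs m' W'" "V \<subseteq> V'"
  shows "m \<le> m'"
proof -
  have "q ^ (r * m) \<le> q ^ (r * m')"
    using card_mono[OF card_free_sub(2)[OF assms(2)] assms(3)] card_free_sub(1)[OF assms(1)]
      card_free_sub(1)[OF assms(2)] by simp
  then have "r * m \<le> r * m'" using residue_order_ge_2 by (simp add: power_le_imp_le_exp)
  then show ?thesis using length_pos by simp
qed

lemma carrier_free_sub: "carrier M \<in> free_subs (card E) (carrier M)"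
  using basis unfolding free_subs_def by blast

lemma zero_free_sub: "{\<zero>\<^bsub>M\<^esub>} \<in> free_subs 0 (carrier M)"
  using indep_empty span_empty_eq unfolding free_subs_def by (auto intro!: exI[of _ "{}"])

end

text \<open>Distinct free submodules of equal rank are never nested, by their orders, so edges join
  lines to submodules of rank \<open>n\<close> only. The bounds on \<open>n\<close> make the two
  ranks different and all these submodules proper and nonzero.\<close>

lemma (in finite_chain_ring) X1n_graph:
  fixes d n :: nat
  assumes n: "2 \<le> n" "n \<le> d - 1"
  defines "M \<equiv> free_mod R d"
  defines "L \<equiv> free_chain_module.free_subs R M 1 (carrier M)"
    and "Xn \<equiv> free_chain_module.free_subs R M n (carrier M)"
  shows "X1n_vertices R d n = L \<union> Xn" "L \<inter> Xn = {}"
    "\<And>u v. fr_proj_adj R d u v = fr_proj_adj R d v u"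
    "\<And>u v. u \<in> L \<Longrightarrow> v \<in> L \<Longrightarrow> \<not> fr_proj_adj R d u v"
    "\<And>u v. u \<in> Xn \<Longrightarrow> v \<in> Xn \<Longrightarrow> \<not> fr_proj_adj R d u v"
    "\<And>u v. u \<in> L \<Longrightarrow> v \<in> Xn \<Longrightarrow> fr_proj_adj R d u v \<longleftrightarrow> u \<subseteq> v"
proof -
  let ?E = "unit_vec d ` {..<d}"
  interpret M: free_chain_module R p r M ?E unfolding M_def by (rule free_mod_free_chain_module)
  have cE: "card ?E = d" by (rule free_mod_free_chain_module)
  have vert: "V \<in> fr_proj_vertices R d" if V: "V \<in> M.free_subs m (carrier M)" "1 \<le> m" "m < d" for V m
  proof -
    have "V \<noteq> {\<zero>\<^bsub>M\<^esub>}" using M.free_sub_card_eq[OF V(1)] M.zero_free_sub V(2) by fastforce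
    moreover have "V \<noteq> carrier M" using M.free_sub_card_eq[OF V(1)] M.carrier_free_sub V(3) cE by fastforce
    ultimately show ?thesis
      using V(1) M.free_submodule_of_rank_iff unfolding fr_proj_vertices_def M_def by blast
  qed
  have L: "L \<subseteq> fr_proj_vertices R d" and Xn: "Xn \<subseteq> fr_proj_vertices R d"
    using vert[of _ 1] vert[of _ n] n unfolding L_def Xn_def by auto
  show "X1n_vertices R d n = L \<union> Xn"
    using L Xn M.free_submodule_of_rank_iff unfolding X1n_vertices_def L_def Xn_def M_def by blast
  show disj: "L \<inter> Xn = {}" using M.free_sub_card_eq[of _ 1 _ n] n unfolding L_def Xn_def by fastforce
  show "fr_proj_adj R d u v = fr_proj_adj R d v u" for u v
    unfolding fr_proj_adj_def by (auto simp: insert_commute)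
  have adjD: "u \<noteq> v \<and> (u \<subseteq> v \<or> v \<subseteq> u)" if "fr_proj_adj R d u v" for u v
    using that unfolding fr_proj_adj_def fr_proj_cells_def by auto
  show "\<not> fr_proj_adj R d u v" if "u \<in> L" "v \<in> L" for u v
    using that adjD[of u v] M.free_subs_subset_eq unfolding L_def by metis
  show "\<not> fr_proj_adj R d u v" if "u \<in> Xn" "v \<in> Xn" for u v
    using that adjD[of u v] M.free_subs_subset_eq unfolding Xn_def by metis
  show "fr_proj_adj R d u v \<longleftrightarrow> u \<subseteq> v" if uv: "u \<in> L" "v \<in> Xn" for u v
  proof
    assume "fr_proj_adj R d u v"
    moreover have "\<not> v \<subseteq> u" using M.free_subs_subset_rank[of v n _ u 1] uv n unfolding L_def Xn_def by fastforce
    ultimately show "u \<subseteq> v" using adjD by blast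
  next
    assume "u \<subseteq> v"
    moreover have "u \<noteq> v" using uv disj by blast
    ultimately show "fr_proj_adj R d u v"
      using uv L Xn unfolding fr_proj_adj_def fr_proj_cells_def by auto
  qed
qed

text \<open>Only the two signs of the top eigenvalue are discarded. As \<open>lam 1 < lam 0\<close>,
  the root of \<open>lam 1\<close> survives, and its positive multiplicity puts it into the
  spectrum.\<close>

lemma spectral_expansion_pm:
  fixes lam :: "nat \<Rightarrow> real"
  assumes Sp: "Sp = (\<Sum>j\<le>r. pm_mset (mlt j) (sqrt (lam j))) + replicate_mset z 0"
    and r: "1 \<le> r" and mlt: "mlt 0 > 0" "mlt 1 > 0"
    and pos: "\<And>j. j \<le> r \<Longrightarrow> lam j > 0"
    and top: "lam 1 < lam 0" and second: "\<And>j. 1 \<le> j \<Longrightarrow> j \<le> r \<Longrightarrow> lam j \<le> lam 1"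
  shows "spectral_expansion Sp = sqrt (lam 1 / lam 0)"
proof -
  let ?s = "\<lambda>j. sqrt (lam j)"
  have mem: "x = 0 \<or> (\<exists>j\<le>r. x = ?s j \<or> x = - ?s j)" if "x \<in># Sp" for x
    using that unfolding Sp by (auto simp: set_mset_sum pm_mset_def split: if_splits)
  have in_sum: "?s j \<in># Sp" if "j \<le> r" "mlt j > 0" for j
  proof -
    have "?s j \<in># pm_mset (mlt j) (?s j)" using that(2) by (simp add: pm_mset_def)
    then show ?thesis using that(1) unfolding Sp by (auto simp: set_mset_sum)
  qed
  have le: "lam j \<le> lam 0" if "j \<le> r" for j
    using second[of j] top that by (cases "j = 0") auto
  have s0: "?s 0 > 0" "?s 1 > 0" "?s 1 < ?s 0" using pos[of 0] pos[of 1] r top by auto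
  have perron: "perron_eigenvalue Sp = ?s 0"
    unfolding perron_eigenvalue_def
  proof (rule Max_eqI)
    show "?s 0 \<in> set_mset Sp" using in_sum[of 0] mlt by simp
    fix x assume "x \<in> set_mset Sp"
    then consider "x = 0" | j where "j \<le> r" "x = ?s j \<or> x = - ?s j" using mem by blast
    then show "x \<le> ?s 0"
    proof cases
      case 2
      have "?s j \<le> ?s 0" "0 \<le> ?s j" using le[OF 2(1)] pos[OF 2(1)] by auto
      then show ?thesis using 2(2) by linarith
    qed (use s0 in simp)
  qed simp
  let ?A = "{x / ?s 0 | x. x \<in># Sp \<and> x \<noteq> ?s 0 \<and> x \<noteq> - ?s 0}"
  have "Max ?A = ?s 1 / ?s 0"
  proof (rule Max_eqI)
    have "?A \<subseteq> (\<lambda>x. x / ?s 0) ` set_mset Sp" by blast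
    then show "finite ?A" by (rule finite_subset) simp
    have "?s 1 \<in># Sp" using in_sum[of 1] r mlt by simp
    moreover have "?s 1 \<noteq> ?s 0" "?s 1 \<noteq> - ?s 0" using s0 by linarith+
    ultimately show "?s 1 / ?s 0 \<in> ?A" by blast
    fix y assume "y \<in> ?A"
    then obtain x where x: "y = x / ?s 0" "x \<in># Sp" "x \<noteq> ?s 0" "x \<noteq> - ?s 0" by blast
    consider "x = 0" | j where "j \<le> r" "x = ?s j \<or> x = - ?s j" using mem[OF x(2)] by blast
    then have "x \<le> ?s 1"
    proof cases
      case 2
      have "j \<noteq> 0" using 2(2) x(3,4) by metis
      then have "?s j \<le> ?s 1" "0 \<le> ?s j" using second[of j] pos[of j] 2(1) by auto
      then show ?thesis using 2(2) by linarith
    qed (use s0 in simp)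
    then show "y \<le> ?s 1 / ?s 0" using x(1) s0 by (simp add: divide_right_mono)
  qed
  then show ?thesis unfolding spectral_expansion_def perron by (simp add: real_sqrt_divide)
qed

text \<open>Here \<open>\<alpha>\<close> and \<open>\<beta>\<close> are the growth factors of row
  sum and class size from level \<open>j\<close> to the coarser level \<open>j - 1\<close>, and the
  quotient is the joint degree \<open>N (j-1)\<close>. So the eigenvalue is
  \<open>W j * (\<beta> - \<alpha>) / (\<beta> - 1)\<close>.\<close>

lemma eigenvalue_from_sums:
  fixes Wj sj \<alpha> \<beta> c :: real
  assumes "sj > 0" "\<beta> > 1" "(\<beta> - \<alpha>) = c * (\<beta> - 1)"
  shows "Wj - sj * ((Wj * \<alpha> - Wj) / (sj * \<beta> - sj)) = Wj * c"
proof -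
  have "sj * ((Wj * \<alpha> - Wj) / (sj * \<beta> - sj)) = Wj * ((\<alpha> - 1) / (\<beta> - 1))"
  proof -
    have "sj * \<beta> - sj = sj * (\<beta> - 1)" "Wj * \<alpha> - Wj = Wj * (\<alpha> - 1)" by (simp_all add: algebra_simps)
    then show ?thesis using assms(1) by simp
  qed
  moreover have "(\<alpha> - 1) / (\<beta> - 1) = 1 - c"
    using assms(2,3) by (simp add: field_simps)
  ultimately show ?thesis by (simp add: algebra_simps)
qed

section \<open>The spectrum of the graph over a finite chain ring\<close>

context finite_chain_ring
begin

text \<open>The index \<open>j\<close> is the level: its eigenfunctions on lines depend on the line
  modulo \<open>p^j\<close> and sum to zero over the classes modulo \<open>p^(j-1)\<close>. From
  \<open>j = 2\<close> on, the parameter \<open>k\<close> of the final list is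
  \<open>r - j\<close>.\<close>

lemma X1n_spectrum:
  fixes d n :: nat
  assumes n: "2 \<le> n" "n \<le> d - 1"
  defines "q \<equiv> residue_order"
  defines "lam \<equiv> \<lambda>j. if j = 0
      then real (q_binomial q (d - 1) (n - 1) * q_int q n * q ^ ((r - 1) * (n - 1) * (d - n + 1)))
      else real (q_binomial q (d - 2) (n - 1) * q ^ ((n - 1) * (r - 1) * (d - n) + (r - j + 1) * (n - 1)))"
  defines "mlt \<equiv> \<lambda>j. if j = 0 then 1 else if j = 1 then q_int q d - 1
      else q ^ ((j - 2) * (d - 1)) * (q ^ (d - 1) - 1) * q_int q d"
  shows "adjacency_spectrum (X1n_vertices R d n) (fr_proj_adj R d)
    = (\<Sum>j\<le>r. pm_mset (mlt j) (sqrt (lam j)))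
      + replicate_mset (q_binomial q d n * q ^ ((r - 1) * n * (d - n)) - q_int q d * q ^ ((d - 1) * (r - 1))) 0"
proof -
  define M where "M = free_mod R d"
  let ?E = "unit_vec d ` {..<d}"
  interpret M: free_chain_module R p r M ?E unfolding M_def by (rule free_mod_free_chain_module)
  have cE: "card ?E = d" by (rule free_mod_free_chain_module)
  define L where "L = M.free_subs 1 (carrier M)"
  define Xn where "Xn = M.free_subs n (carrier M)"
  note G = X1n_graph[OF n, folded M_def, folded L_def Xn_def]
  have q2: "q \<ge> 2" unfolding q_def by (rule residue_order_ge_2)
  have d3: "3 \<le> d" using n by simp
  have fin: "finite L" "finite Xn" unfolding L_def Xn_def using M.finite_free_subs[OF M.finite_M] by auto
  have cL: "card L = q_int q d * q ^ ((r - 1) * (d - 1))"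
    using M.card_lines[OF M.basis(1)] M.basis(2) cE d3 unfolding L_def q_def by simp
  have cX: "card Xn = q_binomial q d n * q ^ ((r - 1) * n * (d - n))"
    using M.card_free_subs[OF M.basis(1), of n] M.basis(2) cE n unfolding Xn_def q_def by simp
  have qd: "q_int q d \<ge> 2" "q_int q n \<ge> 1"
    using q2 d3 n q_int_add[OF q2, of 1 "d - 1"] q_int_pos[OF q2, of "d - 1"] q_int_pos[OF q2, of n]
    by (simp_all add: q_int_def)
  have Lpos: "card L > 0" using cL qd q2 by simp
  \<comment> \<open>At level 0 all lines are congruent; \<open>card_line_class\<close> covers the
    levels from 1 on.\<close>
  define s where "s j = (if j = 0 then card L else q ^ ((r - j) * (d - 1)))" for j
  have cls: "card {l' \<in> L. M.thick j l' = M.thick j l} = s j" if l: "l \<in> L" and j: "j \<le> r" for l j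
  proof (cases "j = 0")
    case True
    have "M.thick 0 l' = carrier M" if l': "l' \<in> L" for l'
    proof -
      obtain x where x: "l' = M.span {x}" "x \<in> carrier M" using M.free_subs_1E l' unfolding L_def by metis
      then show ?thesis using M.thick_0[OF M.span_closed, of "{x}"] M.span_zero[of "{x}"] by simp
    qed
    then have "{l' \<in> L. M.thick j l' = M.thick j l} = L" using True l by auto
    then show ?thesis using True by (simp add: s_def)
  next
    case False
    then show ?thesis
      using M.card_line_class[OF M.basis(1), of l j] l j M.basis(2) cE unfolding L_def s_def q_def by simp
  qed
  obtain ls where ls: "distinct ls" "set ls = L" using finite_distinct_list[OF fin(1)] by blast
  have len: "length ls = card L" using distinct_card[OF ls(1)] ls(2) by simp
  have LM: "l \<subseteq> carrier M" "l \<noteq> {}" if l: "l \<in> L" for l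
  proof -
    obtain x where x: "l = M.span {x}" "x \<in> carrier M" using M.free_subs_1E l unfolding L_def by metis
    then show "l \<subseteq> carrier M" "l \<noteq> {}" using M.span_closed[of "{x}"] M.span_zero[of "{x}"] by auto
  qed
  interpret H: hierarchy ls M.thick r s
    using ls LM M.thick_eq_mono cls by unfold_locales (auto intro: M.thick_eq_mono)
  obtain l0 where l0: "l0 \<in> L" using Lpos by fastforce
  define D where "D = card {V \<in> Xn. l0 \<subseteq> V}"
  have deg: "card {V \<in> Xn. l \<subseteq> V} = D" if "l \<in> L" for l
    using M.degree_const[of l l0 n] that l0 unfolding D_def L_def Xn_def by simp
  \<comment> \<open>The number of lines in one submodule of rank \<open>n\<close> that are congruent
    modulo \<open>p^k\<close> to a given line of it; so \<open>D * w k\<close> is the row sum over a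
    class.\<close>
  define w where "w k = (if k = 0 then q_int q n * q ^ ((r - 1) * (n - 1)) else q ^ ((r - k) * (n - 1)))" for k
  define jt where "jt u v = card {V \<in> Xn. u \<subseteq> V \<and> v \<subseteq> V}" for u v
  have jsum: "(\<Sum>v\<in>{v \<in> L. M.thick k v = M.thick k u}. jt u v) = D * w k" if "u \<in> L" "k \<le> r" for u k
    using M.joint_degree_sum[of u k n] deg[OF that(1)] that n
    unfolding jt_def w_def L_def Xn_def q_def by simp
  have Dform: "D = q_binomial q (d - 1) (n - 1) * q ^ ((r - 1) * (n - 1) * (d - n))"
  proof -
    have "card L * D = card Xn * (q_int q n * q ^ ((r - 1) * (n - 1)))"
      using M.degree_sum[of l0 n] l0 n unfolding D_def L_def Xn_def q_def by simp
    also have "\<dots> = (q_binomial q d n * q_int q n) * q ^ ((r - 1) * n * (d - n) + (r - 1) * (n - 1))"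
      unfolding cX by (simp only: power_add mult_ac)
    \<comment> \<open>This is \<open>n (d-n) + (n-1) = (d-1) + (n-1) (d-n)\<close> times
      \<open>r - 1\<close>; it splits off the power of q in \<open>card L\<close>.\<close>
    also have "(r - 1) * n * (d - n) + (r - 1) * (n - 1) = (r - 1) * (d - 1) + (r - 1) * (n - 1) * (d - n)"
    proof -
      obtain n' where n': "n = Suc n'" using n by (cases n) auto
      obtain e where e: "d = n + e" using n by (metis diff_le_self le_Suc_ex le_trans)
      have "n * (d - n) + (n - 1) = (d - 1) + (n - 1) * (d - n)" unfolding e n' by simp
      then have "(r - 1) * (n * (d - n) + (n - 1)) = (r - 1) * ((d - 1) + (n - 1) * (d - n))" by (rule arg_cong)
      then show ?thesis by (simp only: distrib_left mult.assoc)
    qed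
    also have "q_binomial q d n * q_int q n = q_int q d * q_binomial q (d - 1) (n - 1)"
      using q_binomial_absorb[OF q2, of n d] n by simp
    finally have "card L * D = card L * (q_binomial q (d - 1) (n - 1) * q ^ ((r - 1) * (n - 1) * (d - n)))"
      unfolding cL by (simp only: power_add mult_ac)
    then show ?thesis using Lpos by simp
  qed
  define Q where "Q = real q"
  have Q2: "Q \<ge> 2" using q2 by (simp add: Q_def)
  define a b where "a = Q ^ (n - 1)" and "b = Q ^ (d - 1)"
  have ab: "a > 1" "b > 1" unfolding a_def b_def using Q2 n d3 by (auto intro!: one_less_power)
  have sQ: "real (s (Suc k)) = b ^ (r - Suc k)" for k
    by (simp add: s_def b_def Q_def power_mult mult.commute)
  have wQ: "real (w (Suc k)) = a ^ (r - Suc k)" for k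
    by (simp add: w_def a_def Q_def power_mult mult.commute)
  \<comment> \<open>From level 0 to level 1 the class size drops by the number of lines over the
    residue field, afterwards by the number \<open>b\<close> of lifts of a line by one
    level.\<close>
  have s_ratio: "real (s k) = real (s (Suc k)) * (if k = 0 then real (q_int q d) else b)" if k: "k < r" for k
  proof (cases k)
    case 0
    then show ?thesis by (simp add: s_def cL mult.commute)
  next
    case (Suc i)
    have "r - Suc i = Suc (r - Suc k)" using k Suc by simp
    then show ?thesis unfolding Suc sQ using Suc by (simp add: mult.commute)
  qed
  have w_ratio: "real (w k) = real (w (Suc k)) * (if k = 0 then real (q_int q n) else a)" if k: "k < r" for k
  proof (cases k)
    case 0
    then show ?thesis by (simp add: w_def mult.commute)
  next
    case (Suc i)
    have "r - Suc i = Suc (r - Suc k)" using k Suc by simp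
    then show ?thesis unfolding Suc wQ using Suc by (simp add: mult.commute)
  qed
  have s_pos: "real (s (Suc k)) > 0" for k using sQ ab by simp
  have beta: "(if k = 0 then real (q_int q d) else b) > 1" for k :: nat using qd ab by simp
  have s_less: "real (s (Suc k)) < real (s k)" if "k < r" for k
    unfolding s_ratio[OF that] using s_pos[of k] beta[of k] by simp
  define W where "W k = real (D * w k)" for k
  \<comment> \<open>For \<open>k < r\<close> the joint degree is forced by the difference of two row
    sums; at \<open>k = r\<close> the two lines coincide and it is the degree
    \<open>D\<close>.\<close>
  define N where "N k = (if k < r then (W k - W (Suc k)) / (real (s k) - real (s (Suc k))) else real D)" for k
  have jt_lev: "real (jt u v) = N k"
    if u: "u \<in> L" and v: "v \<in> L" and k: "k < r" and uv: "M.thick k u = M.thick k v"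
      "M.thick (Suc k) u \<noteq> M.thick (Suc k) v" for u v k
  proof -
    let ?C = "\<lambda>k. {l' \<in> L. M.thick k l' = M.thick k u}"
    have sub: "?C (Suc k) \<subseteq> ?C k" using M.thick_eq_mono[of k "Suc k"] LM u by auto
    have "jt u l' = jt u v" if "l' \<in> ?C k - ?C (Suc k)" for l'
      unfolding jt_def Xn_def
      using that u v uv by (intro M.joint_degree_const[of u l' k u v]) (auto simp: L_def)
    then have "(\<Sum>l'\<in>?C k - ?C (Suc k). jt u l') = card (?C k - ?C (Suc k)) * jt u v" by simp
    moreover have "card (?C k - ?C (Suc k)) = s k - s (Suc k)"
      using card_Diff_subset[OF _ sub] cls[OF u] k fin(1) finite_subset[OF sub] by simp
    moreover have "(\<Sum>l'\<in>?C k. jt u l') = (\<Sum>l'\<in>?C k - ?C (Suc k). jt u l') + (\<Sum>l'\<in>?C (Suc k). jt u l')"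
      using sum.subset_diff[OF sub] fin(1) by simp
    ultimately have "D * w k = (s k - s (Suc k)) * jt u v + D * w (Suc k)"
      using jsum[OF u] k by simp
    then have "real (D * w k) = (real (s k) - real (s (Suc k))) * real (jt u v) + real (D * w (Suc k))"
      using s_less[OF k] by (simp add: of_nat_diff)
    then have "(real (s k) - real (s (Suc k))) * real (jt u v) = W k - W (Suc k)" by (simp add: W_def)
    then show ?thesis using s_less[OF k] k unfolding N_def by (simp add: field_simps)
  qed
  define f where "f u v = real (card {V \<in> Xn. fr_proj_adj R d u V \<and> fr_proj_adj R d v V})" for u v
  have f: "f u v = real (jt u v)" if "u \<in> L" "v \<in> L" for u v
  proof -
    have "{V \<in> Xn. fr_proj_adj R d u V \<and> fr_proj_adj R d v V} = {V \<in> Xn. u \<subseteq> V \<and> v \<subseteq> V}"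
      using G(6)[OF that(1)] G(6)[OF that(2)] by blast
    then show ?thesis by (simp add: f_def jt_def)
  qed
  let ?N' = "\<lambda>k. case k of 0 \<Rightarrow> 0 | Suc i \<Rightarrow> N i"
  have cp: "char_poly (kernel_mat ls f) = (\<Prod>j\<le>r. [:- (W j - s j * ?N' j), 1:] ^ H.mlt j)"
  proof (rule H.char_poly_hierarchy)
    show "u = v" if "u \<in> set ls" "v \<in> set ls" "M.thick r u = M.thick r v" for u v
      using that M.thick_r LM ls(2) by metis
    show "M.thick 0 u = M.thick 0 v" if "u \<in> set ls" "v \<in> set ls" for u v
    proof -
      have "card {l' \<in> L. M.thick 0 l' = M.thick 0 u} = card L" using cls[of u 0] that ls(2) by (simp add: s_def)
      then have "{l' \<in> L. M.thick 0 l' = M.thick 0 u} = L" using fin(1) by (intro card_subset_eq) auto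
      then show ?thesis using that ls(2) by blast
    qed
    show "s r = 1" using length_pos by (simp add: s_def)
    show "f u u = N r" if "u \<in> set ls" for u
      using f[of u u] deg[of u] that ls(2) by (simp add: jt_def N_def)
    show "f u v = N k" if "u \<in> set ls" "v \<in> set ls" "k < r" "M.thick k u = M.thick k v"
      "M.thick (Suc k) u \<noteq> M.thick (Suc k) v" for u v k
      using f[of u v] jt_lev[of u v k] that ls(2) by simp
    show "W r = N r" using length_pos by (simp add: W_def N_def w_def)
    show "W k - W (Suc k) = N k * (real (s k) - real (s (Suc k)))" if "k < r" for k
      using s_less[OF that] that by (simp add: N_def)
  qed
  have lam_eq: "W j - s j * ?N' j = lam j" if j: "j \<le> r" for j
  proof (cases j)
    case 0
    have "D * w 0 = q_binomial q (d - 1) (n - 1) * q_int q n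
        * (q ^ ((r - 1) * (n - 1) * (d - n)) * q ^ ((r - 1) * (n - 1)))"
      unfolding Dform w_def by (simp only: refl if_True mult_ac)
    also have "q ^ ((r - 1) * (n - 1) * (d - n)) * q ^ ((r - 1) * (n - 1)) = q ^ ((r - 1) * (n - 1) * (d - n + 1))"
      by (simp only: power_add[symmetric] distrib_left mult_1_right)
    finally have "D * w 0 = q_binomial q (d - 1) (n - 1) * q_int q n * q ^ ((r - 1) * (n - 1) * (d - n + 1))" .
    then show ?thesis using 0 by (simp add: lam_def W_def)
  next
    case (Suc i)
    have i: "i < r" using Suc j by simp
    let ?\<alpha> = "if i = 0 then real (q_int q n) else a" and ?\<beta> = "if i = 0 then real (q_int q d) else b"
    define e where "e = Q ^ (d - n)"
    \<comment> \<open>The quotient \<open>(\<beta> - \<alpha>) / (\<beta> - 1)\<close> has this one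
      value at every level: it is \<open>(b - a) / (b - 1)\<close> from level 2 on and
      \<open>([d] - [n]) / ([d] - 1)\<close> at level 1, where a common factor
      \<open>q / (q - 1)\<close> cancels.\<close>
    define c where "c = a * (e - 1) / (b - 1)"
    have be: "b = a * e" unfolding a_def b_def e_def using n by (simp add: power_add[symmetric])
    have c: "?\<beta> - ?\<alpha> = c * (?\<beta> - 1)"
    proof (cases "i = 0")
      case True
      have iq: "real (q_int q m) = (Q ^ m - 1) / (Q - 1)" for m using q_int_exact[OF q2] by (simp add: Q_def)
      have qn: "Q ^ n = Q * a" and qdd: "Q ^ d = Q * b"
        unfolding a_def b_def using n by (simp_all add: power_Suc[symmetric] del: power_Suc)
      have 1: "real (q_int q d) - real (q_int q n) = Q * a * (e - 1) / (Q - 1)"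
        unfolding iq qn qdd be by (simp add: diff_divide_distrib[symmetric] algebra_simps)
      have 2: "real (q_int q d) - 1 = Q * (b - 1) / (Q - 1)"
        unfolding iq qdd using Q2 by (simp add: field_simps)
      show ?thesis using True ab 1 2 by (simp add: c_def)
    next
      case False
      have "c * (b - 1) = a * (e - 1)" using ab by (simp add: c_def)
      then show ?thesis using False be by (simp add: right_diff_distrib)
    qed
    have "W j - s j * ?N' j = W (Suc i) - s (Suc i) * ((W i - W (Suc i)) / (real (s i) - real (s (Suc i))))"
      using i s_less[OF i] by (simp add: Suc N_def)
    also have "\<dots> = W (Suc i) - s (Suc i) * ((W (Suc i) * ?\<alpha> - W (Suc i)) / (s (Suc i) * ?\<beta> - s (Suc i)))"
      unfolding s_ratio[OF i] W_def of_nat_mult w_ratio[OF i] by (simp only: mult.assoc)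
    also have "\<dots> = W (Suc i) * c"
      using s_pos[of i] beta[of i] c by (rule eigenvalue_from_sums)
    also have "\<dots> = lam j"
    proof -
      let ?b1 = "real (q_binomial q (d - 1) (n - 1))" and ?b2 = "real (q_binomial q (d - 2) (n - 1))"
      have b12: "?b2 * (b - 1) = ?b1 * (e - 1)"
        using q_binomial_pred_real[OF q2 n] unfolding b_def e_def Q_def .
      have "?b1 * c = a * (?b1 * (e - 1)) / (b - 1)" by (simp add: c_def)
      \<comment> \<open>The binomial of the degree becomes the one with \<open>d - 2\<close> and
        leaves a factor \<open>a = q^(n-1)\<close>; that factor is the \<open>+ 1\<close> in the
        exponent \<open>(r - j + 1) * (n - 1)\<close>.\<close>
      then have bc: "?b1 * c = ?b2 * a" unfolding b12[symmetric] using ab by simp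
      have "W (Suc i) * c = (?b1 * c) * Q ^ ((r - 1) * (n - 1) * (d - n)) * a ^ (r - j)"
        unfolding W_def of_nat_mult wQ Dform Suc by (simp add: Q_def)
      also have "\<dots> = ?b2 * (Q ^ ((r - 1) * (n - 1) * (d - n)) * (a ^ (r - j) * a))"
        unfolding bc by (simp only: mult_ac)
      also have "a ^ (r - j) * a = Q ^ ((r - j + 1) * (n - 1))"
        unfolding a_def by (simp add: power_mult[symmetric] power_add mult.commute)
      finally show ?thesis using Suc by (simp add: lam_def Q_def power_add mult_ac)
    qed
    finally show ?thesis .
  qed
  have lam_pos: "lam j > 0" for j
  proof -
    have "q_binomial q (d - 2) (n - 1) > 0" "q_binomial q (d - 1) (n - 1) > 0"
      using n by (auto intro!: q_binomial_pos[OF q2])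
    then show ?thesis using q2 qd(2) by (simp add: lam_def)
  qed
  \<comment> \<open>The number of lines modulo \<open>p^j\<close>; consecutive differences are the
    multiplicities.\<close>
  define c where "c j = (if j = 0 then 1 else q_int q d * q ^ ((j - 1) * (d - 1)))" for j :: nat
  have num: "(if j < r then H.num_classes j else length ls) = c j" if j: "j \<le> r" for j
  proof (cases "j < r")
    case True
    have *: "H.num_classes j * s j = card L" using H.num_classes_times_size[OF True] len by simp
    show ?thesis
    proof (cases "j = 0")
      case True
      then show ?thesis using * Lpos \<open>j < r\<close> by (simp add: s_def c_def)
    next
      case False
      have "(j - 1) * (d - 1) + (r - j) * (d - 1) = (r - 1) * (d - 1)"
        using False j by (simp add: distrib_right[symmetric])
      then have "c j * s j = card L" using False unfolding c_def s_def cL by (simp add: power_add[symmetric])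
      moreover have "s j > 0" using False q2 by (simp add: s_def)
      ultimately show ?thesis using * \<open>j < r\<close> by (metis mult_cancel2 neq0_conv)
    qed
  next
    case False
    then show ?thesis using j length_pos len cL by (simp add: c_def)
  qed
  have mlt_eq: "H.mlt j = mlt j" if j: "j \<le> r" for j
  proof (cases j)
    case 0
    then show ?thesis using num[of 0] by (simp add: H.mlt_def H.coarser_num_def mlt_def c_def)
  next
    case (Suc i)
    have i: "i < r" using Suc j by simp
    have "H.coarser_num j = c i" using num[of i] i Suc by (simp add: H.coarser_num_def)
    then have "H.mlt j = c (Suc i) - c i" unfolding H.mlt_def num[OF j] using Suc by simp
    also have "\<dots> = mlt j"
    proof (cases i)
      case 0
      then show ?thesis using Suc by (simp add: c_def mlt_def)
    next
      case (Suc h)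
      have ex: "(Suc i - 1) * (d - 1) = h * (d - 1) + (d - 1)" "(i - 1) * (d - 1) = h * (d - 1)"
        unfolding Suc by simp_all
      have "c (Suc i) = q_int q d * (q ^ (h * (d - 1)) * q ^ (d - 1))" "c i = q_int q d * q ^ (h * (d - 1))"
        unfolding c_def ex power_add using Suc by simp_all
      then have "c (Suc i) - c i = q_int q d * (q ^ (h * (d - 1)) * q ^ (d - 1) - q ^ (h * (d - 1)))"
        by (simp only: diff_mult_distrib2)
      also have "\<dots> = q_int q d * (q ^ (h * (d - 1)) * (q ^ (d - 1) - 1))" by (simp add: diff_mult_distrib2)
      finally show ?thesis using Suc \<open>j = Suc i\<close> by (simp add: mlt_def mult_ac)
    qed
    finally show ?thesis .
  qed
  have "char_poly (kernel_mat ls f) = (\<Prod>j\<le>r. [:- lam j, 1:] ^ mlt j)"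
    unfolding cp using lam_eq mlt_eq by (intro prod.cong) auto
  then have "adjacency_spectrum (L \<union> Xn) (fr_proj_adj R d)
       = (\<Sum>j\<le>r. pm_mset (mlt j) (sqrt (lam j))) + replicate_mset (card Xn - card L) 0"
    unfolding f_def using lam_pos
    by (intro adjacency_spectrum_bipartite[OF fin G(2,3,4,5) ls]) auto
  then show ?thesis unfolding G(1) cX cL by (simp only: mult.commute[of "r - 1" "d - 1"])
qed

end

text \<open>With a finite residue ring, \<open>P = 0\<close> would force a finite field, in which
  all positive powers of \<open>P\<close> coincide; hence \<open>P\<close> is assumed nonzero. The
  approximation of the expansion is made precise as a relative error of at most \<open>1/q\<close>,
  uniformly in \<open>r\<close>, \<open>d\<close> and \<open>n\<close>.\<close>

theorem theorem5p1:
  fixes R :: "('a, 'b) ring_scheme" and P :: "'a set" and q r d n :: nat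
  assumes "dedekind_domain R"
    and "primeideal P R" and "P \<noteq> {\<zero>\<^bsub>R\<^esub>}"
    and "finite (carrier (R Quot P))" and "card (carrier (R Quot P)) = q"
    and "1 \<le> r" and "2 \<le> n" and "n \<le> d - 1"
  defines "S \<equiv> quot_ring_pow R P r"
  defines "Sp \<equiv> adjacency_spectrum (X1n_vertices S d n) (fr_proj_adj S d)"
  shows "Sp =
      pm_mset 1 (sqrt (q_binomial q (d - 1) (n - 1) * q_int q n *
                       q ^ ((r - 1) * (n - 1) * (d - n + 1))))
    + pm_mset (q_int q d - 1)
        (sqrt (q_binomial q (d - 2) (n - 1) * q ^ ((n - 1) * (r - 1) * (d - n) + r * (n - 1))))
    + (\<Sum>k<r - 1.
        pm_mset (q ^ ((r - 2 - k) * (d - 1)) * (q ^ (d - 1) - 1) * q_int q d)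
          (sqrt (q_binomial q (d - 2) (n - 1) * q ^ ((n - 1) * (r - 1) * (d - n)) *
                 q ^ ((k + 1) * (n - 1)))))
    + replicate_mset
        (q_binomial q d n * q ^ ((r - 1) * n * (d - n)) - q_int q d * q ^ ((d - 1) * (r - 1))) 0
    \<and> \<bar>spectral_expansion Sp - 1 / sqrt (q ^ (n - 1))\<bar> \<le> 1 / q * (1 / sqrt (q ^ (n - 1)))"
proof -
  obtain p where S: "finite_chain_ring S p r"
    and card: "card (ring.multiples S (p [^]\<^bsub>S\<^esub> (r - 1))) = q"
    using dedekind_domain.quot_ring_pow_chain_ring[OF assms(1-4) assms(6)] assms(5) unfolding S_def by metis
  interpret S: finite_chain_ring S p r by (rule S)
  have q: "S.residue_order = q" using card by (simp add: S.residue_order_def)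
  have q2: "q \<ge> 2" using S.residue_order_ge_2 q by simp
  define lam where "lam j = (if j = 0
      then real (q_binomial q (d - 1) (n - 1) * q_int q n * q ^ ((r - 1) * (n - 1) * (d - n + 1)))
      else real (q_binomial q (d - 2) (n - 1) * q ^ ((n - 1) * (r - 1) * (d - n) + (r - j + 1) * (n - 1))))"
    for j :: nat
  define mlt where "mlt j = (if j = 0 then 1 else if j = 1 then q_int q d - 1
      else q ^ ((j - 2) * (d - 1)) * (q ^ (d - 1) - 1) * q_int q d)" for j :: nat
  let ?z = "q_binomial q d n * q ^ ((r - 1) * n * (d - n)) - q_int q d * q ^ ((d - 1) * (r - 1))"
  have Sp: "Sp = (\<Sum>j\<le>r. pm_mset (mlt j) (sqrt (lam j))) + replicate_mset ?z 0"
    using S.X1n_spectrum[OF assms(7,8)] unfolding q Sp_def lam_def mlt_def .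
  have "(\<Sum>j\<le>r. pm_mset (mlt j) (sqrt (lam j)))
      = pm_mset (mlt 0) (sqrt (lam 0)) + pm_mset (mlt 1) (sqrt (lam 1))
        + (\<Sum>j\<in>{2..r}. pm_mset (mlt j) (sqrt (lam j)))"
  proof -
    have "{..r} = insert 0 (insert 1 {2..r})" using assms(6) by auto
    then show ?thesis by (simp add: add.assoc)
  qed
  \<comment> \<open>The substitution \<open>k = r - j\<close> lists the deepest level first.\<close>
  also have "(\<Sum>j\<in>{2..r}. pm_mset (mlt j) (sqrt (lam j)))
      = (\<Sum>k<r - 1. pm_mset (mlt (r - k)) (sqrt (lam (r - k))))"
    by (rule sum.reindex_bij_witness[of _ "\<lambda>k. r - k" "\<lambda>j. r - j"]) auto
  also have "\<dots> = (\<Sum>k<r - 1. pm_mset (q ^ ((r - 2 - k) * (d - 1)) * (q ^ (d - 1) - 1) * q_int q d)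
          (sqrt (q_binomial q (d - 2) (n - 1) * q ^ ((n - 1) * (r - 1) * (d - n)) * q ^ ((k + 1) * (n - 1)))))"
  proof (rule sum.cong)
    fix k assume "k \<in> {..<r - 1}"
    then have k: "r - k \<noteq> 0" "r - k \<noteq> 1" "r - k - 2 = r - 2 - k" "r - (r - k) + 1 = k + 1" by auto
    show "pm_mset (mlt (r - k)) (sqrt (lam (r - k)))
        = pm_mset (q ^ ((r - 2 - k) * (d - 1)) * (q ^ (d - 1) - 1) * q_int q d)
          (sqrt (q_binomial q (d - 2) (n - 1) * q ^ ((n - 1) * (r - 1) * (d - n)) * q ^ ((k + 1) * (n - 1))))"
      unfolding mlt_def lam_def k using k(1,2) by (simp add: power_add mult_ac)
  qed simp
  finally have sum: "Sp = pm_mset (mlt 0) (sqrt (lam 0)) + pm_mset (mlt 1) (sqrt (lam 1))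
      + (\<Sum>k<r - 1. pm_mset (q ^ ((r - 2 - k) * (d - 1)) * (q ^ (d - 1) - 1) * q_int q d)
          (sqrt (q_binomial q (d - 2) (n - 1) * q ^ ((n - 1) * (r - 1) * (d - n)) * q ^ ((k + 1) * (n - 1)))))
      + replicate_mset ?z 0" unfolding Sp by simp
  have m01: "mlt 0 = 1" "mlt 1 = q_int q d - 1" by (simp_all add: mlt_def)
  have l0: "lam 0 = real (q_binomial q (d - 1) (n - 1)) * real (q_int q n) * real q ^ ((r - 1) * (n - 1) * (d - n + 1))"
    by (simp add: lam_def)
  have l1: "lam 1 = real (q_binomial q (d - 2) (n - 1)) * real q ^ ((n - 1) * (r - 1) * (d - n) + r * (n - 1))"
    using assms(6) by (simp add: lam_def)
  define a where "a = real q ^ (n - 1)"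
  have a1: "a > 1" unfolding a_def using q2 assms(7) by (intro one_less_power) auto
  define \<rho> where "\<rho> = lam 1 / lam 0"
  have b_pos: "q_binomial q (d - 2) (n - 1) > 0" "q_binomial q (d - 1) (n - 1) > 0" "q_int q n > 0"
    using assms(7,8) by (auto intro!: q_binomial_pos[OF q2] q_int_pos[OF q2])
  have lam_pos: "lam j > 0" for j using b_pos q2 by (simp add: lam_def)
  have bounds: "(1 - 1 / q)\<^sup>2 \<le> \<rho> * a" "\<rho> * a \<le> 1"
  proof -
    let ?b1 = "real (q_binomial q (d - 1) (n - 1))" and ?b2 = "real (q_binomial q (d - 2) (n - 1))"
    let ?e = "(r - 1) * (n - 1) * (d - n + 1)"
    \<comment> \<open>The exponents of q in \<open>lam 1\<close> and \<open>lam 0\<close> differ by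
      \<open>n - 1\<close>, so the ratio of the two does not depend on \<open>r\<close>.\<close>
    have e: "(n - 1) * (r - 1) * (d - n) + r * (n - 1) = ?e + (n - 1)"
    proof -
      obtain r' where r': "r = Suc r'" using assms(6) by (cases r) auto
      have "m * r' * k + Suc r' * m = r' * m * (k + 1) + m" for m k by (simp add: algebra_simps)
      then show ?thesis unfolding r' by simp
    qed
    have d1: "real q ^ (d - 1) - 1 > 0"
      using q2 assms(7,8) by (simp add: one_less_power)
    have r1: "?b2 / ?b1 = (real q ^ (d - n) - 1) / (real q ^ (d - 1) - 1)"
      using q_binomial_pred_real[OF q2 assms(7,8)] b_pos d1 by (simp add: field_simps)
    have "\<rho> = (?b2 / ?b1) * (1 / real (q_int q n)) * a"
      unfolding \<rho>_def l0 l1 e power_add a_def using q2 b_pos by (simp add: field_simps)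
    also have "1 / real (q_int q n) = (real q - 1) / (real q ^ n - 1)"
      using q_int_exact[OF q2, of n] by simp
    finally have rho: "\<rho> = (real q ^ (d - n) - 1) / (real q ^ (d - 1) - 1) * ((real q - 1) / (real q ^ n - 1)) * real q ^ (n - 1)"
      unfolding r1 a_def .
    have "2 \<le> real q" using q2 by simp
    then show "(1 - 1 / q)\<^sup>2 \<le> \<rho> * a" "\<rho> * a \<le> 1"
      unfolding rho a_def using assms(7,8) by (rule expansion_ratio_bounds)+
  qed
  have rho_pos: "\<rho> > 0" unfolding \<rho>_def using lam_pos by simp
  have top: "lam 1 < lam 0"
  proof -
    have "\<rho> < \<rho> * a" using rho_pos a1 by simp
    then have "\<rho> < 1" using bounds(2) by linarith
    then show ?thesis unfolding \<rho>_def using lam_pos[of 0] by (simp add: divide_less_eq)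
  qed
  have second: "lam j \<le> lam 1" if "1 \<le> j" "j \<le> r" for j
  proof -
    have "r - j + 1 \<le> r" using that by simp
    then have "(n - 1) * (r - 1) * (d - n) + (r - j + 1) * (n - 1) \<le> (n - 1) * (r - 1) * (d - n) + r * (n - 1)"
      by (intro add_left_mono mult_le_mono1)
    then have "real q ^ ((n - 1) * (r - 1) * (d - n) + (r - j + 1) * (n - 1))
        \<le> real q ^ ((n - 1) * (r - 1) * (d - n) + r * (n - 1))"
      using q2 by (intro power_increasing) auto
    then show ?thesis unfolding l1 using that(1) by (simp add: lam_def mult_left_mono)
  qed
  have "q_int q d \<ge> 2"
    using q2 assms(7,8) q_int_add[OF q2, of 1 "d - 1"] q_int_pos[OF q2, of "d - 1"] by (simp add: q_int_def)
  then have "spectral_expansion Sp = sqrt \<rho>"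
    unfolding \<rho>_def using spectral_expansion_pm[OF Sp assms(6) _ _ lam_pos top second] m01 by simp
  \<comment> \<open>Square roots of the bounds on \<open>\<rho> * a\<close> place
    \<open>sqrt \<rho>\<close> between \<open>(1 - 1/q) / sqrt a\<close> and
    \<open>1 / sqrt a\<close>.\<close>
  moreover have "\<bar>sqrt \<rho> - 1 / sqrt a\<bar> \<le> 1 / q * (1 / sqrt a)"
  proof -
    have sa: "sqrt a > 0" using a1 by simp
    have "sqrt \<rho> * sqrt a \<le> 1" using bounds(2) by (simp add: real_sqrt_mult[symmetric])
    then have hi: "sqrt \<rho> \<le> 1 / sqrt a" using sa by (simp add: field_simps)
    have "0 \<le> 1 - 1 / real q" using q2 by simp
    then have "1 - 1 / real q \<le> sqrt (\<rho> * a)" using bounds(1) by (intro real_le_rsqrt)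
    then have "1 - 1 / real q \<le> sqrt \<rho> * sqrt a" by (simp add: real_sqrt_mult)
    then have lo: "(1 - 1 / real q) * (1 / sqrt a) \<le> sqrt \<rho>" using sa by (simp add: field_simps)
    have "(1 - 1 / real q) * (1 / sqrt a) = 1 / sqrt a - 1 / real q * (1 / sqrt a)"
      by (simp only: left_diff_distrib mult_1_left)
    moreover have "0 \<le> 1 / real q * (1 / sqrt a)" using sa by simp
    ultimately show ?thesis using hi lo by linarith
  qed
  ultimately have "\<bar>spectral_expansion Sp - 1 / sqrt (q ^ (n - 1))\<bar> \<le> 1 / q * (1 / sqrt (q ^ (n - 1)))"
    unfolding a_def by simp
  moreover have "sqrt (lam 0) = sqrt (q_binomial q (d - 1) (n - 1) * q_int q n * q ^ ((r - 1) * (n - 1) * (d - n + 1)))"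
    "sqrt (lam 1) = sqrt (q_binomial q (d - 2) (n - 1) * q ^ ((n - 1) * (r - 1) * (d - n) + r * (n - 1)))"
    unfolding l0 l1 by simp_all
  ultimately show ?thesis using sum unfolding m01 by simp
qed

end
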